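(* Let $\Gamma=(X,\mathcal{R})$ be a non-bipartite distance-regular graph with classical parameters $(D,q,\alpha,\beta)$, where $D\ge 4$ and $q\ge 2$, and fix $x\in X$. Let $T=T(x)$ be the Terwilliger algebra of $\Gamma$ with respect to $x$. Assume that every irreducible $T$-module with endpoint $1$ is thin and that $\Gamma$ supports a uniform structure with respect to $x$. Then either $\alpha=0$, or $D\equiv0\pmod 6$ and $\Gamma$ has classical parameters $\left(D,q,q,\frac{q^2(q^D-1)}{q-1}\right)$.
   Context: All graphs are finite, simple, connected, undirected; $\partial$ denotes path-length distance. $\Gamma$ is distance-regular with diameter $D$ if for all $0\le h,i,j\le D$ and all $y,z$ with $\partial(y,z)=h$ the number $p^h_{ij}=|\{w:\partial(y,w)=i,\ \partial(z,w)=j\}|$ depends only on $h,i,j$; write $c_i=p^i_{1,i-1}$, $b_i=p^i_{1,i+1}$. $\Gamma$ has classical parameters $(D,q,\alpha,\beta)$ if $c_i=[i](1+\alpha[i-1])$ for $1\le i\le D$ and $b_i=([D]-[i])(\beta-\alpha[i])$ for $0\le i\le D-1$, where $[j]=1+q+\cdots+q^{j-1}$. Let $V=\mathbb{C}^X$ and $A$ the adjacency matrix. For fixed $x$ and $0\le i\le D$, $E_i^*$ is the diagonal matrix with $(y,y)$-entry $1$ if $\partial(x,y)=i$ and $0$ otherwise. $T=T(x)$ is the algebra generated by $A$ and $E_0^*,\dots,E_D^*$. A $T$-module is a subspace $W\subseteq V$ with $TW\subseteq W$; irreducible if $W\ne0$ with only submodules $0,W$; its endpoint is $\min\{i:E_i^*W\ne0\}$;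 thin if $\dim E_i^*W\le1$ for all $i$. $L=\sum_{i=1}^{D}E^*_{i-1}AE^*_i$, $R=\sum_{i=0}^{D-1}E^*_{i+1}AE^*_i$. $\Gamma$ supports a uniform structure with respect to $x$ if there exist a tridiagonal complex matrix $U=(e_{ij})_{1\le i,j\le D}$ with $e_{ii}=1$, such that either $e_{i,i-1}\ne0$ for all $2\le i\le D$ or $e_{i-1,i}\ne0$ for all $2\le i\le D$, and every principal submatrix $(e_{ij})_{s\le i,j\le t}$ is nonsingular, and scalars $f_1,\dots,f_D$ such that, with $e_i^-=e_{i,i-1}$ ($e_1^-=0$) and $e_i^+=e_{i,i+1}$ ($e_D^+=0$), $e_i^-RL^2+LRL+e_i^+L^2R=f_iL$ holds on $E_i^*V$ for $1\le i\le D$. *)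

theory Defs
  imports "HOL-Analysis.Analysis" "Jordan_Normal_Form.Determinant"
begin

text \<open>A graph is given by its adjacency relation on a finite vertex type; the vertex set is the
  whole type.\<close>

definition connected_simple_graph :: "('a::finite \<Rightarrow> 'a \<Rightarrow> bool) \<Rightarrow> bool" where
  "connected_simple_graph E \<longleftrightarrow> symp E \<and> irreflp E \<and> (\<forall>y z. E\<^sup>*\<^sup>* y z)"

definition bipartite :: "('a::finite \<Rightarrow> 'a \<Rightarrow> bool) \<Rightarrow> bool" where
  "bipartite E \<longleftrightarrow> (\<exists>S. \<forall>y z. E y z \<longrightarrow> (y \<in> S \<longleftrightarrow> z \<notin> S))"

definition path_dist :: "('a::finite \<Rightarrow> 'a \<Rightarrow> bool) \<Rightarrow> 'a \<Rightarrow> 'a \<Rightarrow> nat" where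
  "path_dist E y z = (LEAST n. (E ^^ n) y z)"

definition graph_diameter :: "('a::finite \<Rightarrow> 'a \<Rightarrow> bool) \<Rightarrow> nat" where
  "graph_diameter E = Max {path_dist E y z | y z. True}"

definition distance_regular :: "('a::finite \<Rightarrow> 'a \<Rightarrow> bool) \<Rightarrow> bool" where
  "distance_regular E \<longleftrightarrow>
     (\<forall>h\<le>graph_diameter E. \<forall>i\<le>graph_diameter E. \<forall>j\<le>graph_diameter E. \<exists>p. \<forall>y z.
        path_dist E y z = h \<longrightarrow> card {w. path_dist E y w = i \<and> path_dist E z w = j} = p)"

text \<open>The number \<open>p\<^sup>h\<^sub>i\<^sub>j\<close>; it is well determined if \<open>E\<close> is distance-regular and \<open>h\<close> is at most the
  diameter, and is not used otherwise.\<close>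

definition intersection_number :: "('a::finite \<Rightarrow> 'a \<Rightarrow> bool) \<Rightarrow> nat \<Rightarrow> nat \<Rightarrow> nat \<Rightarrow> nat" where
  "intersection_number E h i j =
     (THE p. \<forall>y z. path_dist E y z = h \<longrightarrow>
        card {w. path_dist E y w = i \<and> path_dist E z w = j} = p)"

definition qbracket :: "real \<Rightarrow> nat \<Rightarrow> real" where
  "qbracket q j = (\<Sum>k<j. q ^ k)"

definition has_classical_parameters ::
    "('a::finite \<Rightarrow> 'a \<Rightarrow> bool) \<Rightarrow> nat \<Rightarrow> real \<Rightarrow> real \<Rightarrow> real \<Rightarrow> bool" where
  "has_classical_parameters E D q \<alpha> \<beta> \<longleftrightarrow>
     graph_diameter E = D \<and>
     (\<forall>i\<in>{1..D}. real (intersection_number E i 1 (i - 1)) =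
        qbracket q i * (1 + \<alpha> * qbracket q (i - 1))) \<and>
     (\<forall>i<D. real (intersection_number E i 1 (i + 1)) =
        (qbracket q D - qbracket q i) * (\<beta> - \<alpha> * qbracket q i))"

text \<open>Square matrices with rows and columns indexed by the vertices act on the standard module
  \<open>V = complex ^ 'a\<close>.\<close>

definition adjacency_matrix :: "('a::finite \<Rightarrow> 'a \<Rightarrow> bool) \<Rightarrow> complex ^ 'a ^ 'a" where
  "adjacency_matrix E = (\<chi> y z. if E y z then 1 else 0)"

definition dual_idempotent ::
    "('a::finite \<Rightarrow> 'a \<Rightarrow> bool) \<Rightarrow> 'a \<Rightarrow> nat \<Rightarrow> complex ^ 'a ^ 'a" where
  "dual_idempotent E x i = (\<chi> y z. if y = z \<and> path_dist E x y = i then 1 else 0)"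

definition matrix_scale :: "complex \<Rightarrow> complex ^ 'a::finite ^ 'a \<Rightarrow> complex ^ 'a ^ 'a" where
  "matrix_scale c M = (\<chi> y. c *s vec_nth M y)"

inductive_set terwilliger_algebra ::
    "('a::finite \<Rightarrow> 'a \<Rightarrow> bool) \<Rightarrow> 'a \<Rightarrow> (complex ^ 'a ^ 'a) set"
  for E :: "'a::finite \<Rightarrow> 'a \<Rightarrow> bool" and x :: 'a where
  adjacency: "adjacency_matrix E \<in> terwilliger_algebra E x"
| dual: "i \<le> graph_diameter E \<Longrightarrow> dual_idempotent E x i \<in> terwilliger_algebra E x"
| one: "Finite_Cartesian_Product.mat 1 \<in> terwilliger_algebra E x"
| add: "M \<in> terwilliger_algebra E x \<Longrightarrow> N \<in> terwilliger_algebra E x \<Longrightarrow>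
    M + N \<in> terwilliger_algebra E x"
| scale: "M \<in> terwilliger_algebra E x \<Longrightarrow> matrix_scale c M \<in> terwilliger_algebra E x"
| mult: "M \<in> terwilliger_algebra E x \<Longrightarrow> N \<in> terwilliger_algebra E x \<Longrightarrow>
    M ** N \<in> terwilliger_algebra E x"

text \<open>Note that \<open>vec.subspace\<close> and \<open>vec.dim\<close> refer to complex scalars here, whereas plain
  \<open>subspace\<close> and \<open>dim\<close> would refer to real scalars.\<close>

definition T_module ::
    "('a::finite \<Rightarrow> 'a \<Rightarrow> bool) \<Rightarrow> 'a \<Rightarrow> (complex ^ 'a) set \<Rightarrow> bool" where
  "T_module E x W \<longleftrightarrow>
     vec.subspace W \<and> (\<forall>M\<in>terwilliger_algebra E x. \<forall>w\<in>W. M *v w \<in> W)"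

definition irreducible_T_module ::
    "('a::finite \<Rightarrow> 'a \<Rightarrow> bool) \<Rightarrow> 'a \<Rightarrow> (complex ^ 'a) set \<Rightarrow> bool" where
  "irreducible_T_module E x W \<longleftrightarrow>
     T_module E x W \<and> W \<noteq> {0} \<and>
     (\<forall>W'. T_module E x W' \<and> W' \<subseteq> W \<longrightarrow> W' = {0} \<or> W' = W)"

definition module_endpoint ::
    "('a::finite \<Rightarrow> 'a \<Rightarrow> bool) \<Rightarrow> 'a \<Rightarrow> (complex ^ 'a) set \<Rightarrow> nat" where
  "module_endpoint E x W =
     Min {i. i \<le> graph_diameter E \<and> (\<lambda>w. dual_idempotent E x i *v w) ` W \<noteq> {0}}"

definition thin_module ::
    "('a::finite \<Rightarrow> 'a \<Rightarrow> bool) \<Rightarrow> 'a \<Rightarrow> (complex ^ 'a) set \<Rightarrow> bool" where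
  "thin_module E x W \<longleftrightarrow>
     (\<forall>i\<le>graph_diameter E. vec.dim ((\<lambda>w. dual_idempotent E x i *v w) ` W) \<le> 1)"

definition lowering_matrix :: "('a::finite \<Rightarrow> 'a \<Rightarrow> bool) \<Rightarrow> 'a \<Rightarrow> complex ^ 'a ^ 'a" where
  "lowering_matrix E x =
     (\<Sum>i=1..graph_diameter E.
        dual_idempotent E x (i - 1) ** adjacency_matrix E ** dual_idempotent E x i)"

definition raising_matrix :: "('a::finite \<Rightarrow> 'a \<Rightarrow> bool) \<Rightarrow> 'a \<Rightarrow> complex ^ 'a ^ 'a" where
  "raising_matrix E x =
     (\<Sum>i<graph_diameter E.
        dual_idempotent E x (i + 1) ** adjacency_matrix E ** dual_idempotent E x i)"

text \<open>A matrix \<open>U = (e\<^sub>i\<^sub>j)\<close> with \<open>1 \<le> i, j \<le> D\<close> is represented by the function \<open>e\<close>, whose values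
  at other indices are irrelevant. The block with rows and columns \<open>s, \<dots>, t\<close> becomes a matrix of
  size \<open>t + 1 - s\<close> with indices starting at 0.\<close>

definition principal_block :: "(nat \<Rightarrow> nat \<Rightarrow> complex) \<Rightarrow> nat \<Rightarrow> nat \<Rightarrow> complex Matrix.mat" where
  "principal_block e s t =
     Matrix.mat (t + 1 - s) (t + 1 - s) (\<lambda>(i, j). e (s + i) (s + j))"

definition parameter_matrix :: "nat \<Rightarrow> (nat \<Rightarrow> nat \<Rightarrow> complex) \<Rightarrow> bool" where
  "parameter_matrix D e \<longleftrightarrow>
     (\<forall>i\<in>{1..D}. \<forall>j\<in>{1..D}. i + 1 < j \<or> j + 1 < i \<longrightarrow> e i j = 0) \<and>
     (\<forall>i\<in>{1..D}. e i i = 1) \<and>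
     ((\<forall>i\<in>{2..D}. e i (i - 1) \<noteq> 0) \<or> (\<forall>i\<in>{2..D}. e (i - 1) i \<noteq> 0)) \<and>
     (\<forall>s t. 1 \<le> s \<and> s \<le> t \<and> t \<le> D \<longrightarrow> invertible_mat (principal_block e s t))"

definition e_minus :: "(nat \<Rightarrow> nat \<Rightarrow> complex) \<Rightarrow> nat \<Rightarrow> complex" where
  "e_minus e i = (if i = 1 then 0 else e i (i - 1))"

definition e_plus :: "nat \<Rightarrow> (nat \<Rightarrow> nat \<Rightarrow> complex) \<Rightarrow> nat \<Rightarrow> complex" where
  "e_plus D e i = (if i = D then 0 else e i (i + 1))"

definition supports_uniform_structure :: "('a::finite \<Rightarrow> 'a \<Rightarrow> bool) \<Rightarrow> 'a \<Rightarrow> bool" where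
  "supports_uniform_structure E x \<longleftrightarrow>
     (let D = graph_diameter E; L = lowering_matrix E x; R = raising_matrix E x in
      \<exists>e f. parameter_matrix D e \<and>
        (\<forall>i\<in>{1..D}. \<forall>v\<in>range (\<lambda>w. dual_idempotent E x i *v w).
           e_minus e i *s ((R ** L ** L) *v v) + (L ** R ** L) *v v
             + e_plus D e i *s ((L ** L ** R) *v v) = f i *s (L *v v)))"

end

theory Submission
  imports Defs
begin

text \<open>
  A thin irreducible module of endpoint 1 is determined by its local eigenvalue, that is, its eigenvalue for the
  subgraph induced on the neighbours of \<open>x\<close>. The tridiagonal relation between \<open>A\<close> and a dual adjacency matrix
  leaves four possible local eigenvalues; two of them belong to modules that reach distance \<open>D\<close> from \<open>x\<close>, the
  other two to modules that stop at distance \<open>D - 1\<close>. If \<open>\<alpha> \<noteq> 0\<close>, then a uniform structure tolerates at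
  most one value of each kind, because its nonsingular blocks determine the eigenvalues of \<open>L R\<close> on a module.
  Hence the local graph is strongly regular, and the equation between its parameters leaves only
  \<open>\<beta> = \<alpha> (1 + q + \<dots> + q\<^sup>D) - q\<close>, with \<open>\<alpha> (q + 1)\<close> a positive integer.

  This case is impossible. On vectors supported at distance \<open>D\<close> the uniform structure expresses
  \<open>R L\<^sup>j\<^sup>+\<^sup>1\<close> as \<open>L\<^sup>j\<close> times an affine function of \<open>R L\<close>. Since \<open>R L\<close> is positive semidefinite, no
  submodule reaches from distance 2 to distance \<open>D\<close>. Comparing the norms of \<open>L\<^sup>D\<^sup>-\<^sup>1 y\<close> and
  \<open>L\<^sup>D\<^sup>-\<^sup>2 y\<close> for a vertex \<open>y\<close> at distance \<open>D\<close> from \<open>x\<close> then gives a contradiction. So \<open>\<alpha> = 0\<close> holds in all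
  cases and the second alternative of the theorem never occurs.
\<close>

section \<open>Distances and intersection numbers\<close>

text \<open>Frees \<open>$\<close> and \<open>\<bullet>\<close> for the Cartesian vectors of HOL-Analysis.\<close>

no_notation Matrix.vec_index (infixl "$" 100)
no_notation Matrix.scalar_prod (infix "\<bullet>" 70)

text \<open>The exceptional family needs an argument of its own because the local graph does not
  remove it: for \<alpha> = q it consists of exactly the parameters of the second alternative, and
  the equation of the strongly regular local graph holds identically on it. What helps is that the
  rows of a uniform structure hold on the whole space, hence also on modules of larger endpoint,
  about which nothing is assumed. The chain with local eigenvalue
  \<open>\<alpha> * (br D - 1) - 1\<close> and the primary module give two solutions of these rows,
  and interpolating between them in \<open>Rop \<circ> Lop\<close> controls every vector at distance
  D. The integer \<alpha> (q + 1) is the number of common neighbours, inside the local graph, of two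
  nonadjacent vertices; the final inequalities rest on its being at least 1. No theory of
  Q-polynomial graphs is presupposed: the dual eigenvalues are written down and checked, and the
  tridiagonal relation is obtained by showing that a real matrix has zero sum of squares.\<close>

lemma relpowp_path_dist:
  assumes "connected_simple_graph E"
  shows "(E ^^ path_dist E y z) y z"
proof -
  have "E\<^sup>*\<^sup>* y z" using assms by (simp add: connected_simple_graph_def)
  then obtain n where "(E ^^ n) y z" using rtranclp_imp_relpowp by metis
  then show ?thesis unfolding path_dist_def by (rule LeastI)
qed

lemma path_dist_le: "(E ^^ n) y z \<Longrightarrow> path_dist E y z \<le> n"
  unfolding path_dist_def by (rule Least_le)

lemma path_dist_commute:
  assumes "connected_simple_graph E"
  shows "path_dist E y z = path_dist E z y"
proof -
  have "symp E" using assms by (simp add: connected_simple_graph_def)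
  then have "(E ^^ n) y z \<Longrightarrow> (E ^^ n) z y" for n y z
  proof (induction n arbitrary: y z)
    case (Suc n)
    then obtain w where "(E ^^ n) y w" "E w z" by auto
    then have "(E ^^ n) w y" "E z w" using Suc by (auto dest: sympD)
    then show ?case by (metis relpowp_Suc_I2)
  qed simp
  then have "path_dist E y z \<le> path_dist E z y" for y z
    using path_dist_le relpowp_path_dist[OF assms] by metis
  then show ?thesis by (simp add: le_antisym)
qed

lemma path_dist_eq_0_iff:
  assumes "connected_simple_graph E"
  shows "path_dist E y z = 0 \<longleftrightarrow> y = z"
proof
  show "path_dist E y z = 0 \<Longrightarrow> y = z"
    using relpowp_path_dist[OF assms, of y z] by simp
  show "y = z \<Longrightarrow> path_dist E y z = 0"
    using path_dist_le[of 0 E y z] by simp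
qed

lemma path_dist_Suc_le:
  assumes "connected_simple_graph E" "E y z"
  shows "path_dist E x z \<le> Suc (path_dist E x y)"
  using relpowp_path_dist[OF assms(1), of x y] assms(2)
  by (intro path_dist_le) (metis relpowp_Suc_I)

lemma path_dist_eq_1_iff:
  assumes "connected_simple_graph E"
  shows "path_dist E y z = 1 \<longleftrightarrow> E y z"
proof
  show "path_dist E y z = 1 \<Longrightarrow> E y z"
    using relpowp_path_dist[OF assms, of y z] by (auto simp: OO_def)
  assume "E y z"
  then have "y \<noteq> z" using assms by (auto simp: connected_simple_graph_def irreflp_def)
  then have "path_dist E y z \<noteq> 0" using path_dist_eq_0_iff[OF assms] by simp
  moreover have "path_dist E y z \<le> 1"
    using path_dist_Suc_le[OF assms \<open>E y z\<close>, of y] path_dist_eq_0_iff[OF assms, of y y] by simp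
  ultimately show "path_dist E y z = 1" by simp
qed

lemma path_dist_pred:
  assumes "connected_simple_graph E" "path_dist E x y = Suc n"
  shows "\<exists>z. E z y \<and> path_dist E x z = n"
proof -
  have "(E ^^ Suc n) x y" using relpowp_path_dist[OF assms(1)] assms(2) by metis
  then obtain z where z: "(E ^^ n) x z" "E z y" by auto
  then have "path_dist E x z \<le> n" using path_dist_le by metis
  moreover have "Suc n \<le> Suc (path_dist E x z)"
    using path_dist_Suc_le[OF assms(1) z(2), of x] assms(2) by simp
  ultimately show ?thesis using z(2) by auto
qed

lemma finite_path_dists: "finite {path_dist (E :: 'a::finite \<Rightarrow> 'a \<Rightarrow> bool) y z | y z. True}"
proof -
  have "{path_dist E y z | y z. True} = (\<lambda>(y, z). path_dist E y z) ` UNIV" by auto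
  then show ?thesis by simp
qed

lemma path_dist_le_diameter: "path_dist E y z \<le> graph_diameter E"
  unfolding graph_diameter_def by (rule Max_ge[OF finite_path_dists]) auto

lemma path_dist_attained:
  assumes "connected_simple_graph E" "i \<le> graph_diameter E"
  shows "\<exists>y z. path_dist E y z = i"
  using assms(2)
proof (induction i rule: inc_induct)
  case base
  have "graph_diameter E \<in> {path_dist E y z | y z. True}"
    unfolding graph_diameter_def by (rule Max_in[OF finite_path_dists]) auto
  then obtain y z where "path_dist E y z = graph_diameter E" by force
  then show ?case by blast
next
  case (step n)
  then show ?case using path_dist_pred[OF assms(1)] by metis
qed

lemma card_intersection_number:
  assumes "connected_simple_graph E" "distance_regular E"
    and "i \<le> graph_diameter E" "j \<le> graph_diameter E" "path_dist E y z = h"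
  shows "card {w. path_dist E y w = i \<and> path_dist E z w = j} = intersection_number E h i j"
proof -
  have h: "h \<le> graph_diameter E" using path_dist_le_diameter assms(5) by metis
  then obtain p where p: "\<And>y z. path_dist E y z = h \<longrightarrow>
      card {w. path_dist E y w = i \<and> path_dist E z w = j} = p"
    using assms(2-4) unfolding distance_regular_def by metis
  then have "intersection_number E h i j = p"
    unfolding intersection_number_def using assms(5) by (intro the_equality) blast+
  then show ?thesis using p assms(5) by simp
qed

lemma qbracket_0 [simp]: "qbracket q 0 = 0" and qbracket_1 [simp]: "qbracket q (Suc 0) = 1"
  and qbracket_Suc: "qbracket q (Suc n) = 1 + q * qbracket q n"
  and qbracket_Suc': "qbracket q (Suc n) = qbracket q n + q ^ n"
proof -
  show "qbracket q (Suc n) = 1 + q * qbracket q n"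
    unfolding qbracket_def by (simp add: sum.lessThan_Suc_shift sum_distrib_left del: sum.lessThan_Suc)
qed (simp_all add: qbracket_def)

lemma qbracket_add: "qbracket q (m + n) = qbracket q m + q ^ m * qbracket q n"
  by (induction n) (simp_all add: qbracket_Suc' algebra_simps power_add)

locale classical_graph =
  fixes E :: "'a::finite \<Rightarrow> 'a \<Rightarrow> bool" and x :: 'a and D :: nat and q \<alpha> \<beta> :: real
  assumes graph: "connected_simple_graph E"
    and regular: "distance_regular E"
    and params: "has_classical_parameters E D q \<alpha> \<beta>"
    and D_ge: "D \<ge> 4"
    and q_ge: "q \<ge> 2"
begin

abbreviation d :: "'a \<Rightarrow> 'a \<Rightarrow> nat" where "d \<equiv> path_dist E"

abbreviation br :: "nat \<Rightarrow> real" where "br \<equiv> qbracket q"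

definition c :: "nat \<Rightarrow> real" where "c i = br i * (1 + \<alpha> * br (i - 1))"

definition b :: "nat \<Rightarrow> real" where "b i = (br D - br i) * (\<beta> - \<alpha> * br i)"

definition a :: "nat \<Rightarrow> real" where "a i = b 0 - b i - c i"

lemma diameter: "graph_diameter E = D"
  using params by (simp add: has_classical_parameters_def)

lemma d_le: "d y z \<le> D"
  using path_dist_le_diameter diameter by metis

lemma d_commute: "d y z = d z y"
  using path_dist_commute[OF graph] .

lemma d_eq_0: "d y z = 0 \<longleftrightarrow> y = z"
  using path_dist_eq_0_iff[OF graph] .

lemma d_self [simp]: "d y y = 0"
  by (simp add: d_eq_0)

lemma d_eq_1: "d y z = Suc 0 \<longleftrightarrow> E y z"
  using path_dist_eq_1_iff[OF graph] by simp

lemma E_sym: "E y z \<longleftrightarrow> E z y"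
  using graph by (auto simp: connected_simple_graph_def dest: sympD)

lemma E_irrefl [simp]: "\<not> E y y"
  using graph by (simp add: connected_simple_graph_def irreflp_def)

lemma d_step: "E y z \<Longrightarrow> d w z \<le> Suc (d w y)" "E y z \<Longrightarrow> d w y \<le> Suc (d w z)"
  using path_dist_Suc_le[OF graph] E_sym by metis+

lemma d_step': "E y z \<Longrightarrow> d z w \<le> Suc (d y w)" "E y z \<Longrightarrow> d y w \<le> Suc (d z w)"
  using d_step d_commute by metis+

lemma q_pos: "q > 0" using q_ge by simp

lemma br_pos: "n > 0 \<Longrightarrow> br n > 0"
proof (induction n)
  case (Suc n)
  then show ?case using q_pos by (cases n) (auto simp: qbracket_Suc intro: add_pos_pos)
qed simp

lemma br_nonneg: "br n \<ge> 0"
  using br_pos[of n] by (cases n) auto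

lemma c_eq: "c i = br i * (1 + \<alpha> * (br i - 1) / q)"
  using q_pos by (cases i) (simp_all add: c_def qbracket_Suc)

lemma c_0 [simp]: "c 0 = 0" by (simp add: c_def)

lemma c_1 [simp]: "c (Suc 0) = 1" by (simp add: c_def)

lemma b_D [simp]: "b D = 0" by (simp add: b_def)

lemma a_0 [simp]: "a 0 = 0" by (simp add: a_def)

lemma D_pos: "D > 0" using D_ge by simp

lemma card_c: "real (card {w. E y w \<and> Suc (d w z) = d y z}) = c (d y z)"
proof (cases "d y z")
  case (Suc n)
  have "real (intersection_number E (Suc n) 1 n) = c (Suc n)"
    using params d_le[of y z] Suc unfolding has_classical_parameters_def c_def by force
  moreover have "card {w. d y w = 1 \<and> d z w = n} = intersection_number E (Suc n) 1 n"
    using card_intersection_number[OF graph regular _ _ Suc, of 1 n] d_le[of y z] Suc D_pos diameter by simp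
  moreover have "{w. E y w \<and> Suc (d w z) = d y z} = {w. d y w = 1 \<and> d z w = n}"
    using Suc by (auto simp: d_commute[of z] d_eq_1)
  ultimately show ?thesis using Suc by simp
qed simp

lemma card_b: "real (card {w. E y w \<and> d w z = Suc (d y z)}) = b (d y z)"
proof (cases "d y z < D")
  case True
  have "real (intersection_number E (d y z) 1 (d y z + 1)) = b (d y z)"
    using params True unfolding has_classical_parameters_def b_def by blast
  moreover have "card {w. d y w = 1 \<and> d z w = Suc (d y z)} = intersection_number E (d y z) 1 (Suc (d y z))"
    using card_intersection_number[OF graph regular, of 1 "Suc (d y z)" y z] True D_pos diameter by simp
  moreover have "{w. E y w \<and> d w z = Suc (d y z)} = {w. d y w = 1 \<and> d z w = Suc (d y z)}"
    by (auto simp: d_commute[of z] d_eq_1)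
  ultimately show ?thesis by simp
next
  case False
  then have "d y z = D" using d_le[of y z] by simp
  moreover have "d w z \<noteq> Suc D" for w using d_le[of w z] by simp
  ultimately show ?thesis by simp
qed

lemma card_E: "real (card {w. E y w}) = b 0"
proof -
  have "{w. E y w \<and> d w y = Suc (d y y)} = {w. E y w}" using E_sym[of y] by (auto simp: d_eq_1)
  then show ?thesis using card_b[of y y] by simp
qed

lemma card_a: "real (card {w. E y w \<and> d w z = d y z}) = a (d y z)"
proof -
  have "E y w \<Longrightarrow> Suc (d w z) = d y z \<or> d w z = d y z \<or> d w z = Suc (d y z)" for w
    using d_step'[of y w z] by linarith
  then have "{w. E y w} = {w. E y w \<and> Suc (d w z) = d y z} \<union>
      ({w. E y w \<and> d w z = d y z} \<union> {w. E y w \<and> d w z = Suc (d y z)})"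
    by blast
  moreover have "card \<dots> = card {w. E y w \<and> Suc (d w z) = d y z} +
      (card {w. E y w \<and> d w z = d y z} + card {w. E y w \<and> d w z = Suc (d y z)})"
    by (subst card_Un_disjoint; (subst card_Un_disjoint)?) auto
  ultimately show ?thesis
    using card_b[of y z] card_c[of y z] card_E[of y] by (simp add: a_def)
qed

end

section \<open>Lowering, flat and raising maps\<close>

lemmas cvec_eq_iff = Finite_Cartesian_Product.vec_eq_iff

text \<open>The action of the 0-1 matrix of a relation. Level projections, \<open>Aop\<close>,
  \<open>Lop\<close>, \<open>Fop\<close>, \<open>Rop\<close> and the distance matrices all have this
  form, so linearity and the adjoint, which belongs to the converse relation, are proved
  once.\<close>

definition relop :: "('a::finite \<Rightarrow> 'a \<Rightarrow> bool) \<Rightarrow> complex ^ 'a \<Rightarrow> complex ^ 'a" where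
  "relop P v = (\<chi> y. \<Sum>z\<in>UNIV. if P y z then v $ z else 0)"

lemma relop_nth: "relop P v $ y = (\<Sum>z\<in>UNIV. if P y z then v $ z else 0)"
  by (simp add: relop_def)

lemma relop_add [simp]: "relop P (u + v) = relop P u + relop P v"
  and relop_diff [simp]: "relop P (u - v) = relop P u - relop P v"
  and relop_minus [simp]: "relop P (- v) = - relop P v"
  and relop_scaleR [simp]: "relop P (r *\<^sub>R v) = r *\<^sub>R relop P v"
  and relop_smult [simp]: "relop P (s *s v) = s *s relop P v"
  by (auto simp: cvec_eq_iff relop_nth sum.distrib[symmetric] sum_subtractf[symmetric]
      sum_negf[symmetric] scaleR_sum_right sum_distrib_left intro!: sum.cong)

lemma relop_0 [simp]: "relop P 0 = 0"
  by (simp add: cvec_eq_iff relop_nth cong: if_cong)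

lemma relop_sum: "relop P (\<Sum>i\<in>I. v i) = (\<Sum>i\<in>I. relop P (v i))"
  by (induction I rule: infinite_finite_induct) auto

lemma relop_inner: "relop P v \<bullet> w = v \<bullet> relop (\<lambda>y z. P z y) w"
proof -
  have "relop P v \<bullet> w = (\<Sum>y\<in>UNIV. \<Sum>z\<in>UNIV. if P y z then v $ z \<bullet> w $ y else 0)"
    by (auto simp: inner_vec_def relop_nth inner_sum_left intro!: sum.cong)
  also have "\<dots> = v \<bullet> relop (\<lambda>y z. P z y) w"
    by (subst sum.swap) (auto simp: inner_vec_def relop_nth inner_sum_right intro!: sum.cong)
  finally show ?thesis .
qed

lemma smult_complex_of_real: "complex_of_real r *s v = r *\<^sub>R v"
  by (simp add: cvec_eq_iff) (simp add: scaleR_conv_of_real)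

context classical_graph
begin

abbreviation lev :: "nat \<Rightarrow> complex ^ 'a \<Rightarrow> complex ^ 'a" where
  "lev i \<equiv> relop (\<lambda>y z. y = z \<and> d x y = i)"

abbreviation Aop :: "complex ^ 'a \<Rightarrow> complex ^ 'a" where "Aop \<equiv> relop E"

abbreviation Lop :: "complex ^ 'a \<Rightarrow> complex ^ 'a" where
  "Lop \<equiv> relop (\<lambda>y z. E y z \<and> d x z = Suc (d x y))"

abbreviation Fop :: "complex ^ 'a \<Rightarrow> complex ^ 'a" where
  "Fop \<equiv> relop (\<lambda>y z. E y z \<and> d x y = d x z)"

abbreviation Rop :: "complex ^ 'a \<Rightarrow> complex ^ 'a" where
  "Rop \<equiv> relop (\<lambda>y z. E y z \<and> d x y = Suc (d x z))"

abbreviation dsum :: "nat \<Rightarrow> complex ^ 'a \<Rightarrow> complex ^ 'a" where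
  "dsum j \<equiv> relop (\<lambda>y z. d y z = j)"

lemma lev_nth: "lev i v $ y = (if d x y = i then v $ y else 0)"
  by (simp add: relop_nth)

lemma A_split: "Aop v = Lop v + Fop v + Rop v"
proof -
  have "E y z \<Longrightarrow> d x z = Suc (d x y) \<or> d x y = d x z \<or> d x y = Suc (d x z)" for y z
    using d_step[of y z x] by linarith
  then show ?thesis
    unfolding cvec_eq_iff relop_nth vector_add_component sum.distrib[symmetric]
    by (intro allI sum.cong refl) force
qed

lemma lev_lev [simp]: "lev i (lev j v) = (if i = j then lev i v else 0)"
  by (simp add: cvec_eq_iff lev_nth)

lemma lev_R: "lev (Suc l) (Rop v) = Rop (lev l v)"
  and lev_R_0: "lev 0 (Rop v) = 0"
  and lev_F: "lev l (Fop v) = Fop (lev l v)"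
  and lev_L: "lev l (Lop v) = Lop (lev (Suc l) v)"
  unfolding cvec_eq_iff lev_nth
  by (auto simp: relop_nth lev_nth intro!: sum.cong sum.neutral)

lemma lev_gt:
  assumes "i > D"
  shows "lev i v = 0"
proof -
  have "d x y \<noteq> i" for y using d_le[of x y] assms by simp
  then show ?thesis by (simp add: cvec_eq_iff relop_nth)
qed

lemma lev_sum: "(\<Sum>i\<le>D. lev i v) = v"
  using d_le[of x] by (simp add: cvec_eq_iff sum_component lev_nth)

lemma lev_Suc_A: "lev (Suc l) (Aop v) = Rop (lev l v) + Fop (lev (Suc l) v) + Lop (lev (Suc (Suc l)) v)"
  by (simp only: A_split relop_add lev_R lev_F lev_L) simp

lemma L_inner: "Lop v \<bullet> w = v \<bullet> Rop w"
proof -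
  have "(\<lambda>y z. E z y \<and> d x y = Suc (d x z)) = (\<lambda>y z. E y z \<and> d x y = Suc (d x z))"
    using E_sym by (intro ext) auto
  then show ?thesis by (simp add: relop_inner)
qed

lemma R_inner: "Rop v \<bullet> w = v \<bullet> Lop w"
  using L_inner[of w v] by (simp add: inner_commute)

lemma F_inner: "Fop v \<bullet> w = v \<bullet> Fop w"
proof -
  have "(\<lambda>y z. E z y \<and> d x z = d x y) = (\<lambda>y z. E y z \<and> d x y = d x z)"
    using E_sym by (intro ext) auto
  then show ?thesis by (simp add: relop_inner)
qed

lemma lev_inner: "lev i v \<bullet> w = v \<bullet> lev i w"
proof -
  have "(\<lambda>y z. z = y \<and> d x z = i) = (\<lambda>y z. y = z \<and> d x y = i)" by (intro ext) auto
  then show ?thesis by (simp add: relop_inner)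
qed

lemma A_inner: "Aop v \<bullet> w = v \<bullet> Aop w"
proof -
  have "(\<lambda>y z. E z y) = E" using E_sym by (intro ext) auto
  then show ?thesis by (simp add: relop_inner)
qed

lemma card_nbr_dist:
  "real (card {u. E z u \<and> d u y = j}) = (if d z y = Suc j then c (Suc j) else 0)
     + (if d z y = j then a j else 0) + (if j \<noteq> 0 \<and> d z y = j - 1 then b (j - 1) else 0)"
proof -
  consider "d z y = Suc j" | "d z y = j" | "Suc (d z y) = j"
    | "d z y \<noteq> Suc j \<and> d z y \<noteq> j \<and> Suc (d z y) \<noteq> j" by blast
  then show ?thesis
  proof cases
    case 1
    then show ?thesis using card_c[of z y] by (auto simp: eq_commute[of "Suc j"])
  next
    case 2
    then show ?thesis using card_a[of z y] by auto
  next
    case 3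
    then show ?thesis using card_b[of z y] by auto
  next
    case 4
    have "{u. E z u \<and> d u y = j} = {}"
    proof -
      have "\<not> (E z u \<and> d u y = j)" for u using 4 d_step'[of z u y] by linarith
      then show ?thesis by blast
    qed
    then show ?thesis using 4 by (auto)
  qed
qed

text \<open>The three-term recurrence of the distance matrices. It needs no bound on
  \<open>j\<close>, since \<open>dsum (Suc D)\<close> and \<open>b D\<close> vanish.\<close>

lemma A_dsum:
  "Aop (dsum j v) = c (Suc j) *\<^sub>R dsum (Suc j) v + a j *\<^sub>R dsum j v
     + (if j = 0 then 0 else b (j - 1) *\<^sub>R dsum (j - 1) v)"
proof -
  have "Aop (dsum j v) $ z = (\<Sum>y\<in>UNIV. real (card {u. E z u \<and> d u y = j}) *\<^sub>R v $ y)" for z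
  proof -
    have "Aop (dsum j v) $ z = (\<Sum>u\<in>UNIV. \<Sum>y\<in>UNIV. if E z u \<and> d u y = j then v $ y else 0)"
      by (auto simp: relop_nth intro!: sum.cong)
    also have "\<dots> = (\<Sum>y\<in>UNIV. \<Sum>u\<in>UNIV. if E z u \<and> d u y = j then v $ y else 0)"
      by (rule sum.swap)
    also have "\<dots> = (\<Sum>y\<in>UNIV. real (card {u. E z u \<and> d u y = j}) *\<^sub>R v $ y)"
      by (auto simp: sum.If_cases scaleR_conv_of_real intro!: sum.cong)
    finally show ?thesis .
  qed
  then show ?thesis
    unfolding cvec_eq_iff
    by (auto simp: card_nbr_dist relop_nth scaleR_sum_right sum.distrib[symmetric] scaleR_add_left
        intro!: sum.cong)
qed

text \<open>The sign comes from an actual pair of vertices, because the sign of \<alpha> is not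
  known in advance. The positivity of the factors of the classical parameters is later deduced from
  here and from \<open>b_pos\<close>.\<close>

lemma c_pos:
  assumes "0 < i" "i \<le> D"
  shows "c i > 0"
proof -
  obtain y z where yz: "d y z = i" using path_dist_attained[OF graph] diameter assms(2) by metis
  then obtain n where n: "d y z = Suc n" using assms(1) by (cases i) auto
  then obtain w where "E w z" "d y w = n" using path_dist_pred[OF graph] by blast
  then have "w \<in> {w. E z w \<and> Suc (d w y) = d z y}" using n by (auto simp: E_sym d_commute)
  then have "card {w. E z w \<and> Suc (d w y) = d z y} > 0" by (auto simp: card_gt_0_iff)
  then show ?thesis using card_c[of z y] yz d_commute[of y z] by simp
qed

lemma b_pos:
  assumes "i < D"
  shows "b i > 0"
proof -
  obtain y z where n: "d y z = Suc i"
    using path_dist_attained[OF graph, of "Suc i"] diameter assms by auto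
  then obtain w where w: "E w z" "d y w = i" using path_dist_pred[OF graph] by blast
  then have "z \<in> {u. E w u \<and> d u y = Suc (d w y)}" using n by (auto simp: d_commute[of _ y])
  then have "card {u. E w u \<and> d u y = Suc (d w y)} > 0" by (auto simp: card_gt_0_iff)
  then show ?thesis using card_b[of w y] w d_commute[of y w] by simp
qed

section \<open>Chains generated by vectors on the first sphere\<close>

text \<open>For \<open>w\<close> supported on the neighbours of \<open>x\<close>, with entries summing to 0, these are \<open>E\<^sub>i\<^sup>* A\<^sub>i\<^sub>-\<^sub>1 w\<close> and
  \<open>E\<^sub>i\<^sup>* A\<^sub>i\<^sub>+\<^sub>1 w\<close>, where \<open>A\<^sub>j\<close> is the distance-\<open>j\<close> matrix. The remaining part \<open>E\<^sub>i\<^sup>* A\<^sub>i w\<close> is minus their sum.\<close>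

definition wp :: "nat \<Rightarrow> complex ^ 'a \<Rightarrow> complex ^ 'a" where "wp i w = lev i (dsum (i - 1) w)"

definition wm :: "nat \<Rightarrow> complex ^ 'a \<Rightarrow> complex ^ 'a" where "wm i w = lev i (dsum (Suc i) w)"

definition local_vec :: "complex ^ 'a \<Rightarrow> bool" where
  "local_vec w \<longleftrightarrow> lev 1 w = w \<and> (\<Sum>y\<in>UNIV. w $ y) = 0"

lemma local_vec_nth: "local_vec w \<Longrightarrow> \<not> E x y \<Longrightarrow> w $ y = 0"
  using lev_nth[of 1 w y] by (simp add: local_vec_def d_eq_1)

lemma lev_dsum_eq_0:
  assumes "local_vec w" "Suc i < j \<or> Suc j < i"
  shows "lev i (dsum j w) = 0"
proof -
  have "(if d y z = j then w $ z else 0) = 0" if "d x y = i" for y z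
  proof (cases "E x z")
    case True
    then show ?thesis
      using d_step(1)[OF True, of y] d_step(2)[OF True, of y] that assms(2) d_commute[of x y] by auto
  qed (use local_vec_nth[OF assms(1)] in auto)
  then show ?thesis unfolding cvec_eq_iff lev_nth relop_nth by (auto intro!: sum.neutral)
qed

lemma lev_dsum_mid:
  assumes "local_vec w"
  shows "lev (Suc i) (dsum (Suc i) w) = - (wp (Suc i) w + wm (Suc i) w)"
proof -
  have "(\<Sum>z\<in>UNIV. if d y z = i then w $ z else 0) + (\<Sum>z\<in>UNIV. if d y z = Suc i then w $ z else 0)
      + (\<Sum>z\<in>UNIV. if d y z = Suc (Suc i) then w $ z else 0) = (\<Sum>z\<in>UNIV. w $ z)"
    if "d x y = Suc i" for y
    unfolding sum.distrib[symmetric]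
  proof (rule sum.cong, simp)
    fix z
    show "(if d y z = i then w $ z else 0) + (if d y z = Suc i then w $ z else 0)
      + (if d y z = Suc (Suc i) then w $ z else 0) = w $ z"
    proof (cases "E x z")
      case True
      then have "d y z = i \<or> d y z = Suc i \<or> d y z = Suc (Suc i)"
        using d_step(1)[OF True, of y] d_step(2)[OF True, of y] that d_commute[of x y] by linarith
      then show ?thesis by auto
    qed (use local_vec_nth[OF assms] in auto)
  qed
  then show ?thesis using assms
    unfolding cvec_eq_iff wp_def wm_def lev_nth relop_nth local_vec_def
    by (auto simp: lev_nth relop_nth add_eq_0_iff algebra_simps)
qed

lemma dsum_0 [simp]: "dsum 0 w = w"
  by (simp add: cvec_eq_iff relop_nth d_eq_0)

lemma dsum_1: "dsum (Suc 0) w = Aop w"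
  by (simp add: cvec_eq_iff relop_nth d_eq_1)

lemma wp_1: "local_vec w \<Longrightarrow> wp (Suc 0) w = w"
  by (simp add: wp_def local_vec_def)

lemma wm_0:
  assumes "local_vec w"
  shows "wm 0 w = 0"
proof -
  have "(\<Sum>z\<in>UNIV. if E x z then w $ z else 0) = (\<Sum>z\<in>UNIV. w $ z)"
    using local_vec_nth[OF assms] by (intro sum.cong) auto
  then show ?thesis using assms
    unfolding wm_def cvec_eq_iff lev_nth by (auto simp: relop_nth local_vec_def d_eq_0 d_eq_1)
qed

lemma local_vec_lev:
  assumes "local_vec w" "i \<noteq> 1"
  shows "lev i w = 0"
proof -
  have "lev i w = lev i (lev 1 w)" using assms(1) by (simp add: local_vec_def)
  then show ?thesis using assms(2) by simp
qed

lemma L_local: 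
  assumes "local_vec w"
  shows "Lop w = 0"
proof -
  have "(\<Sum>z\<in>UNIV. if E x z then w $ z else 0) = (\<Sum>z\<in>UNIV. w $ z)"
    using local_vec_nth[OF assms] by (intro sum.cong) auto
  then have sum0: "(\<Sum>z\<in>UNIV. if E x z then w $ z else 0) = 0" using assms by (simp add: local_vec_def)
  have *: "(if E y z \<and> d x z = Suc (d x y) then w $ z else 0)
      = (if y = x then if E x z then w $ z else 0 else 0)" for y z
    using local_vec_nth[OF assms, of z] d_eq_1[of x z] d_eq_0[of x y] by (cases "E x z") auto
  have "Lop w $ y = 0" for y
    unfolding relop_nth * using sum0 by (cases "y = x") auto
  then show ?thesis by (simp add: cvec_eq_iff)
qed

lemma wm_1:
  assumes "local_vec w"
  shows "wm (Suc 0) w = - w - Fop w"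
proof -
  have "lev (Suc 0) (dsum (Suc 0) w) = Fop w"
    unfolding dsum_1 lev_Suc_A using assms local_vec_lev[OF assms] by (simp add: local_vec_def)
  then show ?thesis using lev_dsum_mid[OF assms, of 0] wp_1[OF assms] by (simp add: algebra_simps)
qed

text \<open>This and the next three relations are single levels of the recurrence
  \<open>A_dsum\<close>; a vertex on level \<open>i\<close> is at distance \<open>i - 1\<close>,
  \<open>i\<close> or \<open>i + 1\<close> from the support of \<open>w\<close>, so
  \<open>lev_dsum_eq_0\<close> leaves only few terms.\<close>

lemma R_wp:
  assumes "local_vec w"
  shows "Rop (wp (Suc m) w) = c (Suc m) *\<^sub>R wp (Suc (Suc m)) w"
  using arg_cong[OF A_dsum[of m w], of "lev (Suc (Suc m))"] lev_dsum_eq_0[OF assms]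
  unfolding lev_Suc_A by (auto simp: wp_def split: if_splits)

lemma L_wm:
  assumes "local_vec w"
  shows "Lop (wm (Suc (Suc m)) w) = b (Suc (Suc m)) *\<^sub>R wm (Suc m) w"
  using arg_cong[OF A_dsum[of "Suc (Suc (Suc m))" w], of "lev (Suc m)"] lev_dsum_eq_0[OF assms]
  unfolding lev_Suc_A by (auto simp: wm_def split: if_splits)

lemma F_wp:
  assumes "local_vec w"
  shows "Fop (wp (Suc (Suc m)) w) = (a (Suc m) - c (Suc (Suc m)) + c (Suc m)) *\<^sub>R wp (Suc (Suc m)) w
    - c (Suc (Suc m)) *\<^sub>R wm (Suc (Suc m)) w + Rop (wm (Suc m) w)"
proof -
  have "Rop (lev (Suc m) (dsum (Suc m) w)) + Fop (wp (Suc (Suc m)) w)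
      = c (Suc (Suc m)) *\<^sub>R lev (Suc (Suc m)) (dsum (Suc (Suc m)) w) + a (Suc m) *\<^sub>R wp (Suc (Suc m)) w"
    using arg_cong[OF A_dsum[of "Suc m" w], of "lev (Suc (Suc m))"] lev_dsum_eq_0[OF assms]
    unfolding lev_Suc_A by (auto simp: wp_def split: if_splits)
  then show ?thesis
    unfolding lev_dsum_mid[OF assms] relop_minus relop_add R_wp[OF assms]
    by (simp add: algebra_simps)
qed

lemma L_wp:
  assumes "local_vec w"
  shows "Lop (wp (Suc (Suc m)) w) = Fop (wp (Suc m) w) + Fop (wm (Suc m) w) - Rop (wm m w)
    + c (Suc (Suc m)) *\<^sub>R wm (Suc m) w - a (Suc m) *\<^sub>R (wp (Suc m) w + wm (Suc m) w)
    + b m *\<^sub>R wp (Suc m) w"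
proof -
  have "Rop (wm m w) + Fop (lev (Suc m) (dsum (Suc m) w)) + Lop (wp (Suc (Suc m)) w)
      = c (Suc (Suc m)) *\<^sub>R wm (Suc m) w + a (Suc m) *\<^sub>R lev (Suc m) (dsum (Suc m) w) + b m *\<^sub>R wp (Suc m) w"
    using arg_cong[OF A_dsum[of "Suc m" w], of "lev (Suc m)"] lev_dsum_eq_0[OF assms]
    unfolding lev_Suc_A by (auto simp: wp_def wm_def split: if_splits)
  then show ?thesis
    unfolding lev_dsum_mid[OF assms] relop_minus relop_add
    by (simp add: algebra_simps)
qed

text \<open>What thinness of the module generated by \<open>w\<close> contributes: its level spaces
  have dimension at most 1, so the self-adjoint map \<open>Fop\<close> acts on each
  \<open>wp i w\<close> as a real scalar.\<close>

definition thin_vec :: "complex ^ 'a \<Rightarrow> bool" where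
  "thin_vec w \<longleftrightarrow> w \<noteq> 0 \<and> local_vec w \<and> (\<forall>i\<in>{1..D}. \<exists>r::real. Fop (wp i w) = r *\<^sub>R wp i w)"

text \<open>If \<open>wm i w = g i *\<^sub>R wp i w\<close> for all \<open>i\<close>, then \<open>phi g i\<close> is the eigenvalue of \<open>Fop\<close> on \<open>wp i w\<close>, and \<open>Lop\<close> maps
  \<open>wp i w\<close> to \<open>ell g i\<close> times \<open>wp (i - 1) w\<close>.\<close>

definition phi :: "(nat \<Rightarrow> real) \<Rightarrow> nat \<Rightarrow> real" where
  "phi g i = a (i - 1) - c i + c (i - 1) - c i * g i + c (i - 1) * g (i - 1)"

definition ell :: "(nat \<Rightarrow> real) \<Rightarrow> nat \<Rightarrow> real" where
  "ell g i = (1 + g (i - 1)) * (phi g (i - 1) - a (i - 1)) - c (i - 2) * g (i - 2) + c i * g (i - 1) + b (i - 2)"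

definition chain :: "complex ^ 'a \<Rightarrow> (nat \<Rightarrow> real) \<Rightarrow> bool" where
  "chain w g \<longleftrightarrow> w \<noteq> 0 \<and> local_vec w \<and>
     (\<forall>i\<in>{1..D}. wm i w = g i *\<^sub>R wp i w \<and> Fop (wp i w) = phi g i *\<^sub>R wp i w)"

text \<open>\<open>F_wp\<close> expresses \<open>c i\<close> times \<open>wm i w\<close> through
  \<open>Fop (wp i w)\<close>, \<open>wp i w\<close> and level \<open>i - 1\<close>. Once
  \<open>Fop\<close> acts as a scalar, \<open>wm i w\<close> is therefore a multiple of
  \<open>wp i w\<close>, by induction on the level.\<close>

lemma thin_chain:
  assumes "thin_vec w"
  shows "\<exists>g. chain w g"
proof -
  have lw: "local_vec w" and "w \<noteq> 0" using assms by (auto simp: thin_vec_def)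
  have "\<forall>i\<in>{1..D}. \<exists>r::real. Fop (wp i w) = r *\<^sub>R wp i w"
    using assms unfolding thin_vec_def by blast
  from bchoice[OF this] obtain r :: "nat \<Rightarrow> real"
    where r: "\<And>i. i \<in> {1..D} \<Longrightarrow> Fop (wp i w) = r i *\<^sub>R wp i w"
    by blast
  \<comment> \<open>The recursion is \<open>phi g i = r i\<close> solved for \<open>g i\<close>; the
    start value is arbitrary, as it is multiplied by \<open>c 0 = 0\<close>.\<close>
  define g where "g = rec_nat 0 (\<lambda>m gm. (a m - c (Suc m) + c m + c m * gm - r (Suc m)) / c (Suc m))"
  have g_Suc: "g (Suc m) = (a m - c (Suc m) + c m + c m * g m - r (Suc m)) / c (Suc m)" for m
    by (simp add: g_def)
  have phi: "phi g (Suc m) = r (Suc m)" if "Suc m \<le> D" for m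
    using c_pos[OF _ that] by (simp add: phi_def g_Suc field_simps)
  have "wm (Suc m) w = g (Suc m) *\<^sub>R wp (Suc m) w" if "Suc m \<le> D" for m
    using that
  proof (induction m)
    case 0
    have "wm (Suc 0) w = (- 1 - r (Suc 0)) *\<^sub>R w"
      using wm_1[OF lw] r[of "Suc 0"] wp_1[OF lw] D_pos by (simp add: algebra_simps)
    then show ?case by (simp add: g_Suc wp_1[OF lw])
  next
    case (Suc m)
    have cp: "c (Suc (Suc m)) > 0" using Suc.prems c_pos by simp
    have "c (Suc (Suc m)) *\<^sub>R wm (Suc (Suc m)) w =
        (a (Suc m) - c (Suc (Suc m)) + c (Suc m)) *\<^sub>R wp (Suc (Suc m)) w + Rop (wm (Suc m) w) - Fop (wp (Suc (Suc m)) w)"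
      using F_wp[OF lw, of m] by (simp add: algebra_simps)
    also have "\<dots> = (a (Suc m) - c (Suc (Suc m)) + c (Suc m) + c (Suc m) * g (Suc m) - r (Suc (Suc m))) *\<^sub>R wp (Suc (Suc m)) w"
      using Suc r[of "Suc (Suc m)"] by (simp add: R_wp[OF lw] algebra_simps)
    also have "\<dots> = c (Suc (Suc m)) *\<^sub>R (g (Suc (Suc m)) *\<^sub>R wp (Suc (Suc m)) w)"
      using cp by (simp add: g_Suc[of "Suc m"])
    finally show ?case using cp by (simp only: scaleR_cancel_left) simp
  qed
  then have "chain w g"
    unfolding chain_def using lw \<open>w \<noteq> 0\<close> r phi
    by (auto simp: Suc_le_eq gr0_conv_Suc)
  then show ?thesis by blast
qed

lemma chain_L:
  assumes "chain w g" "2 \<le> i" "i \<le> D"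
  shows "Lop (wp i w) = ell g i *\<^sub>R wp (i - 1) w"
proof -
  obtain m where m: "i = Suc (Suc m)" using assms(2) by (metis Suc_le_D add_2_eq_Suc le_Suc_ex)
  have lw: "local_vec w" using assms(1) by (simp add: chain_def)
  have "Rop (wm m w) = (c m * g m) *\<^sub>R wp (Suc m) w"
  proof (cases m)
    case 0
    then show ?thesis using wm_0[OF lw] by simp
  next
    case (Suc n)
    then show ?thesis using assms m by (simp add: chain_def R_wp[OF lw])
  qed
  then show ?thesis
    using assms m L_wp[OF lw, of m]
    by (simp add: chain_def ell_def algebra_simps)
qed

text \<open>\<open>Lop (wm i w)\<close> is computed in two ways: through
  \<open>wm i w = g i *\<^sub>R wp i w\<close>, and by \<open>L_wm\<close>.\<close>

lemma chain_g:
  assumes "chain w g" "2 \<le> i" "i \<le> D" "wp (i - 1) w \<noteq> 0"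
  shows "g i * ell g i = b i * g (i - 1)"
proof -
  obtain m where m: "i = Suc (Suc m)" using assms(2) by (metis Suc_le_D add_2_eq_Suc le_Suc_ex)
  have lw: "local_vec w" using assms(1) by (simp add: chain_def)
  have "(g i * ell g i) *\<^sub>R wp (i - 1) w = Lop (wm i w)"
    using assms chain_L[OF assms(1-3)] by (simp add: chain_def)
  also have "\<dots> = (b i * g (i - 1)) *\<^sub>R wp (i - 1) w"
    using L_wm[OF lw, of m] assms m by (simp add: chain_def)
  finally show ?thesis using assms(4) by simp
qed

text \<open>\<open>Rop\<close> and \<open>Lop\<close> are adjoint. Hence a chain stops at the first
  zero of \<open>ell g\<close>.\<close>

lemma chain_norm:
  assumes "chain w g" "2 \<le> i" "i \<le> D"
  shows "c (i - 1) * (wp i w \<bullet> wp i w) = ell g i * (wp (i - 1) w \<bullet> wp (i - 1) w)"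
proof -
  obtain m where m: "i = Suc (Suc m)" using assms(2) by (metis Suc_le_D add_2_eq_Suc le_Suc_ex)
  have lw: "local_vec w" using assms(1) by (simp add: chain_def)
  have "c (i - 1) * (wp i w \<bullet> wp i w) = Rop (wp (i - 1) w) \<bullet> wp i w"
    using R_wp[OF lw, of m] m by simp
  also have "\<dots> = wp (i - 1) w \<bullet> Lop (wp i w)" by (rule R_inner)
  finally show ?thesis by (simp add: chain_L[OF assms])
qed

lemma chain_wp_nonzero:
  assumes "chain w g" "2 \<le> i" "i \<le> D" "wp (i - 1) w \<noteq> 0"
  shows "wp i w \<noteq> 0 \<longleftrightarrow> ell g i \<noteq> 0"
proof -
  have "c (i - 1) > 0" using assms c_pos[of "i - 1"] by simp
  then show ?thesis using chain_norm[OF assms(1-3)] assms(4) by auto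
qed

lemma ell_cong:
  assumes "2 \<le> i" "g (i - 1) = g' (i - 1)" "2 < i \<Longrightarrow> g (i - 2) = g' (i - 2)"
  shows "ell g i = ell g' i"
proof (cases "i = 2")
  case True
  then show ?thesis using assms by (simp add: ell_def phi_def)
next
  case False
  then have "g (i - 2) = g' (i - 2)" using assms by simp
  moreover have "i - 1 - 1 = i - 2" by simp
  ultimately show ?thesis using assms(2) by (simp add: ell_def phi_def del: diff_diff_left)
qed

text \<open>\<open>g 1\<close> determines a chain: \<open>ell g i\<close> involves \<open>g\<close>
  only at \<open>i - 1\<close> and \<open>i - 2\<close>, and \<open>chain_g\<close> then yields
  \<open>g i\<close> as long as \<open>ell g i\<close> is nonzero. \<open>G\<close> is a candidate
  solution with values \<Lambda> of \<open>ell\<close>. The strict bounds leave room for a zero of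
  \<Lambda> at \<open>n\<close>, where the chain may stop.\<close>

lemma chain_closed_form:
  assumes "chain w g" "n \<le> D" "G 1 = g 1"
    and "\<And>i. 2 \<le> i \<Longrightarrow> i \<le> n \<Longrightarrow> ell G i = \<Lambda> i"
    and "\<And>i. 2 \<le> i \<Longrightarrow> i < n \<Longrightarrow> G i * \<Lambda> i = b i * G (i - 1)"
    and "\<And>i. 2 \<le> i \<Longrightarrow> i < n \<Longrightarrow> \<Lambda> i \<noteq> 0"
  shows "\<And>i. 1 \<le> i \<Longrightarrow> i < n \<Longrightarrow> g i = G i \<and> wp i w \<noteq> 0"
    and "\<And>i. 2 \<le> i \<Longrightarrow> i \<le> n \<Longrightarrow> ell g i = \<Lambda> i"
proof -
  have lw: "local_vec w" "w \<noteq> 0" using assms(1) by (auto simp: chain_def)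
  have *: "\<forall>j\<in>{1..m}. g j = G j \<and> wp j w \<noteq> 0" if "1 \<le> m" "m < n" for m
    using that
  proof (induction m rule: nat_induct_at_least)
    case base
    then show ?case using wp_1[OF lw(1)] lw(2) assms(3) by simp
  next
    case (Suc m)
    then have IH: "\<forall>j\<in>{1..m}. g j = G j \<and> wp j w \<noteq> 0" by simp
    have "ell g (Suc m) = ell G (Suc m)"
      using Suc IH by (intro ell_cong) auto
    then have e: "ell g (Suc m) = \<Lambda> (Suc m)" "\<Lambda> (Suc m) \<noteq> 0" using assms(4,6) Suc by auto
    have "wp (Suc m) w \<noteq> 0"
      using chain_wp_nonzero[OF assms(1), of "Suc m"] Suc IH e assms(2) by auto
    moreover have "g (Suc m) * ell g (Suc m) = b (Suc m) * g m"
      using chain_g[OF assms(1), of "Suc m"] Suc IH assms(2) by auto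
    then have "g (Suc m) * \<Lambda> (Suc m) = G (Suc m) * \<Lambda> (Suc m)"
      using assms(5)[of "Suc m"] Suc IH e by auto
    then have "g (Suc m) = G (Suc m)" using e(2) by simp
    ultimately show ?case using IH by (auto simp: le_Suc_eq)
  qed
  then show 1: "\<And>i. 1 \<le> i \<Longrightarrow> i < n \<Longrightarrow> g i = G i \<and> wp i w \<noteq> 0" by auto
  fix i assume i: "2 \<le> i" "i \<le> n"
  have "ell g i = ell G i" using i 1 by (intro ell_cong) auto
  then show "ell g i = \<Lambda> i" using assms(4) i by simp
qed

lemma ell_eq:
  "ell g (Suc (Suc m)) = (1 + g (Suc m)) * (b (Suc m) - b m - c (Suc m) * g (Suc m) + c m * g m)
     - c m * g m + c (Suc (Suc m)) * g (Suc m) + b m"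
  by (simp add: ell_def phi_def a_def algebra_simps)

section \<open>Closed forms of the four kinds of chains\<close>

lemma br_diff_pos: "i < D \<Longrightarrow> br D - br i > 0"
  using qbracket_add[of q i "D - i"] br_pos[of "D - i"] q_pos by simp

lemma beta_alpha_pos:
  assumes "i < D"
  shows "\<beta> - \<alpha> * br i > 0"
  using b_pos[OF assms] br_diff_pos[OF assms] by (simp add: b_def zero_less_mult_iff)

lemma one_alpha_pos:
  assumes "i < D"
  shows "1 + \<alpha> * br i > 0"
  using c_pos[of "Suc i"] br_pos[of "Suc i"] assms by (simp add: c_def zero_less_mult_iff)

lemma ell_const_0: "2 \<le> i \<Longrightarrow> ell (\<lambda>_. 0) i = b (i - 1)"
  using ell_eq[of "\<lambda>_. 0" "i - 2"] by (simp add: numeral_2_eq_2 Suc_diff_Suc)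

lemma ell_const_q:
  assumes "2 \<le> i"
  shows "ell (\<lambda>_. q) i = b i"
proof -
  obtain m where m: "i = Suc (Suc m)" using assms by (metis add_2_eq_Suc le_Suc_ex)
  have *: "c m * q = br m * (q + \<alpha> * (br m - 1))"
    using q_pos by (simp add: c_eq field_simps)
  show ?thesis
    unfolding m ell_eq * unfolding b_def c_def[of "Suc m"] c_def[of "Suc (Suc m)"] qbracket_Suc diff_Suc_1
    by (simp add: algebra_simps)
qed

text \<open>Solutions \<open>g\<close> of the recursion \<open>g i * ell g i = b i * g (i - 1)\<close>, with their values of \<open>ell\<close>; the constant
  sequences 0 and \<open>q\<close> are two more solutions. The value at 0 does not matter, since it only occurs multiplied by \<open>c 0 = 0\<close>.\<close>

definition gtight :: "nat \<Rightarrow> real" where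
  "gtight i = - (\<beta> - \<alpha> * br i) / (1 + \<alpha> * (br i - 1) / q)"

definition ltight :: "nat \<Rightarrow> real" where
  "ltight i = (br D - br i) * (1 + \<alpha> * br (i - 1)) * (\<beta> - \<alpha> * br (i - 1)) / (1 + \<alpha> * br (i - 2))"

definition gfull :: "nat \<Rightarrow> real" where
  "gfull i = - \<alpha> * (br D - br i) / (1 + \<alpha> * (br i - 1) / q)"

definition lfull :: "nat \<Rightarrow> real" where
  "lfull i = (br D - br (i - 1)) * (1 + \<alpha> * br (i - 1)) * (\<beta> - \<alpha> * br i) / (1 + \<alpha> * br (i - 2))"

lemma gtight_Suc: "gtight (Suc m) = - (\<beta> - \<alpha> * br (Suc m)) / (1 + \<alpha> * br m)"
  and gfull_Suc: "gfull (Suc m) = - \<alpha> * (br D - br (Suc m)) / (1 + \<alpha> * br m)"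
  using q_pos by (simp_all add: gtight_def gfull_def qbracket_Suc)

lemma c_gtight:
  assumes "m < D"
  shows "c m * gtight m = - (br m * (\<beta> - \<alpha> * br m))"
proof (cases m)
  case (Suc n)
  then show ?thesis using one_alpha_pos[of n] assms by (simp add: gtight_Suc c_def field_simps)
qed simp

lemma c_gfull:
  assumes "m < D"
  shows "c m * gfull m = - (br m * \<alpha> * (br D - br m))"
proof (cases m)
  case (Suc n)
  then show ?thesis using one_alpha_pos[of n] assms by (simp add: gfull_Suc c_def field_simps)
qed simp

lemma ell_gtight:
  assumes "2 \<le> i" "i \<le> D"
  shows "ell gtight i = ltight i"
proof -
  obtain m where m: "i = Suc (Suc m)" using assms by (metis add_2_eq_Suc le_Suc_ex)
  define y where "y = br m"
  have u: "1 + \<alpha> * y \<noteq> 0" using one_alpha_pos[of m] assms m by (simp add: y_def)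
  have g: "gtight (Suc m) * (1 + \<alpha> * y) = - (\<beta> - \<alpha> * (1 + q * y))"
    using u by (simp add: gtight_Suc qbracket_Suc y_def)
  have *: "c m * gtight m = - (y * (\<beta> - \<alpha> * y))" "c (Suc m) * gtight (Suc m) = - ((1 + q * y) * (\<beta> - \<alpha> * (1 + q * y)))"
    using c_gtight[of m] c_gtight[of "Suc m"] assms m by (simp_all add: y_def qbracket_Suc)
  \<comment> \<open>Multiplied by \<open>1 + \<alpha> * y\<close>, the right-hand side of
    \<open>ell_eq\<close> becomes polynomial: that factor clears the denominator of
    \<open>gtight (Suc m)\<close>, and in the products with \<open>c\<close> the denominators cancel
    by \<open>c_gtight\<close>.\<close>
  have "((1 + gtight (Suc m)) * (b (Suc m) - b m - c (Suc m) * gtight (Suc m) + c m * gtight m)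
     - c m * gtight m + c (Suc (Suc m)) * gtight (Suc m) + b m) * (1 + \<alpha> * y)
     = (1 + \<alpha> * y + gtight (Suc m) * (1 + \<alpha> * y)) * (b (Suc m) - b m - c (Suc m) * gtight (Suc m) + c m * gtight m)
     + (b m - c m * gtight m) * (1 + \<alpha> * y) + c (Suc (Suc m)) * (gtight (Suc m) * (1 + \<alpha> * y))"
    by (simp add: algebra_simps)
  also have "\<dots> = (br D - br (Suc (Suc m))) * (1 + \<alpha> * br (Suc m)) * (\<beta> - \<alpha> * br (Suc m))"
    unfolding * g unfolding b_def c_def[of "Suc (Suc m)"] qbracket_Suc diff_Suc_1 y_def[symmetric]
    by (simp add: algebra_simps)
  finally have "((1 + gtight (Suc m)) * (b (Suc m) - b m - c (Suc m) * gtight (Suc m) + c m * gtight m)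
     - c m * gtight m + c (Suc (Suc m)) * gtight (Suc m) + b m) * (1 + \<alpha> * y) = (br D - br (Suc (Suc m))) * (1 + \<alpha> * br (Suc m)) * (\<beta> - \<alpha> * br (Suc m))" .
  then have "ell gtight i * (1 + \<alpha> * y) = ltight i * (1 + \<alpha> * y)"
    unfolding m ell_eq using u by (simp add: ltight_def y_def)
  then show ?thesis using u by simp
qed

lemma ell_gfull:
  assumes "2 \<le> i" "i \<le> D"
  shows "ell gfull i = lfull i"
proof -
  obtain m where m: "i = Suc (Suc m)" using assms by (metis add_2_eq_Suc le_Suc_ex)
  define y where "y = br m"
  have u: "1 + \<alpha> * y \<noteq> 0" using one_alpha_pos[of m] assms m by (simp add: y_def)
  have g: "gfull (Suc m) * (1 + \<alpha> * y) = - \<alpha> * (br D - (1 + q * y))"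
    using u by (simp add: gfull_Suc qbracket_Suc y_def)
  have *: "c m * gfull m = - (y * \<alpha> * (br D - y))" "c (Suc m) * gfull (Suc m) = - ((1 + q * y) * \<alpha> * (br D - (1 + q * y)))"
    using c_gfull[of m] c_gfull[of "Suc m"] assms m by (simp_all add: y_def qbracket_Suc)
  have "((1 + gfull (Suc m)) * (b (Suc m) - b m - c (Suc m) * gfull (Suc m) + c m * gfull m)
     - c m * gfull m + c (Suc (Suc m)) * gfull (Suc m) + b m) * (1 + \<alpha> * y)
     = (1 + \<alpha> * y + gfull (Suc m) * (1 + \<alpha> * y)) * (b (Suc m) - b m - c (Suc m) * gfull (Suc m) + c m * gfull m)
     + (b m - c m * gfull m) * (1 + \<alpha> * y) + c (Suc (Suc m)) * (gfull (Suc m) * (1 + \<alpha> * y))"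
    by (simp add: algebra_simps)
  also have "\<dots> = (br D - br (Suc m)) * (1 + \<alpha> * br (Suc m)) * (\<beta> - \<alpha> * br (Suc (Suc m)))"
    unfolding * g unfolding b_def c_def[of "Suc (Suc m)"] qbracket_Suc diff_Suc_1 y_def[symmetric]
    by (simp add: algebra_simps)
  finally have "((1 + gfull (Suc m)) * (b (Suc m) - b m - c (Suc m) * gfull (Suc m) + c m * gfull m)
     - c m * gfull m + c (Suc (Suc m)) * gfull (Suc m) + b m) * (1 + \<alpha> * y) = (br D - br (Suc m)) * (1 + \<alpha> * br (Suc m)) * (\<beta> - \<alpha> * br (Suc (Suc m)))" .
  then have "ell gfull i * (1 + \<alpha> * y) = lfull i * (1 + \<alpha> * y)"
    unfolding m ell_eq using u by (simp add: lfull_def y_def)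
  then show ?thesis using u by simp
qed

lemma gtight_step:
  assumes "2 \<le> i" "i < D"
  shows "gtight i * ltight i = b i * gtight (i - 1)"
proof -
  have cross: "- X / u * (Y * u * Z / v) = Y * X * (- Z / v)" if "u \<noteq> 0" for X Y Z u v :: real
    using that by (simp add: field_simps)
  obtain m where m: "i = Suc (Suc m)" using assms by (metis add_2_eq_Suc le_Suc_ex)
  have "1 + \<alpha> * br m > 0" "1 + \<alpha> * br (Suc m) > 0" using one_alpha_pos assms m by auto
  then show ?thesis
    unfolding m diff_Suc_1 gtight_Suc ltight_def b_def diff_Suc_Suc diff_zero numeral_2_eq_2
    by (intro cross) simp
qed

lemma gfull_step:
  assumes "2 \<le> i" "i \<le> D"
  shows "gfull i * lfull i = b i * gfull (i - 1)"
proof -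
  have cross: "- \<alpha> * X / u * (Y * u * Z / v) = X * Z * (- \<alpha> * Y / v)" if "u \<noteq> 0" for X Y Z u v :: real
    using that by (simp add: field_simps)
  obtain m where m: "i = Suc (Suc m)" using assms by (metis add_2_eq_Suc le_Suc_ex)
  have "1 + \<alpha> * br m > 0" "1 + \<alpha> * br (Suc m) > 0" using one_alpha_pos assms m by auto
  then show ?thesis
    unfolding m diff_Suc_1 gfull_Suc lfull_def b_def diff_Suc_Suc diff_zero numeral_2_eq_2
    by (intro cross) simp
qed

lemma ltight_nonzero:
  assumes "2 \<le> i" "i < D"
  shows "ltight i \<noteq> 0"
proof -
  have "i - 1 < D" "i - 2 < D" using assms by auto
  then show ?thesis
    using br_diff_pos[OF assms(2)] one_alpha_pos[of "i - 1"] one_alpha_pos[of "i - 2"] beta_alpha_pos[of "i - 1"]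
    unfolding ltight_def by auto
qed

lemma lfull_nonzero:
  assumes "2 \<le> i" "i < D"
  shows "lfull i \<noteq> 0"
proof -
  have "i - 1 < D" "i - 2 < D" using assms by auto
  then show ?thesis
    using br_diff_pos[of "i - 1"] one_alpha_pos[of "i - 1"] one_alpha_pos[of "i - 2"] beta_alpha_pos[OF assms(2)]
    unfolding lfull_def by auto
qed

text \<open>The local eigenvalue is \<open>- 1 - g 1\<close>. Since \<open>b D = ltight D = 0\<close>, the second and third kind of chain stop at
  level \<open>D - 1\<close>.\<close>

lemma chain_minus_one:
  assumes "chain w g" "g 1 = 0" "2 \<le> i" "i \<le> D"
  shows "ell g i = b (i - 1)" "wp (i - 1) w \<noteq> 0"
proof -
  note * = chain_closed_form[OF assms(1) order_refl, of "\<lambda>_. 0" "\<lambda>i. b (i - 1)"]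
  have pos: "b (i - 1) > 0" if "2 \<le> i" "i \<le> D" for i using b_pos that by simp
  show "ell g i = b (i - 1)" by (rule *(2)) (use assms ell_const_0 pos in \<open>force+\<close>)
  show "wp (i - 1) w \<noteq> 0" by (rule *(1)[THEN conjunct2]) (use assms ell_const_0 pos in \<open>force+\<close>)
qed

lemma chain_q:
  assumes "chain w g" "g 1 = q" "2 \<le> i" "i \<le> D"
  shows "ell g i = b i" "wp (i - 1) w \<noteq> 0"
proof -
  note * = chain_closed_form[OF assms(1) order_refl, of "\<lambda>_. q" b]
  have pos: "b i > 0" if "i < D" for i using b_pos that by simp
  show "ell g i = b i" by (rule *(2)) (use assms ell_const_q pos in \<open>force+\<close>)
  show "wp (i - 1) w \<noteq> 0" by (rule *(1)[THEN conjunct2]) (use assms ell_const_q pos in \<open>force+\<close>)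
qed

lemma chain_tight:
  assumes "chain w g" "g 1 = \<alpha> - \<beta>" "2 \<le> i" "i \<le> D"
  shows "ell g i = ltight i" "wp (i - 1) w \<noteq> 0"
proof -
  note * = chain_closed_form[OF assms(1) order_refl, of gtight ltight]
  have "gtight 1 = g 1" using assms(2) by (simp add: gtight_def)
  note 1 = this
  show "ell g i = ltight i" by (rule *(2)) (use assms(3,4) 1 ell_gtight gtight_step ltight_nonzero in auto)
  show "wp (i - 1) w \<noteq> 0" by (rule *(1)[THEN conjunct2]) (use assms(3,4) 1 ell_gtight gtight_step ltight_nonzero in auto)
qed

lemma chain_full:
  assumes "chain w g" "g 1 = - \<alpha> * (br D - 1)" "2 \<le> i" "i \<le> D"
  shows "ell g i = lfull i" "wp (i - 1) w \<noteq> 0"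
proof -
  note * = chain_closed_form[OF assms(1) order_refl, of gfull lfull]
  have 1: "gfull 1 = g 1" using assms(2) by (simp add: gfull_def)
  show "ell g i = lfull i" by (rule *(2)) (use assms(3,4) 1 ell_gfull gfull_step lfull_nonzero in auto)
  show "wp (i - 1) w \<noteq> 0" by (rule *(1)[THEN conjunct2]) (use assms(3,4) 1 ell_gfull gfull_step lfull_nonzero in auto)
qed

section \<open>The tridiagonal relation\<close>

text \<open>\<open>kpow m i\<close> is the entry of \<open>A\<^sup>m\<close> at two vertices at distance \<open>i\<close>.\<close>

fun kpow :: "nat \<Rightarrow> nat \<Rightarrow> real" where
  "kpow 0 i = (if i = 0 then 1 else 0)"
| "kpow (Suc m) i = c i * kpow m (i - 1) + a i * kpow m i + b i * kpow m (Suc i)"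

lemma sum_nbr:
  "(\<Sum>u\<in>UNIV. if E y u then f (d u z) else 0)
     = c (d y z) * f (d y z - 1) + a (d y z) * f (d y z) + b (d y z) * f (Suc (d y z))"
  for f :: "nat \<Rightarrow> real"
proof -
  have "(if E y u then f (d u z) else 0) =
      (if E y u \<and> Suc (d u z) = d y z then f (d y z - 1) else 0)
      + (if E y u \<and> d u z = d y z then f (d y z) else 0)
      + (if E y u \<and> d u z = Suc (d y z) then f (Suc (d y z)) else 0)" for u
  proof (cases "E y u")
    case True
    then have "Suc (d u z) = d y z \<or> d u z = d y z \<or> d u z = Suc (d y z)"
      using d_step'[OF True, of z] by linarith
    moreover have "d y z - 1 = d u z" if "Suc (d u z) = d y z" using that[symmetric] by simp
    ultimately show ?thesis using True by auto
  qed simp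
  then show ?thesis
    using card_a[of y z] card_b[of y z] card_c[of y z]
    by (simp add: sum.distrib sum.If_cases)
qed

lemma sum_nbr': "(\<Sum>u\<in>UNIV. if E y u then kpow m (d u z) else 0) = kpow (Suc m) (d y z)"
  by (simp add: sum_nbr)

lemma sum_kpow: "(\<Sum>w\<in>UNIV. kpow m (d y w) * kpow n (d w z)) = kpow (m + n) (d y z)"
proof (induction m arbitrary: y)
  case 0
  have "kpow 0 (d y w) * kpow n (d w z) = (if w = y then kpow n (d w z) else 0)" for w
    by (auto simp: d_eq_0)
  then show ?case by (simp only:) simp
next
  case (Suc m)
  have "(\<Sum>w\<in>UNIV. kpow (Suc m) (d y w) * kpow n (d w z))
      = (\<Sum>w\<in>UNIV. \<Sum>u\<in>UNIV. if E y u then kpow m (d u w) * kpow n (d w z) else 0)"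
    unfolding sum_nbr'[symmetric] sum_distrib_right by (intro sum.cong) auto
  also have "\<dots> = (\<Sum>u\<in>UNIV. if E y u then kpow (m + n) (d u z) else 0)"
    by (subst sum.swap) (auto simp: Suc.IH intro!: sum.cong)
  finally show ?case by (simp only: sum_nbr' add_Suc)
qed

text \<open>In \<open>c i - b i / q\<close> the squares of \<open>br i\<close> cancel, and
  \<open>ths\<close> is the coefficient of \<open>br i\<close> in the affine function that remains.
  The companion \<open>thr\<close> is the eigenvalue \<open>b 1 / q - 1\<close> minus the valency
  \<open>b 0\<close>.\<close>

definition ths :: real where "ths = 1 + (\<beta> - \<alpha> + \<alpha> * br D) / q"

definition thr :: real where "thr = - ((q - 1) * b 0 / q + ths)"

text \<open>The dual eigenvalue sequence, up to scaling, of the eigenvalue \<open>b\<^sub>1 / q - 1\<close>.\<close>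

definition th :: "nat \<Rightarrow> real" where "th i = ths + thr * (1 / q) ^ i"

lemma q_br: "(q - 1) * br i = q ^ i - 1"
  by (induction i) (simp_all add: qbracket_Suc algebra_simps)

lemma th_eigen:
  "c i * th (i - 1) + a i * th i + b i * th (Suc i) = (b 1 / q - 1) * th i"
proof -
  define p where "p = (1 / q) ^ i"
  have p: "q ^ i * p = 1" using q_pos by (simp add: p_def power_one_over)
  have th1: "c i * th (i - 1) = c i * (ths + thr * q * p)"
    using q_pos by (cases i) (auto simp: th_def p_def)
  have th2: "th (Suc i) = ths + thr * p / q" "th i = ths + thr * p"
    by (simp_all add: th_def p_def)
  have b0: "b 0 = br D * \<beta>" and b1: "b 1 = (br D - 1) * (\<beta> - \<alpha>)" by (simp_all add: b_def)
  have r: "b 1 / q - 1 - b 0 = thr"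
    unfolding b0 b1 thr_def ths_def using q_pos by (simp add: field_simps)
  have cb: "c i - b i / q = - b 0 / q + br i * ths"
    using q_pos by (simp add: c_eq b_def ths_def field_simps power2_eq_square)
  \<comment> \<open>The defect of the recurrence is \<open>thr\<close> times the defect of this
    identity, so the second-order equation reduces to a first-order one, which is affine in
    \<open>br i\<close>.\<close>
  have "ths + thr * p = (q - 1) * p * (c i - b i / q)"
  proof -
    have "(q - 1) * p * (c i - b i / q) = - (q - 1) * b 0 / q * p + ((q - 1) * br i) * p * ths"
      unfolding cb using q_pos by (simp add: field_simps)
    also have "\<dots> = ths + thr * p"
    proof -
      have "(q ^ i - 1) * p = 1 - p" using p by (simp add: algebra_simps)
      then show ?thesis unfolding q_br using q_pos by (simp add: thr_def field_simps)
    qed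
    finally show ?thesis ..
  qed
  then have "thr * (ths + thr * p) = thr * p * (q - 1) * (c i - b i / q)" by simp
  moreover have "c i * (ths + thr * q * p) + a i * (ths + thr * p) + b i * (ths + thr * p / q)
      = b 0 * (ths + thr * p) + thr * p * (q - 1) * (c i - b i / q)"
    using q_pos by (simp add: a_def field_simps)
  ultimately have "c i * (ths + thr * q * p) + a i * (ths + thr * p) + b i * (ths + thr * p / q)
      = (b 0 + thr) * (ths + thr * p)"
    by (simp add: algebra_simps)
  then show ?thesis unfolding th1 th2 r[symmetric] by simp
qed

lemma th_0: "th 0 \<noteq> 0"
  using b_pos[of 0] D_pos q_ge by (simp add: th_def thr_def)

text \<open>The vector with entries \<open>th (d x w)\<close> is an eigenvector of \<open>A\<close>
  by \<open>th_eigen\<close>; the three-term recurrence passes this on to every distance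
  matrix.\<close>

lemma th_sphere:
  assumes "h \<le> D"
  shows "\<exists>\<nu>. \<forall>y. (\<Sum>w\<in>UNIV. if d y w = h then th (d x w) else 0) = \<nu> * th (d x y)"
  using assms
proof (induction h rule: less_induct)
  case (less h)
  define U where "U h y = (\<Sum>w\<in>UNIV. if d y w = h then th (d x w) else 0)" for h y
  show ?case
  proof (cases h)
    case 0
    then show ?thesis by (intro exI[of _ 1]) (simp add: d_eq_0)
  next
    case (Suc j)
    obtain \<nu> where \<nu>: "\<And>y. U j y = \<nu> * th (d x y)" using less.IH[of j] less.prems Suc unfolding U_def by auto
    obtain \<mu> where \<mu>: "\<And>y. (if j = 0 then 0 else b (j - 1) * U (j - 1) y) = \<mu> * th (d x y)"
    proof (cases j)
      case 0
      then show ?thesis using that[of 0] by simp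
    next
      case (Suc i)
      then obtain \<mu>' where "\<And>y. U i y = \<mu>' * th (d x y)"
        using less.IH[of i] less.prems \<open>h = Suc j\<close> unfolding U_def by auto
      then show ?thesis using that[of "b i * \<mu>'"] Suc by simp
    qed
    have "(\<Sum>u\<in>UNIV. if E y u then U j u else 0)
        = c (Suc j) * U (Suc j) y + a j * U j y + (if j = 0 then 0 else b (j - 1) * U (j - 1) y)" for y
    proof -
      have "(\<Sum>u\<in>UNIV. if E y u then U j u else 0)
          = (\<Sum>u\<in>UNIV. \<Sum>w\<in>UNIV. if E y u \<and> d u w = j then th (d x w) else 0)"
        unfolding U_def by (intro sum.cong) auto
      also have "\<dots> = (\<Sum>w\<in>UNIV. real (card {u. E y u \<and> d u w = j}) * th (d x w))"
        by (subst sum.swap) (simp add: sum.If_cases)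
      also have "\<dots> = c (Suc j) * U (Suc j) y + a j * U j y + (if j = 0 then 0 else b (j - 1) * U (j - 1) y)"
        unfolding card_nbr_dist U_def
        by (auto simp: sum_distrib_left sum.distrib[symmetric] intro!: sum.cong)
      finally show ?thesis .
    qed
    moreover have "(\<Sum>u\<in>UNIV. if E y u then U j u else 0) = \<nu> * (b 1 / q - 1) * th (d x y)" for y
    proof -
      have "(\<Sum>u\<in>UNIV. if E y u then U j u else 0) = \<nu> * (\<Sum>u\<in>UNIV. if E y u then th (d u x) else 0)"
        unfolding \<nu> sum_distrib_left by (intro sum.cong) (auto simp: d_commute)
      then show ?thesis unfolding sum_nbr th_eigen by (simp add: d_commute[of y])
    qed
    ultimately have "c (Suc j) * U (Suc j) y = (\<nu> * (b 1 / q - 1) - a j * \<nu> - \<mu>) * th (d x y)" for y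
      using \<nu>[of y] \<mu>[of y] by (simp add: algebra_simps)
    moreover have "c (Suc j) > 0" using c_pos less.prems Suc by simp
    ultimately have "U (Suc j) y = (\<nu> * (b 1 / q - 1) - a j * \<nu> - \<mu>) / c (Suc j) * th (d x y)" for y
      by (simp add: field_simps)
    then show ?thesis unfolding U_def Suc by blast
  qed
qed

lemma th_convolution:
  "\<exists>\<kappa>. \<forall>y. (\<Sum>w\<in>UNIV. f (d y w) * th (d x w)) = \<kappa> * th (d x y)"
  for f :: "nat \<Rightarrow> real"
proof -
  have "\<forall>h\<in>{..D}. \<exists>\<nu>. \<forall>y. (\<Sum>w\<in>UNIV. if d y w = h then th (d x w) else 0) = \<nu> * th (d x y)"
    using th_sphere by simp
  from bchoice[OF this] obtain \<nu> where
    \<nu>: "\<And>h y. h \<in> {..D} \<Longrightarrow> (\<Sum>w\<in>UNIV. if d y w = h then th (d x w) else 0) = \<nu> h * th (d x y)"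
    by blast
  have "(\<Sum>w\<in>UNIV. f (d y w) * th (d x w)) = (\<Sum>h\<le>D. f h * \<nu> h) * th (d x y)" for y
  proof -
    have "(\<Sum>w\<in>UNIV. f (d y w) * th (d x w)) = (\<Sum>w\<in>UNIV. \<Sum>h\<le>D. if d y w = h then f h * th (d x w) else 0)"
      using d_le by (intro sum.cong) auto
    also have "\<dots> = (\<Sum>h\<le>D. f h * (\<Sum>w\<in>UNIV. if d y w = h then th (d x w) else 0))"
      by (subst sum.swap) (auto simp: sum_distrib_left intro!: sum.cong)
    also have "\<dots> = (\<Sum>h\<le>D. f h * \<nu> h) * th (d x y)"
      unfolding sum_distrib_right using \<nu> by (intro sum.cong) auto
    finally show ?thesis .
  qed
  then show ?thesis by blast
qed

end

text \<open>With \<open>h = 1 + \<eta>\<close> for the local eigenvalue \<open>\<eta>\<close>, the premise \<open>rel\<close> is the tridiagonal relation between levels 1 and 2.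
  It factors as \<open>g2 * (h - \<alpha> * q + (1 + \<alpha>) * g2) = 0\<close>, and substituting \<open>g2 = - b2 * h / P\<close> makes it a quartic in \<open>h\<close>.\<close>

lemma local_eigenvalue_cases:
  fixes q \<alpha> B M h g2 :: real
  assumes q: "q \<noteq> 0" "1 + q \<noteq> 0"
    and P: "P = - (h^2) + h * (B + \<alpha> * M - q - \<alpha> * q) + M * B"
    and b1: "b1 = M * B" and b2: "b2 = (M - q) * (B - \<alpha> * q)" and k: "k = (M + 1) * (B + \<alpha>)"
    and c2: "c2 = (1 + q) * (1 + \<alpha>)" and c3: "c3 = (1 + q + q^2) * (1 + \<alpha> + \<alpha> * q)"
    and a1: "a1 = B + \<alpha> + \<alpha> * M - 1" and a2: "a2 = k - b2 - c2"
    and g2: "g2 * P = - b2 * h"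
    and p2: "p2 = a1 - c2 + 1 - c2 * g2 - h"
    and l3: "l3 = (1 + g2) * (b2 - b1 - c2 * g2 - h) + h + c3 * g2 + b1"
    and gam: "q * (1 + q) * \<gamma> = q * (1 + q) * a1 - a2"
    and rho: "q^2 * \<rho> = q * (q + 1)^2 * k - (q + 1) * b1 * c2 + q^2 * a1^2 - q^2 * \<gamma> * a1"
    and rel: "q * (q + 1)^2 * P - (q + 1) * (c2 * l3) + q^2 * (h - 1)^2 - q * (q^2 + 1) * (h - 1) * p2
      + q^2 * p2^2 - q^2 * \<gamma> * ((h - 1) + p2) - q^2 * \<rho> = 0"
    and pos: "q > 0" "1 + \<alpha> \<noteq> 0" "b2 \<noteq> 0" "P \<noteq> 0"
  shows "h = 0 \<or> h = - q \<or> h = B \<or> h = \<alpha> * M"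
proof -
  define R where "R = q * (q + 1)^2 * P - (q + 1) * (c2 * l3) + q^2 * (h - 1)^2 - q * (q^2 + 1) * (h - 1) * p2
      + q^2 * p2^2 - q^2 * \<gamma> * ((h - 1) + p2) - q^2 * \<rho>"
  define S where "S = q * (q + 1)^2 * P - (q + 1) * (c2 * l3) + q^2 * (h - 1)^2 - q * (q^2 + 1) * (h - 1) * p2
      + q^2 * p2^2 - (q * (q + 1)^2 * k - (q + 1) * b1 * c2 + q^2 * a1^2)"
  have "R = S - q^2 * \<gamma> * (h - 1 + p2 - a1)"
    unfolding R_def S_def rho by (simp add: algebra_simps)
  \<comment> \<open>The factor \<open>1 + q\<close> makes the terms with \<gamma> accessible to the
    premise \<open>gam\<close>, which has no denominators.\<close>
  then have "(1 + q) * R = (1 + q) * (S - q^2 * \<gamma> * (h - 1 + p2 - a1))" by simp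
  also have "\<dots> = (1 + q) * S - q * (q * (1 + q) * \<gamma>) * (h - 1 + p2 - a1)" by Groebner_Basis.algebra
  also have "\<dots> = (1 + q) * S - q * (q * (1 + q) * a1 - a2) * (h - 1 + p2 - a1)"
    unfolding gam ..
  also have "\<dots> = (1 + q)^3 * (1 + q + q^2) * (1 + \<alpha>) * g2 * (h - \<alpha> * q + (1 + \<alpha>) * g2)"
    unfolding S_def l3 p2 P a2 k b1 b2 c2 c3 a1 by Groebner_Basis.algebra
  finally have "(1 + q)^3 * (1 + q + q^2) * (1 + \<alpha>) * g2 * (h - \<alpha> * q + (1 + \<alpha>) * g2) = (1 + q) * R" ..
  moreover have "1 + q + q^2 \<noteq> 0" using pos(1) by (intro less_imp_neq[symmetric] add_pos_pos) auto
  ultimately have "g2 * (h - \<alpha> * q + (1 + \<alpha>) * g2) = 0" using rel q pos unfolding R_def by simp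
  moreover have "(g2 * P) * ((h - \<alpha> * q) * P + (1 + \<alpha>) * (g2 * P)) = (g2 * (h - \<alpha> * q + (1 + \<alpha>) * g2)) * P^2"
    by Groebner_Basis.algebra
  ultimately have "(- b2 * h) * ((h - \<alpha> * q) * P + (1 + \<alpha>) * (- b2 * h)) = 0" unfolding g2 by simp
  then have "h * ((h - \<alpha> * q) * P - (1 + \<alpha>) * b2 * h) = 0" using pos(3) by (auto simp: mult.assoc)
  moreover have "(h - \<alpha> * q) * P - (1 + \<alpha>) * b2 * h = - ((h + q) * (h - B) * (h - \<alpha> * M))"
    unfolding P b2 by Groebner_Basis.algebra
  ultimately have "h * ((h + q) * (h - B) * (h - \<alpha> * M)) = 0" by simp
  then show ?thesis by auto
qed

text \<open>The tridiagonal relation between levels 1 and 2 of the primary module. Since \<gamma>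
  and \<rho> are already fixed by the lower levels, no freedom is left, and the relation has to be
  an identity in the classical parameters.\<close>

lemma primary_identity:
  fixes q \<alpha> B M b1 b2 k c2 c3 a1 a2 \<gamma> \<rho> :: real
  assumes "q \<noteq> 0" "1 + q \<noteq> 0"
    and b1: "b1 = M * B" and b2: "b2 = (M - q) * (B - \<alpha> * q)" and k: "k = (M + 1) * (B + \<alpha>)"
    and c2: "c2 = (1 + q) * (1 + \<alpha>)" and c3: "c3 = (1 + q + q^2) * (1 + \<alpha> + \<alpha> * q)"
    and a1: "a1 = B + \<alpha> + \<alpha> * M - 1" and a2: "a2 = k - b2 - c2"
    and gam: "q * (1 + q) * \<gamma> = q * (1 + q) * a1 - a2"
    and rho: "q^2 * \<rho> = q * (q + 1)^2 * k - (q + 1) * b1 * c2 + q^2 * a1^2 - q^2 * \<gamma> * a1"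
  shows "q * (q + 1)^2 * (b1 * c2) - q^3 * (q + 1) * k - (q + 1) * (b2 * c3) + q^2 * a1^2
      - q * (q^2 + 1) * (a1 * a2) + q^2 * a2^2 - q^2 * \<gamma> * (a1 + a2) - q^2 * \<rho> = 0" (is "?R = 0")
proof -
  define S where "S = q * (q + 1)^2 * (b1 * c2) - q^3 * (q + 1) * k - (q + 1) * (b2 * c3) + q^2 * a1^2
      - q * (q^2 + 1) * (a1 * a2) + q^2 * a2^2 - (q * (q + 1)^2 * k - (q + 1) * b1 * c2 + q^2 * a1^2)"
  have "?R = S - q^2 * \<gamma> * a2"
    unfolding S_def rho by (simp add: algebra_simps)
  then have "(1 + q) * ?R = (1 + q) * (S - q^2 * \<gamma> * a2)" by simp
  also have "\<dots> = (1 + q) * S - q * (q * (1 + q) * \<gamma>) * a2" by Groebner_Basis.algebra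
  also have "\<dots> = (1 + q) * S - q * (q * (1 + q) * a1 - a2) * a2" unfolding gam ..
  also have "\<dots> = 0"
    unfolding S_def a2 k b1 b2 c2 c3 a1 by Groebner_Basis.algebra
  finally show ?thesis using assms by simp
qed

text \<open>The left-hand side is the coefficient of one raising step of the tridiagonal relation:
  \<open>t0\<close> to \<open>t3\<close> are consecutive dual eigenvalues, \<open>x0\<close>,
  \<open>x1\<close>, \<open>x2\<close> the products of a raising and a lowering coefficient on three
  consecutive steps, \<open>f1\<close> and \<open>f2\<close> the flat eigenvalues on the two middle
  levels. For a geometric sequence plus a constant every coefficient is a multiple of
  \<open>z * (q - 1)\<close>, so the relation no longer depends on the level through the
  \<open>t\<close>.\<close>

lemma tridiagonal_raise:
  fixes q z s BB :: real
  assumes "BB * q = q^2 + q + 1" "t0 = s + z * q^2" "t1 = s + z * q" "t2 = s + z" "t3 * q = s * q + z"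
  shows "q^2 * ((t1 - BB * t0 + BB * t1 - t2) * x0 + (t1 - BB * t2 + BB * t1 - t2) * x1
      + (t1 - BB * t2 + BB * t3 - t2) * x2 + (t1 - t2) * f1^2 + (t1 - BB * t1 + BB * t2 - t2) * (f1 * f2)
      + (t1 - t2) * f2^2 - \<gamma> * (t1 - t2) * (f1 + f2) - \<rho> * (t1 - t2))
    = z * (q - 1) * (q * (q + 1)^2 * x1 - q^3 * (q + 1) * x0 - (q + 1) * x2 + q^2 * f1^2
      - q * (q^2 + 1) * (f1 * f2) + q^2 * f2^2 - q^2 * \<gamma> * (f1 + f2) - q^2 * \<rho>)"
proof -
  have 1: "(t1 - BB * t0 + BB * t1 - t2) = - (z * (q - 1) * q * (q + 1))"
    using assms(1) unfolding assms(2-4) by Groebner_Basis.algebra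
  have 2: "q * (t1 - BB * t2 + BB * t1 - t2) = z * (q - 1) * (q + 1)^2"
    using assms(1) unfolding assms(2-4) by Groebner_Basis.algebra
  have "q * (q * (t1 - BB * t2 + BB * t3 - t2)) = q * (q * (t1 - t2) - (BB * q) * t2) + (BB * q) * (t3 * q)"
    by Groebner_Basis.algebra
  then have 3: "q * (q * (t1 - BB * t2 + BB * t3 - t2)) = - (z * (q - 1) * (q + 1))"
    unfolding assms by Groebner_Basis.algebra
  have 4: "q * (t1 - BB * t1 + BB * t2 - t2) = - (z * (q - 1) * (q^2 + 1))"
    using assms(1) unfolding assms(2-4) by Groebner_Basis.algebra
  have 5: "t1 - t2 = z * (q - 1)" unfolding assms by Groebner_Basis.algebra
  have "q^2 * ((t1 - BB * t0 + BB * t1 - t2) * x0 + (t1 - BB * t2 + BB * t1 - t2) * x1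
      + (t1 - BB * t2 + BB * t3 - t2) * x2 + (t1 - t2) * f1^2 + (t1 - BB * t1 + BB * t2 - t2) * (f1 * f2)
      + (t1 - t2) * f2^2 - \<gamma> * (t1 - t2) * (f1 + f2) - \<rho> * (t1 - t2))
    = q^2 * (t1 - BB * t0 + BB * t1 - t2) * x0 + q * (q * (t1 - BB * t2 + BB * t1 - t2)) * x1
      + q * (q * (t1 - BB * t2 + BB * t3 - t2)) * x2 + q^2 * (t1 - t2) * f1^2
      + q * (q * (t1 - BB * t1 + BB * t2 - t2)) * (f1 * f2) + q^2 * (t1 - t2) * f2^2
      - q^2 * \<gamma> * (t1 - t2) * (f1 + f2) - q^2 * \<rho> * (t1 - t2)"
    by (simp add: algebra_simps power2_eq_square)
  then show ?thesis unfolding 1 2 3 4 5 by (simp add: algebra_simps power2_eq_square power3_eq_cube)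
qed

context classical_graph
begin

text \<open>\<open>T m n\<close> is the matrix \<open>A\<^sup>m \<Theta> A\<^sup>n\<close>, where \<open>\<Theta>\<close> is diagonal with entries \<open>th (d x w)\<close>.\<close>

definition T :: "nat \<Rightarrow> nat \<Rightarrow> 'a \<Rightarrow> 'a \<Rightarrow> real" where
  "T m n y z = (\<Sum>w\<in>UNIV. kpow m (d y w) * th (d x w) * kpow n (d w z))"

definition rpair :: "(nat \<Rightarrow> real) \<Rightarrow> (nat \<Rightarrow> real) \<Rightarrow> real" where
  "rpair f g = (\<Sum>w\<in>UNIV. f (d x w) * g (d x w))"

definition radA :: "(nat \<Rightarrow> real) \<Rightarrow> nat \<Rightarrow> real" where
  "radA f i = c i * f (i - 1) + a i * f i + b i * f (Suc i)"

definition Q :: "nat \<Rightarrow> nat \<Rightarrow> real" where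
  "Q p s = rpair (kpow p) (\<lambda>i. th i * kpow s i)"

text \<open>Summing over \<open>y\<close> and \<open>z\<close> merges the powers of \<open>A\<close> on both sides; what remains is a quadratic form in
  the vector with entries \<open>th (d x w)\<close>, which is an eigenvector of every distance matrix.\<close>

lemma T_inner: "\<exists>C. \<forall>m n m' n'. (\<Sum>y\<in>UNIV. \<Sum>z\<in>UNIV. T m n y z * T m' n' y z) = C * Q (m + m') (n + n')"
proof (intro exI allI)
  fix m n m' n'
  let ?t = "\<lambda>w. th (d x w)"
  let ?g = "\<lambda>y z w w'. (kpow m (d y w) * kpow m' (d y w')) * (kpow n (d w z) * kpow n' (d w' z)) * (?t w * ?t w')"
  obtain \<kappa> where \<kappa>: "\<And>y. (\<Sum>w\<in>UNIV. kpow (m + m') (d y w) * kpow (n + n') (d y w) * ?t w) = \<kappa> * ?t y"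
    using th_convolution[of "\<lambda>i. kpow (m + m') i * kpow (n + n') i"] by auto
  have "(\<Sum>y\<in>UNIV. \<Sum>z\<in>UNIV. T m n y z * T m' n' y z) = (\<Sum>y\<in>UNIV. \<Sum>z\<in>UNIV. \<Sum>w\<in>UNIV. \<Sum>w'\<in>UNIV. ?g y z w w')"
    unfolding T_def sum_product by (intro sum.cong refl) (simp add: algebra_simps)
  also have "\<dots> = (\<Sum>y\<in>UNIV. \<Sum>w\<in>UNIV. \<Sum>z\<in>UNIV. \<Sum>w'\<in>UNIV. ?g y z w w')"
    by (intro sum.cong refl sum.swap)
  also have "\<dots> = (\<Sum>w\<in>UNIV. \<Sum>y\<in>UNIV. \<Sum>z\<in>UNIV. \<Sum>w'\<in>UNIV. ?g y z w w')"
    by (rule sum.swap)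
  also have "\<dots> = (\<Sum>w\<in>UNIV. \<Sum>y\<in>UNIV. \<Sum>w'\<in>UNIV. \<Sum>z\<in>UNIV. ?g y z w w')"
    by (intro sum.cong refl sum.swap)
  also have "\<dots> = (\<Sum>w\<in>UNIV. \<Sum>w'\<in>UNIV. \<Sum>y\<in>UNIV. \<Sum>z\<in>UNIV. ?g y z w w')"
    by (intro sum.cong refl sum.swap)
  also have "\<dots> = (\<Sum>w\<in>UNIV. \<Sum>w'\<in>UNIV. kpow (m + m') (d w w') * kpow (n + n') (d w w') * ?t w' * ?t w)"
  proof (intro sum.cong refl)
    fix w w'
    have "(\<Sum>y\<in>UNIV. \<Sum>z\<in>UNIV. ?g y z w w')
        = (\<Sum>y\<in>UNIV. kpow m (d y w) * kpow m' (d y w')) * (\<Sum>z\<in>UNIV. kpow n (d w z) * kpow n' (d w' z)) * (?t w * ?t w')"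
      unfolding sum_product unfolding sum_distrib_right ..
    also have "(\<Sum>y\<in>UNIV. kpow m (d y w) * kpow m' (d y w')) = kpow (m + m') (d w w')"
      unfolding sum_kpow[symmetric] by (simp add: d_commute[of w])
    also have "(\<Sum>z\<in>UNIV. kpow n (d w z) * kpow n' (d w' z)) = kpow (n + n') (d w w')"
      unfolding sum_kpow[symmetric] by (simp add: d_commute[of w'])
    finally show "(\<Sum>y\<in>UNIV. \<Sum>z\<in>UNIV. ?g y z w w') = kpow (m + m') (d w w') * kpow (n + n') (d w w') * ?t w' * ?t w"
      by (simp add: algebra_simps)
  qed
  also have "\<dots> = (\<Sum>w\<in>UNIV. \<kappa> * ?t w * ?t w)"
    unfolding sum_distrib_right[symmetric] \<kappa> ..
  also have "\<dots> = \<kappa> * (\<Sum>w\<in>UNIV. ?t w * ?t w)"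
    by (simp add: sum_distrib_left mult.assoc)
  \<comment> \<open>At \<open>y = x\<close> the defining equation of \<kappa> reads
    \<open>\<kappa> * th 0 = Q (m + m') (n + n')\<close>, so the other factor does not depend on the
    four exponents.\<close>
  also have "\<dots> = (\<Sum>w\<in>UNIV. ?t w * ?t w) / th 0 * Q (m + m') (n + n')"
    using \<kappa>[of x] th_0 by (simp add: Q_def rpair_def algebra_simps)
  finally show "(\<Sum>y\<in>UNIV. \<Sum>z\<in>UNIV. T m n y z * T m' n' y z) = (\<Sum>w\<in>UNIV. ?t w * ?t w) / th 0 * Q (m + m') (n + n')" .
qed

lemma Q_commute: "Q p s = Q s p"
  by (simp add: Q_def rpair_def algebra_simps)

lemma rpair_radA: "rpair (radA f) g = rpair f (radA g)"
proof -
  have *: "(\<Sum>u\<in>UNIV. if E w u then h (d x u) else 0) = radA h (d x w)" for h w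
    using sum_nbr[of w h x] by (simp add: radA_def d_commute cong: if_cong)
  have "rpair (radA f) g = (\<Sum>w\<in>UNIV. \<Sum>u\<in>UNIV. if E w u then f (d x u) * g (d x w) else 0)"
    unfolding rpair_def *[symmetric] sum_distrib_right by (intro sum.cong) auto
  also have "\<dots> = (\<Sum>u\<in>UNIV. \<Sum>w\<in>UNIV. if E u w then f (d x u) * g (d x w) else 0)"
    by (subst sum.swap) (auto simp: E_sym intro!: sum.cong)
  also have "\<dots> = rpair f (radA g)"
    unfolding rpair_def *[symmetric] sum_distrib_left by (intro sum.cong) auto
  finally show ?thesis .
qed

lemma Q_Suc: "Q (Suc p) s = rpair (kpow p) (radA (\<lambda>i. th i * kpow s i))"
proof -
  have "kpow (Suc p) = radA (kpow p)" by (simp add: fun_eq_iff radA_def)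
  then show ?thesis unfolding Q_def using rpair_radA by simp
qed

lemma Q_Suc2: "Q (Suc (Suc p)) s = rpair (kpow p) (radA (radA (\<lambda>i. th i * kpow s i)))"
proof -
  have "kpow (Suc (Suc p)) = radA (radA (kpow p))" by (simp add: fun_eq_iff radA_def)
  then show ?thesis unfolding Q_def using rpair_radA by simp
qed

lemma Q_Suc3: "Q (Suc (Suc (Suc p))) s = rpair (kpow p) (radA (radA (radA (\<lambda>i. th i * kpow s i))))"
proof -
  have "kpow (Suc (Suc (Suc p))) = radA (radA (radA (kpow p)))" by (simp add: fun_eq_iff radA_def)
  then show ?thesis unfolding Q_def using rpair_radA by simp
qed

text \<open>\<open>t^3 - BB * t^2 + BB * t - 1\<close> has the roots 1, q and 1/q, so it annihilates
  the sequence \<open>th\<close>; this is why the part of the relation that moves by three levels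
  vanishes.\<close>

definition BB :: real where "BB = q + 1 / q + 1"

text \<open>The values for which the tridiagonal relation holds on the primary module between levels 0 and 2 and between
  levels 0 and 1, respectively.\<close>

definition gam :: real where "gam = a 1 - a 2 / (q * (1 + q))"

definition rho :: real where
  "rho = (q * (q + 1)^2 * b 0 - (q + 1) * b 1 * c 2) / q^2 + (a 1)^2 - gam * a 1"

text \<open>\<open>Y m n\<close> is the entry of \<open>A\<^sup>m X A\<^sup>n\<close> at \<open>(x, x)\<close>, for the matrix \<open>X\<close> defined below, and \<open>Z n\<close> is the radial vector
  \<open>X A\<^sup>n x\<close>.\<close>

definition Y :: "nat \<Rightarrow> nat \<Rightarrow> real" where
  "Y m n = Q (3 + m) n - BB * Q (2 + m) (1 + n) + BB * Q (1 + m) (2 + n) - Q m (3 + n)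
     - gam * (Q (2 + m) n - Q m (2 + n)) - rho * (Q (1 + m) n - Q m (1 + n))"

definition Z :: "nat \<Rightarrow> nat \<Rightarrow> real" where
  "Z n = (\<lambda>i. radA (radA (radA (\<lambda>i. th i * kpow n i))) i - BB * radA (radA (\<lambda>i. th i * kpow (1 + n) i)) i
     + BB * radA (\<lambda>i. th i * kpow (2 + n) i) i - th i * kpow (3 + n) i
     - gam * (radA (radA (\<lambda>i. th i * kpow n i)) i - th i * kpow (2 + n) i)
     - rho * (radA (\<lambda>i. th i * kpow n i) i - th i * kpow (1 + n) i))"

text \<open>\<open>X\<close> is skew-symmetric: transposition exchanges
  \<open>A\<^sup>m \<Theta> A\<^sup>n\<close> and
  \<open>A\<^sup>n \<Theta> A\<^sup>m\<close>.\<close>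

lemma Y_commute: "Y n m = - Y m n"
  unfolding Y_def Q_commute[of "3 + n" m] Q_commute[of "2 + n" "1 + m"] Q_commute[of "1 + n" "2 + m"]
    Q_commute[of n "3 + m"] Q_commute[of "2 + n" m] Q_commute[of n "2 + m"] Q_commute[of "1 + n" m]
    Q_commute[of n "1 + m"]
  by (simp add: algebra_simps)

lemma Y_rpair: "Y m n = rpair (kpow m) (Z n)"
proof -
  have "Y m n = rpair (kpow m) (radA (radA (radA (\<lambda>i. th i * kpow n i)))) - BB * rpair (kpow m) (radA (radA (\<lambda>i. th i * kpow (1 + n) i)))
     + BB * rpair (kpow m) (radA (\<lambda>i. th i * kpow (2 + n) i)) - rpair (kpow m) (\<lambda>i. th i * kpow (3 + n) i)
     - gam * (rpair (kpow m) (radA (radA (\<lambda>i. th i * kpow n i))) - rpair (kpow m) (\<lambda>i. th i * kpow (2 + n) i))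
     - rho * (rpair (kpow m) (radA (\<lambda>i. th i * kpow n i)) - rpair (kpow m) (\<lambda>i. th i * kpow (1 + n) i))"
  proof -
    have e: "3 + m = Suc (Suc (Suc m))" "2 + m = Suc (Suc m)" "1 + m = Suc m" by simp_all
    have "Q (3 + m) s = rpair (kpow m) (radA (radA (radA (\<lambda>i. th i * kpow s i))))"
      "Q (2 + m) s = rpair (kpow m) (radA (radA (\<lambda>i. th i * kpow s i)))"
      "Q (1 + m) s = rpair (kpow m) (radA (\<lambda>i. th i * kpow s i))" for s
      unfolding e by (rule Q_Suc3 Q_Suc2 Q_Suc)+
    then show ?thesis unfolding Y_def by (simp only: Q_def[of m])
  qed
  then show ?thesis
    unfolding rpair_def Z_def
    by (simp add: sum_distrib_left sum.distrib[symmetric] sum_subtractf[symmetric] algebra_simps del: kpow.simps)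
qed

lemma kpow_gt: "i > m \<Longrightarrow> kpow m i = 0"
  by (induction m arbitrary: i) auto

lemma Z_0_0: "Z 0 0 = 0"
  by (simp add: Z_def radA_def numeral_eq_Suc algebra_simps)

lemma Z_0_1: "Z 0 (Suc 0) = (th 0 - BB * th 1 + BB * th 0 - th 1) * b 0
      + (th 0 - BB * th 1 + BB * th 2 - th 1) * (b 1 * c 2) + (th 0 - th 1) * (a 1)^2
      - gam * (th 0 - th 1) * a 1 - rho * (th 0 - th 1)"
  by (simp add: Z_def radA_def numeral_eq_Suc algebra_simps)

lemma Z_0_2: "Z 0 2 = c 2 * ((th 0 - BB * th 1 + BB * th 1 - th 2) * a 1
      + (th 0 - BB * th 1 + BB * th 2 - th 2) * a 2 - gam * (th 0 - th 2))"
  by (simp add: Z_def radA_def numeral_eq_Suc algebra_simps)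

lemma Z_0_3: "Z 0 3 = c 2 * c 3 * (th 0 - BB * th 1 + BB * th 2 - th 3)"
  by (simp add: Z_def radA_def numeral_eq_Suc algebra_simps)

lemma Z_1_2: "Z (Suc 0) 2 = c 2 * ((th 1 - BB * th 0 + BB * th 1 - th 2) * b 0
      + (th 1 - BB * th 2 + BB * th 1 - th 2) * (b 1 * c 2) + (th 1 - BB * th 2 + BB * th 3 - th 2) * (b 2 * c 3)
      + (th 1 - th 2) * (a 1)^2 + (th 1 - BB * th 1 + BB * th 2 - th 2) * (a 1 * a 2)
      + (th 1 - th 2) * (a 2)^2 - gam * (th 1 - th 2) * (a 1 + a 2) - rho * (th 1 - th 2))"
  by (simp add: Z_def radA_def numeral_eq_Suc algebra_simps)

lemma parameter_forms:
  "b 0 = (br D - 1 + 1) * (\<beta> - \<alpha> + \<alpha>)" "b 1 = (br D - 1) * (\<beta> - \<alpha>)"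
  "b 2 = (br D - 1 - q) * (\<beta> - \<alpha> - \<alpha> * q)"
  "c 2 = (1 + q) * (1 + \<alpha>)" "c 3 = (1 + q + q^2) * (1 + \<alpha> + \<alpha> * q)"
  "a 1 = \<beta> - \<alpha> + \<alpha> + \<alpha> * (br D - 1) - 1" "a 2 = b 0 - b 2 - c 2"
  by (simp_all add: a_def b_def c_def qbracket_Suc numeral_eq_Suc algebra_simps)

lemma q_gam: "q * (1 + q) * gam = q * (1 + q) * a 1 - a 2"
  using q_pos by (simp add: gam_def right_diff_distrib)

lemma q_rho: "q^2 * rho = q * (q + 1)^2 * b 0 - (q + 1) * b 1 * c 2 + q^2 * (a 1)^2 - q^2 * gam * a 1"
  using q_pos by (simp add: rho_def field_simps)

lemma BB_q: "BB * q = q^2 + q + 1"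
  using q_pos by (simp add: BB_def field_simps power2_eq_square)

lemma th_forms:
  "th l = ths + thr * (1 / q) ^ (Suc l) * q" "th (Suc l) = ths + thr * (1 / q) ^ (Suc l)"
  "th (Suc (Suc l)) * q = ths * q + thr * (1 / q) ^ (Suc l)"
  "l > 0 \<Longrightarrow> th (l - 1) = ths + thr * (1 / q) ^ (Suc l) * q^2"
  using q_pos by (simp_all add: th_def field_simps power2_eq_square) (cases l; simp add: field_simps)

lemma Z_0_1': "Z 0 (Suc 0) = 0"
proof -
  note t = tridiagonal_raise[OF BB_q _ th_forms(1)[of 0] th_forms(2)[of 0] th_forms(3)[of 0], OF refl,
      of 0 "b 0" "b 1 * c 2" 0 "a 1" gam rho]
  have "q^2 * Z 0 (Suc 0) = thr * (1 / q) ^ (Suc 0) * (q - 1) * (q * (q + 1)^2 * b 0 - (q + 1) * (b 1 * c 2)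
      + q^2 * (a 1)^2 - q^2 * gam * a 1 - q^2 * rho)"
    using t by (simp add: Z_0_1 numeral_2_eq_2)
  also have "\<dots> = 0" using q_rho by (simp add: algebra_simps)
  finally show ?thesis using q_pos by simp
qed

lemma Z_1_2': "Z (Suc 0) 2 = 0"
proof -
  define z where "z = thr * (1 / q)^2"
  have th: "th 0 = ths + z * q^2" "th 1 = ths + z * q" "th 2 = ths + z" "th 3 * q = ths * q + z"
    using th_forms(1,2,3,4)[of 1] by (simp_all add: z_def numeral_eq_Suc)
  note t = tridiagonal_raise[OF BB_q th, of "b 0" "b 1 * c 2" "b 2 * c 3" "a 1" "a 2" gam rho]
  note p = primary_identity[OF _ _ parameter_forms(2,3,1,4-7) q_gam q_rho]
  have "q^2 * Z (Suc 0) 2 = c 2 * (z * (q - 1) * 0)"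
    unfolding Z_1_2 mult.left_commute[of "q^2"] t by (subst p) (use q_pos in auto)
  then show ?thesis using q_pos by simp
qed

lemma Z_0_2': "Z 0 2 = 0"
proof -
  define z where "z = thr * (1 / q)^2"
  have t: "th 1 = ths + z * q" "th 2 = ths + z" "th 0 = ths + z * q^2"
    using th_forms(1,2,4)[of 1] by (simp_all add: z_def numeral_2_eq_2)
  have 1: "th 0 - BB * th 1 + BB * th 1 - th 2 = z * (q - 1) * (1 + q)" 
    unfolding t by (simp add: algebra_simps power2_eq_square)
  have "th 0 - BB * th 1 + BB * th 2 - th 2 = z * (q^2 - 1) - z * (BB * q) + z * BB"
    unfolding t by (simp add: algebra_simps)
  then have 2: "q * (th 0 - BB * th 1 + BB * th 2 - th 2) = - (z * (q - 1))"
    using BB_q by Groebner_Basis.algebra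
  have 3: "th 0 - th 2 = z * (q - 1) * (1 + q)"
    unfolding t by (simp add: algebra_simps power2_eq_square)
  have "q * Z 0 2 = c 2 * (q * (th 0 - BB * th 1 + BB * th 1 - th 2) * a 1
      + (q * (th 0 - BB * th 1 + BB * th 2 - th 2)) * a 2 - q * gam * (th 0 - th 2))"
    unfolding Z_0_2 by (simp add: algebra_simps)
  also have "\<dots> = c 2 * (z * (q - 1)) * (q * (1 + q) * a 1 - a 2 - q * (1 + q) * gam)"
    unfolding 1 2 3 by (simp add: algebra_simps)
  also have "\<dots> = 0" unfolding q_gam by simp
  finally show ?thesis using q_pos by simp
qed

lemma Z_0_3': "Z 0 3 = 0"
proof -
  define z where "z = thr * (1 / q)^3"
  have t: "th 1 = ths + z * q^2" "th 2 = ths + z * q" "th 0 = ths + z * q^3" "th 3 = ths + z"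
    using q_pos by (simp_all add: th_def z_def field_simps power2_eq_square power3_eq_cube)
  have "th 0 - BB * th 1 + BB * th 2 - th 3 = 0"
    unfolding t using BB_q by Groebner_Basis.algebra
  then show ?thesis by (simp add: Z_0_3)
qed

lemma Y_0_right:
  assumes "m \<le> 3"
  shows "Y m 0 = 0"
proof -
  have "kpow m i * Z 0 i = 0" for i
  proof (cases "i > m")
    case True
    then show ?thesis using kpow_gt by simp
  next
    case False
    then have "i = 0 \<or> i = Suc 0 \<or> i = 2 \<or> i = 3" using assms by linarith
    then show ?thesis using Z_0_0 Z_0_1' Z_0_2' Z_0_3' by auto
  qed
  then show ?thesis by (simp only: Y_rpair rpair_def sum.neutral_const)
qed

text \<open>\<open>A\<^sup>2\<close> is a combination of the identity, \<open>A\<close> and the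
  distance-2 matrix. The last contributes \<open>Z 1 2 = 0\<close>, and what is left,
  \<open>Y 0 1\<close> and \<open>Y 1 1\<close>, vanishes by skew-symmetry.\<close>

lemma Y_2_1: "Y 2 1 = 0"
proof -
  have "kpow 2 i * Z 1 i = (b 0 * kpow 0 i + a 1 * kpow 1 i) * Z 1 i" for i
  proof (cases "i = 2")
    case True
    then show ?thesis using Z_1_2' by simp
  next
    case False
    then have "kpow 2 i = b 0 * kpow 0 i + a 1 * kpow 1 i"
      by (cases i; cases "i - 1") (auto simp: numeral_2_eq_2)
    then show ?thesis by simp
  qed
  then have "Y 2 1 = b 0 * Y 0 1 + a 1 * Y 1 1"
    by (simp add: Y_rpair rpair_def sum.distrib sum_distrib_left algebra_simps del: kpow.simps)
  moreover have "Y 1 1 = 0" using Y_commute[of 1 1] by simp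
  moreover have "Y 0 1 = 0" using Y_commute[of 1 0] Y_0_right[of 1] by simp
  ultimately show ?thesis by simp
qed

text \<open>The expanded commutator of \<open>A\<close> with \<open>A\<^sup>2 \<Theta> - (q + 1 / q)
  A \<Theta> A + \<Theta> A\<^sup>2 - gam (A \<Theta> + \<Theta> A) - rho \<Theta>\<close>.\<close>

definition X :: "'a \<Rightarrow> 'a \<Rightarrow> real" where
  "X y z = T 3 0 y z - BB * T 2 1 y z + BB * T 1 2 y z - T 0 3 y z - gam * (T 2 0 y z - T 0 2 y z)
     - rho * (T 1 0 y z - T 0 1 y z)"

text \<open>The tridiagonal relation holds since the sum of the squares of the entries of \<open>X\<close> is a combination of
  values of \<open>X\<close> on the primary module.\<close>

lemma X_eq_0: "X y z = 0"
proof -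
  let ?S = "\<lambda>f. \<Sum>y\<in>UNIV. \<Sum>z\<in>UNIV. f y z :: real"
  obtain C where C: "\<And>m n m' n'. ?S (\<lambda>y z. T m n y z * T m' n' y z) = C * Q (m + m') (n + n')"
    using T_inner by blast
  have lin: "?S (\<lambda>y z. f y z * X y z) = ?S (\<lambda>y z. f y z * T 3 0 y z) - BB * ?S (\<lambda>y z. f y z * T 2 1 y z)
      + BB * ?S (\<lambda>y z. f y z * T 1 2 y z) - ?S (\<lambda>y z. f y z * T 0 3 y z)
      - gam * (?S (\<lambda>y z. f y z * T 2 0 y z) - ?S (\<lambda>y z. f y z * T 0 2 y z))
      - rho * (?S (\<lambda>y z. f y z * T 1 0 y z) - ?S (\<lambda>y z. f y z * T 0 1 y z))" for f
  proof -
    have "f y z * X y z = f y z * T 3 0 y z - BB * (f y z * T 2 1 y z) + BB * (f y z * T 1 2 y z)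
      - f y z * T 0 3 y z - gam * (f y z * T 2 0 y z - f y z * T 0 2 y z)
      - rho * (f y z * T 1 0 y z - f y z * T 0 1 y z)" for y z
      by (simp add: X_def algebra_simps)
    then show ?thesis by (simp only: sum.distrib sum_subtractf sum_distrib_left[symmetric])
  qed
  have TX: "?S (\<lambda>y z. T m n y z * X y z) = C * Y m n" for m n
    unfolding lin[of "T m n"] unfolding C Y_def by (simp add: algebra_simps)
  have XT: "?S (\<lambda>y z. X y z * T m n y z) = C * Y m n" for m n
    unfolding TX[symmetric] by (simp only: mult.commute)
  have "?S (\<lambda>y z. X y z * X y z) = C * (Y 3 0 - BB * Y 2 1 + BB * Y 1 2 - Y 0 3 - gam * (Y 2 0 - Y 0 2)
      - rho * (Y 1 0 - Y 0 1))"
    unfolding lin[of X] unfolding XT by (simp add: algebra_simps)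
  also have "\<dots> = 0"
    using Y_0_right[of 3] Y_0_right[of 2] Y_0_right[of 1] Y_2_1 Y_commute[of 0 3] Y_commute[of 0 2]
      Y_commute[of 0 1] Y_commute[of 1 2] by simp
  finally have "?S (\<lambda>y z. X y z * X y z) = 0" .
  then have "(\<Sum>z\<in>UNIV. X y z * X y z) = 0" for y
    by (subst (asm) sum_nonneg_eq_0_iff) (auto intro: sum_nonneg)
  then have "X y z * X y z = 0"
    using sum_nonneg_eq_0_iff[of UNIV "\<lambda>z. X y z * X y z"] by auto
  then show ?thesis by simp
qed

section \<open>Local eigenvalues from the tridiagonal relation\<close>

definition dth :: "complex ^ 'a \<Rightarrow> complex ^ 'a" where
  "dth v = (\<chi> y. th (d x y) *\<^sub>R v $ y)"

lemma dth_add: "dth (u + v) = dth u + dth v"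
  and dth_scaleR: "dth (r *\<^sub>R v) = r *\<^sub>R dth v"
  and lev_dth: "lev i (dth v) = th i *\<^sub>R lev i v"
  and dth_lev: "dth (lev i v) = th i *\<^sub>R lev i v"
  by (auto simp: dth_def cvec_eq_iff lev_nth algebra_simps)

lemma Apow_nth: "(Aop ^^ m) v $ y = (\<Sum>z\<in>UNIV. kpow m (d y z) *\<^sub>R v $ z)"
proof (induction m arbitrary: y)
  case 0
  have "kpow 0 (d y z) *\<^sub>R v $ z = (if z = y then v $ z else 0)" for z
    by (auto simp: d_eq_0)
  then show ?case by simp
next
  case (Suc m)
  have "(Aop ^^ Suc m) v $ y = (\<Sum>u\<in>UNIV. if E y u then (\<Sum>z\<in>UNIV. kpow m (d u z) *\<^sub>R v $ z) else 0)"
    by (simp add: relop_nth Suc.IH cong: if_cong)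
  also have "\<dots> = (\<Sum>u\<in>UNIV. \<Sum>z\<in>UNIV. (if E y u then kpow m (d u z) else 0) *\<^sub>R v $ z)"
    by (intro sum.cong) auto
  also have "\<dots> = (\<Sum>z\<in>UNIV. (\<Sum>u\<in>UNIV. if E y u then kpow m (d u z) else 0) *\<^sub>R v $ z)"
    by (subst sum.swap) (simp add: scaleR_sum_left)
  finally show ?case unfolding sum_nbr' .
qed

lemma T_vec: "(\<Sum>z\<in>UNIV. T m n y z *\<^sub>R v $ z) = (Aop ^^ m) (dth ((Aop ^^ n) v)) $ y"
proof -
  have "(\<Sum>z\<in>UNIV. T m n y z *\<^sub>R v $ z) =
      (\<Sum>z\<in>UNIV. \<Sum>w\<in>UNIV. (kpow m (d y w) * th (d x w) * kpow n (d w z)) *\<^sub>R v $ z)"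
    unfolding T_def scaleR_sum_left ..
  also have "\<dots> = (\<Sum>w\<in>UNIV. kpow m (d y w) *\<^sub>R (th (d x w) *\<^sub>R (\<Sum>z\<in>UNIV. kpow n (d w z) *\<^sub>R v $ z)))"
    by (subst sum.swap) (simp add: scaleR_sum_right mult.assoc)
  finally show ?thesis by (simp add: Apow_nth dth_def)
qed

lemma tridiagonal_vec:
  "(Aop ^^ 3) (dth v) - BB *\<^sub>R (Aop ^^ 2) (dth (Aop v)) + BB *\<^sub>R Aop (dth ((Aop ^^ 2) v))
     - dth ((Aop ^^ 3) v) - gam *\<^sub>R ((Aop ^^ 2) (dth v) - dth ((Aop ^^ 2) v))
     - rho *\<^sub>R (Aop (dth v) - dth (Aop v)) = 0"
proof -
  have "(\<Sum>z\<in>UNIV. X y z *\<^sub>R v $ z) = 0" for y by (simp add: X_eq_0)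
  then show ?thesis
    unfolding X_def scaleR_diff_left scaleR_add_left sum_subtractf sum.distrib scaleR_scaleR[symmetric]
      scaleR_sum_right[symmetric] T_vec
    by (simp add: cvec_eq_iff)
qed

lemma a_1_nonneg: "a 1 \<ge> 0"
proof -
  obtain y z where "d y z = 1" using path_dist_attained[OF graph, of 1] diameter D_pos by auto
  then show ?thesis using card_a[of y z] by (metis of_nat_0_le_iff)
qed

lemma thr_neg: "thr < 0"
proof -
  have "ths = (q + a 1 + 1) / q" using q_pos parameter_forms(6) by (simp add: ths_def field_simps)
  then have "ths > 0" using a_1_nonneg q_pos by simp
  moreover have "(q - 1) * b 0 / q > 0" using b_pos[OF D_pos] q_ge by simp
  ultimately show ?thesis by (simp add: thr_def)
qed

lemma wp_lev [simp]: "lev j (wp i w) = (if i = j then wp i w else 0)"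
  by (auto simp: wp_def)

lemma A_wp:
  assumes "chain w g" "1 \<le> i" "i \<le> D"
  shows "Aop (wp i w) = (if i = 1 then 0 else ell g i *\<^sub>R wp (i - 1) w) + phi g i *\<^sub>R wp i w + c i *\<^sub>R wp (Suc i) w"
proof -
  have lw: "local_vec w" using assms(1) by (simp add: chain_def)
  have "Rop (wp i w) = c i *\<^sub>R wp (Suc i) w" using R_wp[OF lw, of "i - 1"] assms by simp
  moreover have "Lop (wp i w) = (if i = 1 then 0 else ell g i *\<^sub>R wp (i - 1) w)"
    using chain_L[OF assms(1), of i] assms wp_1[OF lw] L_local[OF lw] by auto
  ultimately show ?thesis using assms unfolding A_split by (simp add: chain_def)
qed

text \<open>Level 2 of the tridiagonal relation applied to \<open>w\<close>. The factor 0 stands for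
  the missing step between levels 0 and 1, as \<open>Lop w = 0\<close>; keeping it preserves the
  shape of \<open>tridiagonal_raise\<close>.\<close>

lemma chain_tridiagonal:
  assumes "chain w g" "wp 2 w \<noteq> 0"
  shows "(th 1 - BB * th 0 + BB * th 1 - th 2) * 0 + (th 1 - BB * th 2 + BB * th 1 - th 2) * ell g 2
      + (th 1 - BB * th 2 + BB * th 3 - th 2) * (c 2 * ell g 3)
      + (th 1 - th 2) * (phi g 1)^2 + (th 1 - BB * th 1 + BB * th 2 - th 2) * (phi g 1 * phi g 2)
      + (th 1 - th 2) * (phi g 2)^2 - gam * (th 1 - th 2) * (phi g 1 + phi g 2) - rho * (th 1 - th 2) = 0"
    (is "?e = 0")
proof -
  \<comment> \<open>Three coordinates suffice: two applications of \<open>Aop\<close> to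
    \<open>w\<close> reach level 3 at most, and of the third application only level 2 is read
    off.\<close>
  define V where "V p1 p2 p3 = p1 *\<^sub>R wp 1 w + p2 *\<^sub>R wp 2 w + p3 *\<^sub>R wp 3 w" for p1 p2 p3 :: real
  have A1: "Aop (wp 1 w) = phi g 1 *\<^sub>R wp 1 w + wp 2 w"
    and A2: "Aop (wp 2 w) = ell g 2 *\<^sub>R wp 1 w + phi g 2 *\<^sub>R wp 2 w + c 2 *\<^sub>R wp 3 w"
    and A3: "Aop (wp 3 w) = ell g 3 *\<^sub>R wp 2 w + phi g 3 *\<^sub>R wp 3 w + c 3 *\<^sub>R wp 4 w"
    using A_wp[OF assms(1), of 1] A_wp[OF assms(1), of 2] A_wp[OF assms(1), of 3] D_ge
    by (simp_all add: numeral_eq_Suc)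
  have AV: "Aop (V p1 p2 0) = V (p1 * phi g 1 + p2 * ell g 2) (p1 + p2 * phi g 2) (p2 * c 2)" for p1 p2
    unfolding V_def relop_add relop_scaleR A1 A2 by (simp add: algebra_simps)
  have lA: "lev 2 (Aop (V p1 p2 p3)) = (p1 + p2 * phi g 2 + p3 * ell g 3) *\<^sub>R wp 2 w" for p1 p2 p3
    unfolding V_def relop_add[of E] relop_scaleR[of E] A1 A2 A3 by (simp add: algebra_simps)
  have lV: "lev 2 (V p1 p2 p3) = p2 *\<^sub>R wp 2 w" for p1 p2 p3
    unfolding V_def by simp
  have dV: "dth (V p1 p2 p3) = V (p1 * th 1) (p2 * th 2) (p3 * th 3)" for p1 p2 p3
    unfolding V_def dth_add dth_scaleR wp_def dth_lev by (simp add: algebra_simps)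
  have w: "w = V 1 0 0" using assms(1) wp_1 by (simp add: V_def chain_def)
  have "lev 2 ((Aop ^^ 3) (dth w) - BB *\<^sub>R (Aop ^^ 2) (dth (Aop w)) + BB *\<^sub>R Aop (dth ((Aop ^^ 2) w))
     - dth ((Aop ^^ 3) w) - gam *\<^sub>R ((Aop ^^ 2) (dth w) - dth ((Aop ^^ 2) w))
     - rho *\<^sub>R (Aop (dth w) - dth (Aop w))) = ?e *\<^sub>R wp 2 w"
  proof -
    have p: "(Aop ^^ 3) v = Aop (Aop (Aop v))" "(Aop ^^ 2) v = Aop (Aop v)" for v
      by (simp_all add: numeral_eq_Suc)
    have dw: "dth w = V (th 1) 0 0" and Aw: "Aop w = V (phi g 1) 1 0"
      using dV[of 1 0 0] AV[of 1 0] w by simp_all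
    have Adw: "Aop (dth w) = V (th 1 * phi g 1) (th 1) 0" unfolding dw AV by simp
    have AAdw: "Aop (Aop (dth w)) = V (th 1 * phi g 1 * phi g 1 + th 1 * ell g 2) (th 1 * phi g 1 + th 1 * phi g 2) (th 1 * c 2)"
      unfolding Adw AV ..
    have dAw: "dth (Aop w) = V (phi g 1 * th 1) (th 2) 0" unfolding Aw dV by simp
    have AdAw: "Aop (dth (Aop w)) = V (phi g 1 * th 1 * phi g 1 + th 2 * ell g 2) (phi g 1 * th 1 + th 2 * phi g 2) (th 2 * c 2)"
      unfolding dAw AV ..
    have AAw: "Aop (Aop w) = V (phi g 1 * phi g 1 + ell g 2) (phi g 1 + phi g 2) (c 2)" unfolding Aw AV by simp
    show ?thesis
      unfolding p relop_diff[of "\<lambda>y z. y = z \<and> d x y = 2"] relop_add[of "\<lambda>y z. y = z \<and> d x y = 2"]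
        relop_scaleR[of "\<lambda>y z. y = z \<and> d x y = 2"] lev_dth
      unfolding AAdw unfolding AdAw unfolding AAw unfolding Adw unfolding dV lA lV lev_dth unfolding Aw lV
      by (simp add: algebra_simps power2_eq_square)
  qed
  then show ?thesis using assms(2) unfolding tridiagonal_vec by simp
qed

lemma chain_eigenvalue:
  assumes "chain w g"
  shows "g 1 = 0 \<or> g 1 = q \<or> g 1 = \<alpha> - \<beta> \<or> g 1 = - \<alpha> * (br D - 1)"
proof (cases "wp 2 w = 0")
  case True
  have lw: "local_vec w" "w \<noteq> 0" using assms by (auto simp: chain_def)
  then have w1: "wp 1 w \<noteq> 0" using wp_1 by simp
  then have "ell g 2 = 0" using chain_wp_nonzero[OF assms, of 2] True D_ge by simp
  then have "b 2 * g 1 = 0" using chain_g[OF assms, of 2] w1 D_ge by simp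
  then show ?thesis using b_pos[of 2] D_ge by simp
next
  case False
  have lw: "local_vec w" "w \<noteq> 0" using assms by (auto simp: chain_def)
  then have w1: "wp 1 w \<noteq> 0" using wp_1 by simp
  then have l2: "ell g 2 \<noteq> 0" using chain_wp_nonzero[OF assms, of 2] False D_ge by simp
  define z where "z = thr * (1 / q)^2"
  have th: "th 0 = ths + z * q^2" "th 1 = ths + z * q" "th 2 = ths + z" "th 3 * q = ths * q + z"
    using th_forms(1,2,3,4)[of 1] by (simp_all add: z_def numeral_eq_Suc)
  note t = tridiagonal_raise[OF BB_q th, of 0 "ell g 2" "c 2 * ell g 3" "phi g 1" "phi g 2" gam rho]
  have "z * (q - 1) \<noteq> 0" using thr_neg q_ge by (simp add: z_def)
  then have r: "q * (q + 1)^2 * ell g 2 - q^3 * (q + 1) * 0 - (q + 1) * (c 2 * ell g 3) + q^2 * (phi g 1)^2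
      - q * (q^2 + 1) * (phi g 1 * phi g 2) + q^2 * (phi g 2)^2 - q^2 * gam * (phi g 1 + phi g 2) - q^2 * rho = 0"
    using t unfolding chain_tridiagonal[OF assms False] by simp
  define h where "h = - g 1"
  have phi1: "phi g 1 = h - 1" by (simp add: phi_def h_def)
  have P: "ell g 2 = - (h^2) + h * (\<beta> - \<alpha> + \<alpha> * (br D - 1) - q - \<alpha> * q) + (br D - 1) * (\<beta> - \<alpha>)"
  proof -
    have "ell g 2 = (1 - h) * (b 1 - b 0 + h) - c 2 * h + b 0"
      using ell_eq[of g 0] by (simp add: numeral_2_eq_2 h_def)
    then show ?thesis unfolding parameter_forms by (simp add: algebra_simps power2_eq_square)
  qed
  have phi2: "phi g 2 = a 1 - c 2 + 1 - c 2 * g 2 - h"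
    by (simp add: phi_def h_def numeral_2_eq_2)
  have l3: "ell g 3 = (1 + g 2) * (b 2 - b 1 - c 2 * g 2 - h) + h + c 3 * g 2 + b 1"
    using ell_eq[of g 1] by (simp add: h_def numeral_eq_Suc)
  have g2: "g 2 * ell g 2 = - b 2 * h"
    using chain_g[OF assms, of 2] w1 D_ge by (simp add: h_def)
  have rel: "q * (q + 1)^2 * ell g 2 - (q + 1) * (c 2 * ell g 3) + q^2 * (h - 1)^2
      - q * (q^2 + 1) * (h - 1) * phi g 2 + q^2 * (phi g 2)^2 - q^2 * gam * ((h - 1) + phi g 2) - q^2 * rho = 0"
    using r unfolding phi1 by (simp add: mult.assoc)
  have "1 + \<alpha> \<noteq> 0" "b 2 \<noteq> 0" "q \<noteq> 0" "1 + q \<noteq> 0"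
    using one_alpha_pos[of 1] b_pos[of 2] D_ge q_pos by simp_all
  then have "h = 0 \<or> h = - q \<or> h = \<beta> - \<alpha> \<or> h = \<alpha> * (br D - 1)"
    using local_eigenvalue_cases[OF _ _ P parameter_forms(2,3,1,4-7) g2 phi2 l3 q_gam q_rho rel q_pos _ _ l2]
    by blast
  then show ?thesis by (auto simp: h_def)
qed

end

section \<open>Rows of the uniform structure\<close>

text \<open>The form in which the nonsingular blocks are used: a sequence satisfying the homogeneous
  three-term rows \<open>s\<close> to \<open>t\<close>, with nothing entering from outside, is a
  kernel vector of the block.\<close>

lemma parameter_matrix_kernel:
  fixes e :: "nat \<Rightarrow> nat \<Rightarrow> complex" and z :: "nat \<Rightarrow> complex"
  assumes pm: "parameter_matrix D e" and st: "1 \<le> s" "s \<le> t" "t \<le> D"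
    and z: "\<And>i. s \<le> i \<Longrightarrow> i \<le> t \<Longrightarrow>
      (if s < i then e i (i - 1) * z (i - 1) else 0) + z i + (if i < t then e i (i + 1) * z (i + 1) else 0) = 0"
    and i: "s \<le> i" "i \<le> t"
  shows "z i = 0"
proof -
  define n where "n = t + 1 - s"
  define B where "B = principal_block e s t"
  define v where "v = Matrix.vec n (\<lambda>j. z (s + j))"
  have dims: "dim_row B = n" "dim_col B = n" by (simp_all add: B_def principal_block_def n_def)
  have "invertible_mat B" using pm st unfolding parameter_matrix_def B_def by blast
  then obtain C where "inverts_mat B C" "inverts_mat C B"
    unfolding invertible_mat_def by blast
  then have C: "C * B = 1\<^sub>m (dim_row C)" "B * C = 1\<^sub>m (dim_row B)"
    by (simp_all add: inverts_mat_def)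
  have dC: "dim_col C = n" "dim_row C = n"
    using arg_cong[OF C(2), of dim_col] arg_cong[OF C(1), of dim_col] dims by simp_all
  have "B *\<^sub>v v = 0\<^sub>v n"
  proof
    fix j assume "j < dim_vec (0\<^sub>v n :: complex Matrix.vec)"
    then have j: "j < n" by simp
    define r where "r = s + j"
    have r: "s \<le> r" "r \<le> t" using j st by (auto simp: r_def n_def)
    have bij: "(\<Sum>k\<in>{0..<n}. h (s + k)) = (\<Sum>k\<in>{s..t}. h k)" for h :: "nat \<Rightarrow> complex"
      by (rule sum.reindex_bij_witness[of _ "\<lambda>k. k - s" "\<lambda>k. s + k"]) (use st in \<open>auto simp: n_def\<close>)
    have "Matrix.vec_index (B *\<^sub>v v) j = (\<Sum>k\<in>{0..<n}. e r (s + k) * z (s + k))"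
      using j dims by (simp add: scalar_prod_def B_def principal_block_def v_def n_def r_def)
    also have "\<dots> = (\<Sum>k\<in>{s..t}. e r k * z k)"
      by (rule bij[of "\<lambda>k. e r k * z k"])
    also have "\<dots> = (\<Sum>k\<in>{s..t}. (if k = r - 1 then if s < r then e r (r - 1) * z (r - 1) else 0 else 0)
        + (if k = r then z r else 0) + (if k = r + 1 then if r < t then e r (r + 1) * z (r + 1) else 0 else 0))"
    proof (rule sum.cong[OF refl])
      fix k assume k: "k \<in> {s..t}"
      have e1: "e r r = 1" and e0: "r + 1 < k \<or> k + 1 < r \<Longrightarrow> e r k = 0"
        using pm r k st unfolding parameter_matrix_def by auto
      consider "k + 1 = r" | "k = r" | "k = r + 1" | "r + 1 < k \<or> k + 1 < r" by linarith
      then show "e r k * z k = (if k = r - 1 then if s < r then e r (r - 1) * z (r - 1) else 0 else 0)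
        + (if k = r then z r else 0) + (if k = r + 1 then if r < t then e r (r + 1) * z (r + 1) else 0 else 0)"
        by cases (use e1 e0 k r st in auto)
    qed
    also have "\<dots> = (if s < r then e r (r - 1) * z (r - 1) else 0) + z r + (if r < t then e r (r + 1) * z (r + 1) else 0)"
      using r by (simp add: sum.distrib) (auto simp: st)
    also have "\<dots> = 0" using z r by blast
    finally show "Matrix.vec_index (B *\<^sub>v v) j = Matrix.vec_index (0\<^sub>v n) j" using j by simp
  qed (simp add: dims)
  then have "C *\<^sub>v (B *\<^sub>v v) = 0\<^sub>v n" using dC by auto
  moreover have "C *\<^sub>v (B *\<^sub>v v) = (C * B) *\<^sub>v v"
    by (rule assoc_mult_mat_vec[symmetric, of _ n n _ n]) (use dC dims in \<open>auto simp: v_def\<close>)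
  moreover have "(C * B) *\<^sub>v v = v" unfolding C(1) dC by (simp add: v_def)
  ultimately have "v = 0\<^sub>v n" by simp
  then have "Matrix.vec_index v (i - s) = 0" using i st by (simp add: n_def)
  then show ?thesis using i st by (simp add: v_def n_def)
qed

lemma sum_matrix_vector_mult: "(\<Sum>i\<in>I. M i) *v v = (\<Sum>i\<in>I. M i *v v)"
  for M :: "'i \<Rightarrow> complex ^ 'n::finite ^ 'n"
  by (induction I rule: infinite_finite_induct)
    (auto simp: matrix_vector_mult_add_rdistrib)

lemma row_collect:
  fixes u :: "complex ^ 'n::finite"
  assumes "p *s (r1 *\<^sub>R u) + r2 *\<^sub>R u + s *s (r3 *\<^sub>R u) = t *s u" "u \<noteq> 0"
  shows "p * of_real r1 + of_real r2 + s * of_real r3 = t"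
proof -
  have "(p * of_real r1 + of_real r2 + s * of_real r3 - t) *s u = 0"
    using assms(1) by (simp add: smult_complex_of_real[symmetric] vec.scale_left_diff_distrib vec.scale_left_distrib)
  then have "p * of_real r1 + of_real r2 + s * of_real r3 - t = 0"
    using assms(2) by (metis vec.scale_eq_0_iff)
  then show ?thesis by simp
qed

context classical_graph
begin

lemma dual_idempotent_mult: "dual_idempotent E x i *v v = lev i v"
  by (simp add: cvec_eq_iff lev_nth matrix_vector_mult_def dual_idempotent_def if_distrib[of "\<lambda>t. t * _"] cong: if_cong)

lemma adjacency_mult: "adjacency_matrix E *v v = Aop v"
  by (auto simp: cvec_eq_iff relop_nth matrix_vector_mult_def adjacency_matrix_def intro!: sum.cong)

lemma L_lev_0: "Lop (lev 0 v) = 0"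
  by (auto simp: cvec_eq_iff relop_nth lev_nth cong: if_cong intro!: sum.neutral)

lemma lowering_mult: "lowering_matrix E x *v v = Lop v"
proof -
  have "lev (i - 1) (Aop (lev i v)) = Lop (lev i v)" if "i \<in> {1..D}" for i
  proof (cases "i = 1")
    case True
    then show ?thesis unfolding A_split relop_add using lev_R_0 by (simp add: lev_F lev_L)
  next
    case False
    define m where "m = i - 2"
    have "2 \<le> i" using that False by simp
    then have "i = Suc (Suc m)" unfolding m_def by arith
    then show ?thesis by (simp add: lev_Suc_A)
  qed
  then have "lowering_matrix E x *v v = (\<Sum>i=1..D. Lop (lev i v))"
    unfolding lowering_matrix_def sum_matrix_vector_mult diameter
    by (simp add: matrix_vector_mul_assoc[symmetric] dual_idempotent_mult adjacency_mult)
  also have "\<dots> = (\<Sum>i\<le>D. Lop (lev i v))"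
    by (rule sum.mono_neutral_left) (auto simp: L_lev_0 not_le)
  also have "\<dots> = Lop v" by (simp only: relop_sum[symmetric] lev_sum)
  finally show ?thesis .
qed

lemma raising_mult: "raising_matrix E x *v v = Rop v"
proof -
  have "lev (i + 1) (Aop (lev i v)) = Rop (lev i v)" for i
    by (simp add: lev_Suc_A)
  then have "raising_matrix E x *v v = (\<Sum>i<D. Rop (lev i v))"
    unfolding raising_matrix_def sum_matrix_vector_mult diameter
    by (simp add: matrix_vector_mul_assoc[symmetric] dual_idempotent_mult adjacency_mult)
  also have "\<dots> = (\<Sum>i\<le>D. Rop (lev i v))"
  proof -
    have "Rop (lev D v) = lev (Suc D) (Rop v)" by (simp add: lev_R)
    then have "Rop (lev D v) = 0" by (simp add: lev_gt)
    then show ?thesis by (simp add: lessThan_Suc_atMost[symmetric])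
  qed
  also have "\<dots> = Rop v" by (simp only: relop_sum[symmetric] lev_sum)
  finally show ?thesis .
qed

text \<open>\<open>xs g i\<close> and \<open>x0 i\<close> are the eigenvalues of \<open>Rop \<circ> Lop\<close> at level \<open>i\<close> of a chain and of the primary module.\<close>

definition xs :: "(nat \<Rightarrow> real) \<Rightarrow> nat \<Rightarrow> real" where
  "xs g i = (if i \<le> 1 then 0 else c (i - 1) * ell g i)"

definition x0 :: "nat \<Rightarrow> real" where "x0 i = b (i - 1) * c i"

definition sph :: "nat \<Rightarrow> complex ^ 'a" where "sph i = (\<chi> y. if d x y = i then 1 else 0)"

lemma sph_L: "Lop (sph (Suc i)) = b i *\<^sub>R sph i"
proof -
  have "(\<Sum>z\<in>UNIV. if E y z \<and> d x z = Suc (d x y) then if d x z = Suc i then 1 else 0 else 0)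
      = (if d x y = i then complex_of_real (b i) else 0)" for y
  proof -
    have "(\<Sum>z\<in>UNIV. if E y z \<and> d x z = Suc (d x y) then if d x z = Suc i then 1 else 0 else (0::complex))
      = (if d x y = i then of_nat (card {w. E y w \<and> d w x = Suc (d y x)}) else 0)"
      by (auto simp: d_commute sum.If_cases intro!: sum.neutral)
    moreover have "(of_nat (card {w. E y w \<and> d w x = Suc (d y x)}) :: complex) = complex_of_real (b (d x y))"
      unfolding d_commute[of x y] card_b[symmetric] by simp
    ultimately show ?thesis by simp
  qed
  then show ?thesis by (auto simp: cvec_eq_iff relop_nth sph_def of_real_def cong: if_cong)
qed

lemma sph_R: "Rop (sph i) = c (Suc i) *\<^sub>R sph (Suc i)"
proof -
  have "(\<Sum>z\<in>UNIV. if E y z \<and> d x y = Suc (d x z) then if d x z = i then 1 else 0 else 0)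
      = (if d x y = Suc i then complex_of_real (c (Suc i)) else 0)" for y
  proof -
    have "(\<Sum>z\<in>UNIV. if E y z \<and> d x y = Suc (d x z) then if d x z = i then 1 else 0 else (0::complex))
      = (\<Sum>z\<in>UNIV. if d x y = Suc i \<and> E y z \<and> Suc (d z x) = d y x then 1 else 0)"
      by (intro sum.cong) (auto simp: d_commute)
    also have "\<dots> = (if d x y = Suc i then of_nat (card {w. E y w \<and> Suc (d w x) = d y x}) else 0)"
      by (auto simp: sum.If_cases)
    also have "(of_nat (card {w. E y w \<and> Suc (d w x) = d y x}) :: complex) = complex_of_real (c (d x y))"
      unfolding d_commute[of x y] card_c[symmetric] by simp
    finally show ?thesis by simp
  qed
  then show ?thesis by (auto simp: cvec_eq_iff relop_nth sph_def of_real_def cong: if_cong)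
qed

lemma sphere_nonempty:
  assumes "i \<le> D"
  shows "\<exists>y. d x y = i"
  using assms
proof (induction i)
  case 0
  show ?case by (rule exI[of _ x]) simp
next
  case (Suc i)
  then obtain y where y: "d x y = i" by auto
  then have "real (card {w. E y w \<and> d w x = Suc (d y x)}) > 0"
    unfolding card_b using b_pos[of i] Suc.prems d_commute[of y x] by simp
  then obtain w where "d w x = Suc (d y x)" by (auto simp: card_gt_0_iff)
  then have "d x w = Suc i" using y d_commute[of w x] d_commute[of y x] by simp
  then show ?case ..
qed

lemma sph_lev [simp]: "lev j (sph i) = (if i = j then sph i else 0)"
  by (auto simp: cvec_eq_iff lev_nth sph_def)

end

section \<open>Comparison of chains row by row\<close>

locale uniform_graph = classical_graph +
  fixes e :: "nat \<Rightarrow> nat \<Rightarrow> complex" and f :: "nat \<Rightarrow> complex"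
  assumes pm: "parameter_matrix D e"
    and row: "\<And>i v. 1 \<le> i \<Longrightarrow> i \<le> D \<Longrightarrow> lev i v = v \<Longrightarrow>
      e_minus e i *s Rop (Lop (Lop v)) + Lop (Rop (Lop v)) + e_plus D e i *s Lop (Lop (Rop v)) = f i *s Lop v"
begin

text \<open>On \<open>wp i w\<close> all terms of row \<open>i\<close> are multiples of
  \<open>ell g i *\<^sub>R wp (i - 1) w\<close>; the last two hypotheses allow cancelling this
  vector.\<close>

lemma chain_row:
  assumes "chain w g" "2 \<le> i" "i \<le> D" "wp (i - 1) w \<noteq> 0" "ell g i \<noteq> 0"
  shows "e_minus e i * xs g (i - 1) + xs g i + e_plus D e i * xs g (i + 1) = f i"
proof -
  have lw: "local_vec w" using assms(1) by (simp add: chain_def)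
  have L: "Lop (wp j w) = ell g j *\<^sub>R wp (j - 1) w" if "2 \<le> j" "j \<le> D" for j using chain_L[OF assms(1) that] .
  have R: "Rop (wp j w) = c j *\<^sub>R wp (Suc j) w" if "1 \<le> j" for j using R_wp[OF lw, of "j - 1"] that by simp
  have RL: "Rop (Lop (wp j w)) = xs g j *\<^sub>R wp j w" if "1 \<le> j" "j \<le> D" for j
  proof (cases "j = 1")
    case True
    then show ?thesis using wp_1[OF lw] L_local[OF lw] by (simp add: xs_def)
  next
    case False
    then show ?thesis using that L[of j] R[of "j - 1"] by (simp add: xs_def mult.commute)
  qed
  have LLR: "e_plus D e i *s Lop (Lop (Rop (wp i w))) = e_plus D e i *s (xs g (i + 1) *\<^sub>R (ell g i *\<^sub>R wp (i - 1) w))"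
  proof (cases "i = D")
    case False
    then have "Lop (Lop (Rop (wp i w))) = xs g (i + 1) *\<^sub>R (ell g i *\<^sub>R wp (i - 1) w)"
      using assms(2,3) R[of i] L[of i] L[of "Suc i"] by (simp add: xs_def)
    then show ?thesis by simp
  qed (simp add: e_plus_def)
  have 1: "Rop (Lop (Lop (wp i w))) = xs g (i - 1) *\<^sub>R (ell g i *\<^sub>R wp (i - 1) w)"
    using L[of i] RL[of "i - 1"] assms(2,3) by (simp add: mult.commute)
  have 2: "Lop (Rop (Lop (wp i w))) = xs g i *\<^sub>R (ell g i *\<^sub>R wp (i - 1) w)"
    using RL[of i] L[of i] assms(2,3) by simp
  have r: "e_minus e i *s Rop (Lop (Lop (wp i w))) + Lop (Rop (Lop (wp i w))) + e_plus D e i *s Lop (Lop (Rop (wp i w)))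
      = f i *s Lop (wp i w)"
    using row[of i "wp i w"] assms(2,3) by simp
  show ?thesis
    by (rule row_collect[OF r[unfolded 1 2 LLR, unfolded L[OF assms(2,3)]]]) (use assms(4,5) in simp)
qed

lemma primary_row:
  assumes "1 \<le> i" "i \<le> D"
  shows "e_minus e i * x0 (i - 1) + x0 i + e_plus D e i * x0 (i + 1) = f i"
proof -
  obtain m where m: "i = Suc m" using assms by (cases i) auto
  have 1: "e_minus e i *s Rop (Lop (Lop (sph i))) = e_minus e i *s (x0 m *\<^sub>R (b m *\<^sub>R sph m))"
  proof (cases m)
    case 0
    then show ?thesis using m by (simp add: e_minus_def)
  next
    case (Suc n)
    then show ?thesis
      by (simp add: m sph_L sph_R x0_def mult_ac)
  qed
  have 2: "Lop (Rop (Lop (sph i))) = x0 i *\<^sub>R (b m *\<^sub>R sph m)" 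
    by (simp add: m sph_L sph_R x0_def mult_ac)
  have 3: "Lop (Lop (Rop (sph i))) = x0 (i + 1) *\<^sub>R (b m *\<^sub>R sph m)"
    by (simp add: m sph_L sph_R x0_def mult_ac)
  have nz: "b m *\<^sub>R sph m \<noteq> 0"
  proof -
    obtain y where "d x y = m" using sphere_nonempty[of m] assms m by auto
    then have "sph m $ y = 1" by (simp add: sph_def)
    then have "sph m \<noteq> 0" by auto
    then show ?thesis using b_pos[of m] assms m by simp
  qed
  have r: "e_minus e i *s Rop (Lop (Lop (sph i))) + Lop (Rop (Lop (sph i))) + e_plus D e i *s Lop (Lop (Rop (sph i)))
      = f i *s Lop (sph i)"
    using row[of i "sph i"] assms by simp
  have "Lop (sph i) = b m *\<^sub>R sph m" using sph_L[of m] m by simp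
  from row_collect[OF r[unfolded 1 2 3, unfolded this] nz] show ?thesis by (simp add: m)
qed

text \<open>The difference of two solutions satisfies the homogeneous rows 2 to \<open>m\<close>.
  Nothing enters from outside: \<open>xs\<close> is 0 at level 1, and at the top either
  \<open>e_plus\<close> is 0 or the values at \<open>m + 1\<close> coincide.\<close>

lemma chains_agree:
  assumes "chain w g" "chain w' g'" "m \<le> D"
    and nz: "\<And>i. 2 \<le> i \<Longrightarrow> i \<le> m \<Longrightarrow> wp (i - 1) w \<noteq> 0 \<and> ell g i \<noteq> 0 \<and> wp (i - 1) w' \<noteq> 0 \<and> ell g' i \<noteq> 0"
    and end_eq: "m = D \<or> xs g (m + 1) = xs g' (m + 1)"
    and "2 \<le> i" "i \<le> m"
  shows "xs g i = xs g' i"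
proof -
  define z where "z i = complex_of_real (xs g i) - complex_of_real (xs g' i)" for i
  have r: "e_minus e i * z (i - 1) + z i + e_plus D e i * z (i + 1) = 0" if "2 \<le> i" "i \<le> m" for i
    using chain_row[OF assms(1), of i] chain_row[OF assms(2), of i] nz[OF that] that assms(3)
    by (simp add: z_def algebra_simps)
  have "z i = 0"
  proof (rule parameter_matrix_kernel[OF pm, of 2 m])
    fix j assume j: "2 \<le> j" "j \<le> m"
    have "z 1 = 0" by (simp add: z_def xs_def)
    then have 1: "(if 2 < j then e j (j - 1) * z (j - 1) else 0) = e_minus e j * z (j - 1)"
      using j by (auto simp: e_minus_def)
    have 2: "(if j < m then e j (j + 1) * z (j + 1) else 0) = e_plus D e j * z (j + 1)"
      using j end_eq assms(3) by (auto simp: e_plus_def z_def)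
    show "(if 2 < j then e j (j - 1) * z (j - 1) else 0) + z j + (if j < m then e j (j + 1) * z (j + 1) else 0) = 0"
      unfolding 1 2 using r[OF j] .
  qed (use assms in auto)
  then show ?thesis by (simp add: z_def)
qed

lemma xs_D_tight:
  "chain w g \<Longrightarrow> g 1 = q \<Longrightarrow> xs g D = 0" "chain w g \<Longrightarrow> g 1 = \<alpha> - \<beta> \<Longrightarrow> xs g D = 0"
  using chain_q(1)[of w g D] chain_tight(1)[of w g D] D_ge by (simp_all add: xs_def ltight_def)

text \<open>Both chains stop at level \<open>D - 1\<close>, so row \<open>D\<close> gives nothing
  for them. Rows 2 to \<open>D - 1\<close> suffice, with the common value 0 at level
  \<open>D\<close>.\<close>

lemma tight_chains_exclusive:
  assumes "chain w g" "g 1 = q" "chain w' g'" "g' 1 = \<alpha> - \<beta>"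
  shows "\<alpha> = 0"
proof -
  have "xs g 2 = xs g' 2"
  proof (rule chains_agree[OF assms(1,3), of "D - 1"])
    show "D - 1 = D \<or> xs g (D - 1 + 1) = xs g' (D - 1 + 1)"
      using xs_D_tight(1)[OF assms(1,2)] xs_D_tight(2)[OF assms(3,4)] D_pos by simp
  next
    fix i assume i: "2 \<le> i" "i \<le> D - 1"
    then have "i \<le> D" "i < D" by auto
    then show "wp (i - 1) w \<noteq> 0 \<and> ell g i \<noteq> 0 \<and> wp (i - 1) w' \<noteq> 0 \<and> ell g' i \<noteq> 0"
      using chain_q[OF assms(1,2) i(1)] chain_tight[OF assms(3,4) i(1)] b_pos[of i] ltight_nonzero[of i] i by simp
  qed (use D_ge in auto)
  then have "b 2 = ltight 2"
    using chain_q(1)[OF assms(1,2), of 2] chain_tight(1)[OF assms(3,4), of 2] D_ge by (simp add: xs_def)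
  then have "(br D - br 2) * (\<beta> - \<alpha> * (1 + q)) = (br D - br 2) * ((1 + \<alpha>) * (\<beta> - \<alpha>))"
    by (simp add: b_def ltight_def qbracket_Suc numeral_2_eq_2 mult.assoc)
  moreover have "br D - br 2 \<noteq> 0" using br_diff_pos[of 2] D_ge by simp
  ultimately have "\<beta> - \<alpha> * (1 + q) = (1 + \<alpha>) * (\<beta> - \<alpha>)" by (simp only: mult_cancel_left) simp
  then have "\<alpha> * (\<beta> - \<alpha> + q) = 0" by (simp add: algebra_simps)
  moreover have "\<beta> - \<alpha> + q > 0" using beta_alpha_pos[of 1] q_pos D_ge by simp
  ultimately show ?thesis by simp
qed

text \<open>The last hypothesis keeps \<open>lfull D\<close> nonzero, so all rows from 2 to
  \<open>D\<close> are available. Equality at level 2 leaves, besides \<alpha> = 0, only \<beta> =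
  \<alpha> (1 + q) + q, and then level 3 forces \<alpha> = 0.\<close>

lemma full_chains_exclusive:
  assumes "chain w g" "g 1 = 0" "chain w' g'" "g' 1 = - \<alpha> * (br D - 1)" "\<beta> \<noteq> \<alpha> * br D"
  shows "\<alpha> = 0"
proof -
  have lD: "lfull i \<noteq> 0" if "2 \<le> i" "i \<le> D" for i
  proof (cases "i = D")
    case True
    have "D - 1 < D" "D - 2 < D" using D_pos by auto
    then show ?thesis
      using True br_diff_pos[of "D - 1"] one_alpha_pos[of "D - 1"] one_alpha_pos[of "D - 2"] assms(5)
      by (auto simp: lfull_def)
  qed (use lfull_nonzero that in auto)
  have ag: "xs g i = xs g' i" if "2 \<le> i" "i \<le> D" for i
  proof (rule chains_agree[OF assms(1,3) order_refl _ _ that])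
    fix i assume i: "2 \<le> i" "i \<le> D"
    then have "i - 1 < D" by auto
    then show "wp (i - 1) w \<noteq> 0 \<and> ell g i \<noteq> 0 \<and> wp (i - 1) w' \<noteq> 0 \<and> ell g' i \<noteq> 0"
      using chain_minus_one[OF assms(1,2) i] chain_full[OF assms(3,4) i] b_pos[of "i - 1"] lD[OF i] by simp
  qed simp
  have "b 1 = lfull 2" "b 2 = lfull 3"
    using ag[of 2] ag[of 3] c_pos[of 2] D_ge chain_minus_one(1)[OF assms(1,2), of 2] chain_minus_one(1)[OF assms(1,2), of 3]
      chain_full(1)[OF assms(3,4), of 2] chain_full(1)[OF assms(3,4), of 3] by (simp_all add: xs_def)
  then have e: "(br D - 1) * (\<beta> - \<alpha>) = (br D - 1) * ((1 + \<alpha>) * (\<beta> - \<alpha> * (1 + q)))"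
    "(br D - (1 + q)) * (\<beta> - \<alpha> * (1 + q))
      = (br D - (1 + q)) * ((1 + \<alpha> * (1 + q)) * (\<beta> - \<alpha> * (1 + q * (1 + q))) / (1 + \<alpha>))"
    by (simp_all add: b_def lfull_def qbracket_Suc numeral_eq_Suc mult.assoc)
  have nz: "br D - 1 \<noteq> 0" "br D - (1 + q) \<noteq> 0" "1 + \<alpha> \<noteq> 0"
    using br_diff_pos[of 1] br_diff_pos[of 2] one_alpha_pos[of 1] D_ge by (simp_all add: qbracket_Suc numeral_2_eq_2)
  have 1: "\<beta> - \<alpha> = (1 + \<alpha>) * (\<beta> - \<alpha> * (1 + q))"
    using e(1) nz(1) by (simp only: mult_cancel_left) simp
  have "\<beta> - \<alpha> * (1 + q) = (1 + \<alpha> * (1 + q)) * (\<beta> - \<alpha> * (1 + q * (1 + q))) / (1 + \<alpha>)"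
    using e(2) nz(2) by (simp only: mult_cancel_left) simp
  then have 2: "(1 + \<alpha>) * (\<beta> - \<alpha> * (1 + q)) = (1 + \<alpha> * (1 + q)) * (\<beta> - \<alpha> * (1 + q * (1 + q)))"
    using nz(3) by (simp only: eq_divide_eq) (simp add: mult.commute)
  from 1 have "\<alpha> * (\<beta> - (\<alpha> * (1 + q) + q)) = 0" by (simp add: algebra_simps)
  then consider "\<alpha> = 0" | "\<beta> = \<alpha> * (1 + q) + q" by auto
  then show ?thesis
  proof cases
    case 2
    then have "\<alpha> * \<alpha> * (q * (q * (1 + q))) = 0"
      using \<open>(1 + \<alpha>) * (\<beta> - \<alpha> * (1 + q)) = (1 + \<alpha> * (1 + q)) * (\<beta> - \<alpha> * (1 + q * (1 + q)))\<close>
      by (simp add: algebra_simps)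
    then show ?thesis using q_pos by simp
  qed
qed

end

text \<open>Here \<open>m\<close>, \<open>n\<close>, \<open>N\<close> are \<open>br (D - 2)\<close>,
  \<open>br (D - 1)\<close>, \<open>br D\<close>, and \<open>p\<close> is
  \<open>q ^ (D - 2)\<close>. Up to a positive factor this is
  \<open>xf D * x0 2 < xf 2 * x0 D\<close>, which makes the eigenvalue \<xi> below negative. The
  difference of the two sides is \<open>m\<close> times an expression that \<alpha> (1 + q) \<ge> 1
  keeps positive.\<close>

lemma ratio_inequality:
  fixes q \<alpha> m n p N :: real
  assumes q: "q \<ge> 2" and m: "m \<ge> 1 + q" and n: "n = 1 + q * m" and p: "(q - 1) * m = p - 1" and N: "N = 1 + q * n"
    and al: "\<alpha> * (1 + q) \<ge> 1"
  shows "n * (\<alpha> * q * p - 1) * (\<alpha> * N - 1) * (1 + q) < (\<alpha> * q * n - 1) * (\<alpha> * p * (1 + q) - 1) * N"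
proof -
  have "p = (q - 1) * m + 1" using p by simp
  then have "(\<alpha> * q * n - 1) * (\<alpha> * p * (1 + q) - 1) * N - n * (\<alpha> * q * p - 1) * (\<alpha> * N - 1) * (1 + q)
      = m * (\<alpha> * n + \<alpha> * (1 + q) * (q * p) - q)"
    unfolding N n by Groebner_Basis.algebra
  moreover have "\<alpha> > 0" using al q by (smt (verit) mult_nonpos_nonneg)
  have "p \<ge> 1" using p q m by (smt (verit) mult_nonneg_nonneg)
  have "\<alpha> * n > 0" using \<open>\<alpha> > 0\<close> n m q by (simp add: add_pos_pos)
  have "\<alpha> * (1 + q) * (q * p) \<ge> 1 * (q * 1)"
    using al q \<open>p \<ge> 1\<close> by (intro mult_mono) auto
  then have "\<alpha> * n + \<alpha> * (1 + q) * (q * p) - q > 0"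
    using \<open>\<alpha> * n > 0\<close> by linarith
  then have "m * (\<alpha> * n + \<alpha> * (1 + q) * (q * p) - q) > 0"
    using m q by (intro mult_pos_pos) auto
  ultimately show ?thesis by linarith
qed

text \<open>Multiplied by \<open>n * (1 + \<alpha>)\<close> this becomes
  \<open>c 2 * c (D - 1) \<le> xf 2\<close>.\<close>

lemma size_inequality:
  fixes q \<alpha> m n :: real
  assumes q: "q \<ge> 2" and m: "m \<ge> 1 + q" and n: "n = 1 + q * m" and al: "\<alpha> * (1 + q) \<ge> 1"
  shows "(1 + q) * (1 + \<alpha> * m) \<le> q^2 * (\<alpha> * q * n - 1)"
proof -
  have a: "\<alpha> > 0" using al q by (smt (verit) mult_nonpos_nonneg)
  have "\<alpha> * m \<ge> \<alpha> * (1 + q)" using a m by (intro mult_left_mono) auto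
  then have am: "\<alpha> * m \<ge> 1" using al by linarith
  have q2: "q^2 \<ge> 2 * q" using q by (simp add: power2_eq_square)
  have "(1 + q) * (1 + \<alpha> * m) \<le> (1 + q) * (2 * (\<alpha> * m))" using am q by (intro mult_left_mono) auto
  also have "\<dots> \<le> (q^2 * (q - 1) * (1 + q)) * (\<alpha> * m)"
  proof -
    have "2 * 1 \<le> q^2 * (q - 1)" using q2 q by (intro mult_mono) auto
    then have "(2 * (1 + q)) * (\<alpha> * m) \<le> (q^2 * (q - 1) * (1 + q)) * (\<alpha> * m)"
      using am q by (intro mult_right_mono) auto
    then show ?thesis by (simp add: algebra_simps)
  qed
  also have "\<dots> = q^2 * (q^2 * (\<alpha> * m) - \<alpha> * m)" by (simp add: algebra_simps power2_eq_square)
  also have "\<dots> \<le> q^2 * (\<alpha> * q * n - 1)"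
  proof -
    have "\<alpha> * q * n = \<alpha> * q + q^2 * (\<alpha> * m)" unfolding n by (simp add: algebra_simps power2_eq_square)
    moreover have "\<alpha> * q > 0" using a q by simp
    ultimately show ?thesis using am by (intro mult_left_mono) auto
  qed
  finally show ?thesis .
qed

context classical_graph
begin

lemma full_chain_bounds:
  assumes "\<beta> = \<alpha> * (1 + q * br D) - q" "\<alpha> * (1 + q) \<ge> 1"
  defines "xf i \<equiv> if i \<le> 1 then 0 else c (i - 1) * lfull i"
  shows "c 2 * c (D - 1) \<le> xf 2" "xf 2 < x0 2" "0 < xf D" "xf D * x0 2 < xf 2 * x0 D"
proof -
  define m where "m = br (D - 2)"
  define n where "n = br (D - 1)"
  define p where "p = q ^ (D - 2)"
  define N where "N = br D"
  have D: "D = Suc (Suc (D - 2))" "D - 1 = Suc (D - 2)" "D - 2 = Suc (Suc (D - 4))" using D_ge by auto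
  have n: "n = 1 + q * m" and N: "N = 1 + q * n"
    using qbracket_Suc[of q "D - 2"] qbracket_Suc[of q "D - 1"] D by (simp_all add: m_def n_def N_def)
  have m: "m \<ge> 1 + q"
  proof -
    have "m = 1 + q * (1 + q * br (D - 4))" unfolding m_def by (subst D(3)) (simp add: qbracket_Suc)
    moreover have "q * (q * br (D - 4)) \<ge> 0" using br_nonneg q_pos by simp
    ultimately show ?thesis by (simp add: algebra_simps)
  qed
  have p: "(q - 1) * m = p - 1" unfolding m_def p_def by (rule q_br)
  note al = assms(2)
  have a: "\<alpha> > 0" using al q_ge by (smt (verit) mult_nonpos_nonneg)
  have beta: "\<beta> = \<alpha> * (1 + q * N) - q" using assms(1) by (simp add: N_def)
  have "\<alpha> * m \<ge> \<alpha> * (1 + q)" using a m by (intro mult_left_mono) auto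
  then have am: "\<alpha> * m \<ge> 1" using al by linarith
  have mpos: "m > 0" "n > 0" "p > 0" using m q_ge n by (auto simp: p_def add_pos_pos)
  have aqn: "\<alpha> * q * n - 1 > 0"
  proof -
    have "\<alpha> * q * n - 1 = \<alpha> * q + q * q * (\<alpha> * m) - 1" unfolding n by (simp add: algebra_simps)
    moreover have "q * q * (\<alpha> * m) \<ge> 1 * 1 * 1" using q_ge am by (intro mult_mono) auto
    moreover have "\<alpha> * q > 0" using a q_pos by simp
    ultimately show ?thesis by linarith
  qed
  have aqp: "\<alpha> * q * p - 1 > 0"
  proof -
    have p': "p = (q - 1) * m + 1" using p by simp
    have "\<alpha> * q * p = q * ((q - 1) * (\<alpha> * m)) + \<alpha> * q" unfolding p' by (simp add: algebra_simps)
    moreover have "q * ((q - 1) * (\<alpha> * m)) \<ge> 1 * (1 * 1)" using q_ge am by (intro mult_mono) auto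
    moreover have "\<alpha> * q > 0" using a q_pos by simp
    ultimately show ?thesis by linarith
  qed
  have b2: "\<beta> - \<alpha> * (1 + q) = q * (\<alpha> * q * n - 1)" and b1: "\<beta> - \<alpha> = q * (\<alpha> * N - 1)"
    unfolding beta N by (simp_all add: algebra_simps)
  have qN: "(q - 1) * N = q * q * p - 1"
  proof -
    have "(q - 1) * N = q * q * ((q - 1) * m) + (q - 1) * (1 + q)" unfolding N n by (simp add: algebra_simps)
    then show ?thesis unfolding p by (simp add: algebra_simps)
  qed
  have bD: "\<beta> - \<alpha> * N = q * (\<alpha> * q * p - 1)"
  proof -
    have "\<beta> - \<alpha> * N = \<alpha> * (1 + (q - 1) * N) - q" unfolding beta by (simp add: algebra_simps)
    then show ?thesis unfolding qN by (simp add: algebra_simps)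
  qed
  have qn: "(q - 1) * n = q * p - 1"
  proof -
    have "(q - 1) * n = q * ((q - 1) * m) + q - 1" unfolding n by (simp add: algebra_simps)
    then show ?thesis unfolding p by (simp add: algebra_simps)
  qed
  have Nn: "N - n = q * p" using qn unfolding N by (simp add: algebra_simps)
  have bD1: "\<beta> - \<alpha> * n = q * (\<alpha> * p * (1 + q) - 1)"
  proof -
    have "\<beta> - \<alpha> * n = (\<beta> - \<alpha> * N) + \<alpha> * (N - n)" by (simp add: algebra_simps)
    then show ?thesis unfolding bD Nn by (simp add: algebra_simps)
  qed
  have c2: "c 2 = (1 + q) * (1 + \<alpha>)" and bb1: "b 1 = q * n * (\<beta> - \<alpha>)"
    using N by (simp_all add: c_def b_def qbracket_Suc numeral_2_eq_2 N_def[symmetric])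
  have cD1: "c (D - 1) = n * (1 + \<alpha> * m)" and cD: "c D = N * (1 + \<alpha> * n)" and bbD: "b (D - 1) = q * p * (\<beta> - \<alpha> * n)"
    using Nn by (simp_all add: c_def b_def n_def m_def N_def numeral_2_eq_2)
  have u: "1 + \<alpha> * m > 0" "1 + \<alpha> * n > 0" "1 + \<alpha> > 0" using a mpos by (auto simp: add_pos_pos)
  have xf2: "xf 2 = (q * n * (1 + \<alpha>)) * (q * (\<alpha> * q * n - 1))"
    unfolding b2[symmetric] using N by (simp add: xf_def lfull_def qbracket_Suc numeral_2_eq_2 N_def[symmetric])
  have x02: "x0 2 = (q * n * (1 + \<alpha>)) * (q * ((\<alpha> * N - 1) * (1 + q)))"
  proof -
    have "x0 2 = b 1 * c 2" by (simp add: x0_def)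
    then show ?thesis unfolding bb1 b1 c2 by (simp only: mult_ac)
  qed
  have "lfull D = q * p * (1 + \<alpha> * n) * (q * (\<alpha> * q * p - 1)) / (1 + \<alpha> * m)"
    unfolding lfull_def N_def[symmetric] n_def[symmetric] m_def[symmetric] Nn bD ..
  then have xfD: "xf D = (q * p * (1 + \<alpha> * n)) * (q * (n * (\<alpha> * q * p - 1)))"
    using u(1) D_ge cD1 by (simp add: xf_def)
  have x0D: "x0 D = (q * p * (1 + \<alpha> * n)) * (q * ((\<alpha> * p * (1 + q) - 1) * N))"
    unfolding x0_def bbD cD bD1 by (simp add: algebra_simps)
  have pos: "q * n * (1 + \<alpha>) > 0" "q * p * (1 + \<alpha> * n) > 0" using q_pos mpos u by simp_all
  show "0 < xf D" unfolding xfD using pos q_pos mpos aqp by simp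
  show "xf 2 < x0 2"
  proof -
    have "(\<alpha> * N - 1) * (1 + q) - (\<alpha> * q * n - 1) = \<alpha> * (1 + q) + q * (\<alpha> * q * n - 1)"
      unfolding N by (simp add: algebra_simps)
    moreover have "q * (\<alpha> * q * n - 1) > 0" using q_pos aqn by simp
    ultimately have "\<alpha> * q * n - 1 < (\<alpha> * N - 1) * (1 + q)" using al by linarith
    then show ?thesis unfolding xf2 x02 using pos(1) q_pos by (intro mult_strict_left_mono) auto
  qed
  show "c 2 * c (D - 1) \<le> xf 2"
  proof -
    have "c 2 * c (D - 1) = (n * (1 + \<alpha>)) * ((1 + q) * (1 + \<alpha> * m))" unfolding c2 cD1 by (simp add: algebra_simps)
    also have "\<dots> \<le> (n * (1 + \<alpha>)) * (q^2 * (\<alpha> * q * n - 1))"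
      using size_inequality[OF q_ge m n al] mpos u by (intro mult_left_mono) auto
    also have "\<dots> = xf 2" unfolding xf2 by (simp add: power2_eq_square)
    finally show ?thesis .
  qed
  show "xf D * x0 2 < xf 2 * x0 D"
  proof -
    have "xf D * x0 2 = ((q * n * (1 + \<alpha>)) * (q * p * (1 + \<alpha> * n)) * (q * q)) * (n * (\<alpha> * q * p - 1) * (\<alpha> * N - 1) * (1 + q))"
      unfolding xfD x02 by (simp only: mult_ac)
    moreover have "xf 2 * x0 D = ((q * n * (1 + \<alpha>)) * (q * p * (1 + \<alpha> * n)) * (q * q)) * ((\<alpha> * q * n - 1) * (\<alpha> * p * (1 + q) - 1) * N)"
      unfolding xf2 x0D by (simp only: mult_ac)
    moreover have "(q * n * (1 + \<alpha>)) * (q * p * (1 + \<alpha> * n)) * (q * q) > 0" using mpos u q_pos by (intro mult_pos_pos) auto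
    ultimately show ?thesis using ratio_inequality[OF q_ge m n p N al] by (simp only: mult_less_cancel_left_pos)
  qed
qed

section \<open>Norms at the last sphere\<close>

text \<open>For \<open>d x y = D\<close> these are the vertices at distance \<open>j\<close> from
  \<open>y\<close> on the geodesics from \<open>x\<close> to \<open>y\<close>.\<close>

definition ball_vec :: "'a \<Rightarrow> nat \<Rightarrow> complex ^ 'a" where
  "ball_vec y j = (\<chi> z. if d x z + j = D \<and> d z y = j then 1 else 0)"

lemma ball_vec_nth: "ball_vec y j $ z = (if d x z + j = D \<and> d z y = j then 1 else 0)"
  by (simp add: ball_vec_def)

lemma d_triangle: "d u w \<le> d u z + d z w"
proof (induction "d z w" arbitrary: w)
  case 0
  then show ?case using d_eq_0[of z w] by simp
next
  case (Suc n)
  then obtain v where v: "E v w" "d z v = n" using path_dist_pred[OF graph, of z w n] by auto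
  then have "d u v \<le> d u z + n" using Suc.hyps(1)[of v] by simp
  then show ?case using d_step(1)[OF v(1), of u] Suc.hyps(2) by simp
qed

text \<open>A neighbour, closer to \<open>y\<close>, of a vertex on a geodesic lies on a geodesic
  again; \<open>c (Suc j)\<close> counts these neighbours.\<close>

lemma L_ball_vec:
  assumes "d x y = D"
  shows "Lop (ball_vec y j) = c (Suc j) *\<^sub>R ball_vec y (Suc j)"
proof -
  have "Lop (ball_vec y j) $ z = (c (Suc j) *\<^sub>R ball_vec y (Suc j)) $ z" for z
  proof (cases "d x z + Suc j = D \<and> d z y = Suc j")
    case True
    have "E z u \<and> d x u = Suc (d x z) \<and> d x u + j = D \<and> d u y = j \<longleftrightarrow> E z u \<and> Suc (d u y) = d z y" for u
    proof -
      have "d x u = Suc (d x z)" if "E z u" "d u y = j"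
        using d_triangle[of x y u] assms that True d_step(1)[OF that(1), of x] by linarith
      then show ?thesis using True by auto
    qed
    then have "(if E z u \<and> d x u = Suc (d x z) then ball_vec y j $ u else 0) = (if E z u \<and> Suc (d u y) = d z y then 1 else 0)" for u
      unfolding ball_vec_nth by (smt (verit))
    then have "Lop (ball_vec y j) $ z = of_nat (card {u. E z u \<and> Suc (d u y) = d z y})"
      unfolding relop_nth by (simp add: sum.If_cases)
    also have "\<dots> = complex_of_real (c (d z y))"
      unfolding card_c[symmetric] by simp
    finally show ?thesis using True by (simp add: ball_vec_nth of_real_def)
  next
    case False
    have "(if E z u \<and> d x u = Suc (d x z) then ball_vec y j $ u else 0) = 0" for u
    proof -
      have "\<not> (E z u \<and> d x u = Suc (d x z) \<and> d x u + j = D \<and> d u y = j)"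
      proof
        assume u: "E z u \<and> d x u = Suc (d x z) \<and> d x u + j = D \<and> d u y = j"
        then have "d x z + Suc j = D" by simp
        moreover have "d z y \<le> Suc j" using u d_step'(2)[of z u y] by auto
        moreover have "D \<le> d x z + d z y" using d_triangle[of x y z] assms by simp
        ultimately show False using False by linarith
      qed
      then show ?thesis by (auto simp: ball_vec_nth)
    qed
    then have "Lop (ball_vec y j) $ z = 0" unfolding relop_nth by simp
    moreover have "ball_vec y (Suc j) $ z = 0" using False by (auto simp: ball_vec_nth)
    ultimately show ?thesis by simp
  qed
  then show ?thesis unfolding cvec_eq_iff by blast
qed

lemma ball_vec_0: "d x y = D \<Longrightarrow> ball_vec y 0 = axis y 1"
  by (auto simp: cvec_eq_iff ball_vec_nth axis_def d_eq_0)

lemma ball_vec_D: "d x y = D \<Longrightarrow> ball_vec y D = sph 0"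
  by (auto simp: cvec_eq_iff ball_vec_nth sph_def d_eq_0)

lemma L_pow_ball_vec:
  assumes "d x y = D"
  shows "(Lop ^^ j) (axis y 1) = (\<Prod>i=1..j. c i) *\<^sub>R ball_vec y j"
  by (induction j) (use assms ball_vec_0 in \<open>auto simp: L_ball_vec mult.commute\<close>)

text \<open>The two vectors live on levels 1 and 2. All \<open>c 2\<close> neighbours on level 1 of
  a geodesic vertex on level 2 lie on geodesics, so the raised vector is constantly
  \<open>c 2\<close> there.\<close>

lemma R_ball_vec_inner:
  assumes "d x y = D" "Suc j = D"
  shows "Rop (ball_vec y j) \<bullet> ball_vec y (j - 1) = c 2 * (ball_vec y (j - 1) \<bullet> ball_vec y (j - 1))"
proof -
  have "Rop (ball_vec y j) $ z = of_real (c 2)" if z: "d x z + (j - 1) = D" "d z y = j - 1" for z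
  proof -
    have xz: "d x z = 2" using z assms D_ge by simp
    have "(if E z u \<and> d x z = Suc (d x u) then ball_vec y j $ u else 0) = (if E z u \<and> Suc (d u x) = d z x then 1 else 0)" for u
    proof -
      have "d x u + j = D \<and> d u y = j" if u: "E z u" "d x z = Suc (d x u)"
      proof -
        have "d x u = 1" using u xz by simp
        moreover have "d u y \<le> Suc (d z y)" using d_step'(1)[OF u(1)] .
        moreover have "D \<le> d x u + d u y" using d_triangle[of x y u] assms by simp
        ultimately show ?thesis using z assms D_ge by simp
      qed
      then show ?thesis by (auto simp: ball_vec_nth d_commute)
    qed
    then have "Rop (ball_vec y j) $ z = of_nat (card {u. E z u \<and> Suc (d u x) = d z x})"
      unfolding relop_nth by (simp add: sum.If_cases)
    also have "\<dots> = of_real (c (d z x))" unfolding card_c[symmetric] by simp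
    finally show ?thesis using xz d_commute[of z x] by simp
  qed
  then have "Rop (ball_vec y j) $ z \<bullet> ball_vec y (j - 1) $ z = c 2 * (ball_vec y (j - 1) $ z \<bullet> ball_vec y (j - 1) $ z)" for z
    by (auto simp: ball_vec_nth inner_complex_def)
  then show ?thesis by (simp add: inner_vec_def sum_distrib_left)
qed

lemma lev_L_pow:
  assumes "lev D v = v" "j \<le> D"
  shows "lev (D - j) ((Lop ^^ j) v) = (Lop ^^ j) v"
  using assms(2)
proof (induction j)
  case (Suc j)
  then have "Suc (D - Suc j) = D - j" by simp
  then show ?case using Suc by (simp add: lev_L)
qed (use assms in simp)

lemma relpow_add: "(relop P ^^ j) (u + v) = (relop P ^^ j) u + (relop P ^^ j) v"
  and relpow_diff: "(relop P ^^ j) (u - v) = (relop P ^^ j) u - (relop P ^^ j) v"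
  and relpow_scaleR: "(relop P ^^ j) (r *\<^sub>R u) = r *\<^sub>R (relop P ^^ j) u"
  and relpow_smult: "(relop P ^^ j) (s *s u) = s *s (relop P ^^ j) u"
  by (induction j) simp_all

lemma L_pow_inner: "(Lop ^^ j) u \<bullet> v = u \<bullet> (Rop ^^ j) v"
proof (induction j arbitrary: v)
  case (Suc j)
  have "(Lop ^^ Suc j) u \<bullet> v = (Lop ^^ j) u \<bullet> Rop v" by (simp add: L_inner)
  also have "\<dots> = u \<bullet> (Rop ^^ j) (Rop v)" by (rule Suc.IH)
  finally show ?case by (simp add: funpow_swap1)
qed simp

lemma sph_RL: "0 < i \<Longrightarrow> Rop (Lop (sph i)) = x0 i *\<^sub>R sph i"
  by (cases i) (simp_all add: sph_L sph_R x0_def)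

lemma L_pow_sph: "j \<le> D \<Longrightarrow> (Lop ^^ j) (sph D) = (\<Prod>i<j. b (D - Suc i)) *\<^sub>R sph (D - j)"
proof (induction j)
  case (Suc j)
  then have "D - j = Suc (D - Suc j)" by simp
  then show ?case using Suc by (simp add: sph_L mult.commute)
qed simp

lemma R_pow_sph: "(Rop ^^ j) (sph 0) = (\<Prod>i=1..j. c i) *\<^sub>R sph j"
  by (induction j) (auto simp: sph_R mult.commute)

end

section \<open>Exclusion of the exceptional family\<close>

context uniform_graph
begin

lemma full_chain_contradiction:
  assumes "chain w g" "g 1 = - \<alpha> * (br D - 1)" "\<beta> \<noteq> \<alpha> * br D"
    and beta: "\<beta> = \<alpha> * (1 + q * br D) - q" and al: "\<alpha> * (1 + q) \<ge> 1"
  shows False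
proof -
  define xf where "xf i = (if i \<le> 1 then 0 else c (i - 1) * lfull i)" for i
  define \<delta> where "\<delta> i = x0 i - xf i" for i
  have sv: "c 2 * c (D - 1) \<le> xf 2" "xf 2 < x0 2" "0 < xf D" "xf D * x0 2 < xf 2 * x0 D"
    using full_chain_bounds[OF beta al] unfolding xf_def by blast+
  have \<delta>2: "\<delta> 2 > 0" using sv by (simp add: \<delta>_def)
  have \<delta>D2: "xf D * \<delta> 2 < xf 2 * \<delta> D" using sv by (simp add: \<delta>_def algebra_simps)
  have "c 2 * c (D - 1) > 0" using c_pos[of 2] c_pos[of "D - 1"] D_ge by simp
  then have xf2: "xf 2 > 0" using sv(1) by linarith
  have "xf D * \<delta> 2 > 0" using sv \<delta>2 by simp
  then have "xf 2 * \<delta> D > 0" using \<delta>D2 by linarith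
  then have \<delta>D: "\<delta> D > 0" using xf2 by (simp add: zero_less_mult_iff)
  have lD: "lfull i \<noteq> 0" if "2 \<le> i" "i \<le> D" for i
    using lfull_nonzero[of i] that sv(3) D_ge by (cases "i = D") (auto simp: xf_def)
  have xsf: "xs g i = xf i" if "i \<le> D" for i
    using chain_full(1)[OF assms(1,2), of i] that by (auto simp: xs_def xf_def)
  have rowf: "e_minus e i * xf (i - 1) + xf i + e_plus D e i * xf (i + 1) = f i" if i: "2 \<le> i" "i \<le> D" for i
  proof -
    have ep: "e_plus D e i * xf (i + 1) = e_plus D e i * xs g (i + 1)"
      using i xsf[of "i + 1"] by (cases "i = D") (auto simp: e_plus_def)
    show ?thesis
      unfolding ep using chain_row[OF assms(1) i] chain_full[OF assms(1,2) i] lD[OF i] xsf[of i] xsf[of "i - 1"] i by simp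
  qed
  have row\<delta>: "e_minus e i * \<delta> (i - 1) + \<delta> i + e_plus D e i * \<delta> (i + 1) = 0" if i: "2 \<le> i" "i \<le> D" for i
    using rowf[OF i] primary_row[of i] i by (simp add: \<delta>_def algebra_simps)
  \<comment> \<open>Otherwise \<open>\<delta>\<close> would lie in the kernel of the block with rows \<open>i, \<dots>, D\<close>.\<close>
  have em: "e_minus e i \<noteq> 0" if i: "2 \<le> i" "i \<le> D" for i
  proof
    assume 0: "e_minus e i = 0"
    have "complex_of_real (\<delta> D) = 0"
    proof (rule parameter_matrix_kernel[OF pm, of i D])
      fix j assume j: "i \<le> j" "j \<le> D"
      have 1: "(if i < j then e j (j - 1) * complex_of_real (\<delta> (j - 1)) else 0) = e_minus e j * \<delta> (j - 1)"
        using j i 0 by (auto simp: e_minus_def)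
      have 2: "(if j < D then e j (j + 1) * complex_of_real (\<delta> (j + 1)) else 0) = e_plus D e j * \<delta> (j + 1)"
        using j by (auto simp: e_plus_def)
      show "(if i < j then e j (j - 1) * complex_of_real (\<delta> (j - 1)) else 0) + complex_of_real (\<delta> j)
          + (if j < D then e j (j + 1) * complex_of_real (\<delta> (j + 1)) else 0) = 0"
        unfolding 1 2 using row\<delta>[of j] i j by simp
    qed (use i in auto)
    then show False using \<delta>D by simp
  qed
  \<comment> \<open>At level \<open>D\<close>, \<open>t\<close> is the affine function of
    \<open>Rop \<circ> Lop\<close> with value 0 on the given chain and 1 on the primary module. So
    \<open>p i\<close> interpolates between \<open>xf i\<close> and \<open>x0 i\<close>.\<close>
  define t where "t v = (1 / \<delta> D) *\<^sub>R (Rop (Lop v) - xf D *\<^sub>R v)" for v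
  define p where "p i v = xf i *\<^sub>R v + \<delta> i *\<^sub>R t v" for i v
  have lev_RL: "lev D (Rop (Lop v)) = Rop (Lop v)" if "lev D v = v" for v
  proof -
    have "lev (Suc (D - 1)) (Rop (Lop v)) = Rop (Lop (lev (Suc (D - 1)) v))"
      by (simp only: lev_R lev_L)
    then show ?thesis using that D_pos by simp
  qed
  have lev_t: "lev D (t v) = t v" if "lev D v = v" for v
    using that lev_RL[OF that] by (simp add: t_def)
  have p_D: "p D v = Rop (Lop v)" for v using \<delta>D by (simp add: p_def t_def)
  \<comment> \<open>Row \<open>D - k\<close>, divided by \<open>e_minus\<close>, expresses the case
    \<open>k + 1\<close> through the cases \<open>k\<close> and \<open>k - 1\<close>. The
    coefficients fit because \<open>xf\<close> solves the rows and \<delta> the homogeneous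
    ones.\<close>
  have key: "Rop ((Lop ^^ Suc j) v) = (Lop ^^ j) (p (D - j) v)" if "lev D v = v" "j < D" for j v
    using that(2)
  proof (induction j rule: less_induct)
    case (less j)
    show ?case
    proof (cases j)
      case 0
      then show ?thesis by (simp add: p_D)
    next
      case (Suc k)
      define i where "i = D - k"
      have i: "2 \<le> i" "i \<le> D" "D - j = i - 1" using less.prems Suc by (auto simp: i_def)
      define u where "u = (Lop ^^ k) v"
      have lu: "lev i u = u" unfolding u_def i_def using lev_L_pow[OF that(1), of k] less.prems Suc by simp
      have LRL: "Lop (Rop (Lop u)) = (Lop ^^ Suc k) (p i v)"
        using less.IH[of k] less.prems Suc by (simp add: u_def i_def)
      have LLR: "e_plus D e i *s Lop (Lop (Rop u)) = e_plus D e i *s (Lop ^^ Suc k) (p (i + 1) v)"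
      proof (cases k)
        case 0
        then show ?thesis by (simp add: i_def e_plus_def)
      next
        case (Suc l)
        have "Rop u = (Lop ^^ l) (p (D - l) v)"
          using less.IH[of l] less.prems Suc \<open>j = Suc k\<close> by (simp add: u_def)
        moreover have "D - l = i + 1" using Suc less.prems \<open>j = Suc k\<close> by (simp add: i_def)
        ultimately show ?thesis using Suc by simp
      qed
      have Lu: "Lop u = (Lop ^^ Suc k) v" by (simp add: u_def)
      have comb: "f i *s v - p i v - e_plus D e i *s p (i + 1) v = e_minus e i *s p (i - 1) v"
      proof -
        have "(f i - xf i - e_plus D e i * xf (i + 1)) *s v + (- \<delta> i - e_plus D e i * \<delta> (i + 1)) *s t v
            = (e_minus e i * xf (i - 1)) *s v + (e_minus e i * \<delta> (i - 1)) *s t v"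
        proof -
          have "f i - xf i - e_plus D e i * xf (i + 1) = e_minus e i * xf (i - 1)"
            using rowf[OF i(1,2)] by (simp add: algebra_simps)
          moreover have "- \<delta> i - e_plus D e i * \<delta> (i + 1) = e_minus e i * \<delta> (i - 1)"
            using row\<delta>[OF i(1,2)] by (simp add: algebra_simps add_eq_0_iff)
          ultimately show ?thesis by simp
        qed
        then show ?thesis
          by (simp add: p_def smult_complex_of_real[symmetric] vec.scale_left_diff_distrib vec.scale_left_distrib
              vec.scale_right_distrib algebra_simps)
      qed
      have "e_minus e i *s Rop (Lop (Lop u)) = f i *s Lop u - Lop (Rop (Lop u)) - e_plus D e i *s Lop (Lop (Rop u))"
        using row[OF _ i(2) lu] i(1) by (simp add: algebra_simps)
      also have "\<dots> = (Lop ^^ Suc k) (f i *s v - p i v - e_plus D e i *s p (i + 1) v)"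
        unfolding LRL LLR unfolding Lu by (simp only: relpow_diff relpow_smult)
      also have "\<dots> = e_minus e i *s (Lop ^^ Suc k) (p (i - 1) v)"
        unfolding comb relpow_smult ..
      finally have "Rop (Lop (Lop u)) = (Lop ^^ Suc k) (p (i - 1) v)"
        using em[OF i(1,2)] by (simp only: vec.scale_cancel_left) simp
      then show ?thesis using Suc i(3) by (simp add: u_def)
    qed
  qed
  define M where "M j v = (Rop ^^ j) ((Lop ^^ j) v)" for j v
  have M_Suc: "M (Suc j) v = M j (p (D - j) v)" if "lev D v = v" "j < D" for j v
    using key[OF that] by (simp add: M_def funpow_swap1)
  have M_comm: "M j (Rop (Lop v)) = Rop (Lop (M j v))" if "lev D v = v" "j \<le> D" for j v
    using that
  proof (induction j arbitrary: v)
    case 0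
    then show ?case by (simp add: M_def)
  next
    case (Suc j)
    have lp: "lev D (p (D - j) v) = p (D - j) v" using Suc.prems lev_t by (simp add: p_def)
    have "M (Suc j) (Rop (Lop v)) = M j (p (D - j) (Rop (Lop v)))"
      using M_Suc[of "Rop (Lop v)" j] Suc.prems lev_RL by simp
    also have "p (D - j) (Rop (Lop v)) = Rop (Lop (p (D - j) v))" by (simp add: p_def t_def)
    also have "M j (Rop (Lop (p (D - j) v))) = Rop (Lop (M j (p (D - j) v)))"
      using Suc.IH[OF lp] Suc.prems by simp
    finally show ?case using M_Suc[of v j] Suc.prems by simp
  qed
  \<comment> \<open>The eigenvalue of \<open>Rop \<circ> Lop\<close> at level \<open>D\<close> on a submodule with endpoint 2 that reaches level \<open>D\<close>.\<close>
  define \<xi> where "\<xi> = xf D - xf 2 * \<delta> D / \<delta> 2"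
  have \<xi>: "\<xi> < 0" using \<delta>D2 \<delta>2 by (simp add: \<xi>_def field_simps)
  have D1: "D - (D - 1) = 1" "D - (D - 2) = 2" "Suc (D - 1) = D" "Suc (D - 2) = D - 1" using D_ge by auto
  have xf1: "xf 1 = 0" by (simp add: xf_def)
  have \<delta>1: "\<delta> 1 \<noteq> 0" using b_pos[of 0] D_pos by (simp add: \<delta>_def xf_def x0_def)
  \<comment> \<open>The hypothesis on \<open>z\<close> means orthogonality to the primary module.
    Then \<open>Lop ^^ (D - 1)\<close> kills \<open>u = t z\<close>, so \<open>u\<close> has no part
    of endpoint below 2; \<open>M (D - 2) u\<close> is an eigenvector of
    \<open>Rop \<circ> Lop\<close> for \<xi> or 0, and semidefiniteness excludes \<xi> < 0.\<close>
  have vanish: "(Lop ^^ (D - 2)) (t z) = 0" if z: "lev D z = z" "(Lop ^^ D) z = 0" for z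
  proof -
    define u where "u = t z"
    have lu: "lev D u = u" using lev_t z by (simp add: u_def)
    have "(Lop ^^ (D - 1)) (p 1 z) = 0"
      using key[OF z(1), of "D - 1"] z(2) D1 D_pos by simp
    then have Lu: "(Lop ^^ (D - 1)) u = 0"
      using \<delta>1 by (simp add: p_def xf1[unfolded One_nat_def] u_def relpow_add relpow_scaleR)
    then have "(Lop ^^ (D - 2)) (p 2 u) = 0"
      using key[OF lu, of "D - 2"] D1 D_ge by simp
    then have "\<delta> 2 *\<^sub>R (Lop ^^ (D - 2)) (t u) = - (xf 2 *\<^sub>R (Lop ^^ (D - 2)) u)"
      by (simp add: p_def relpow_add relpow_scaleR add_eq_0_iff)
    note * = this
    have "(Lop ^^ (D - 2)) (t u) = (1 / \<delta> 2) *\<^sub>R (\<delta> 2 *\<^sub>R (Lop ^^ (D - 2)) (t u))"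
      using \<delta>2 by simp
    also have "\<dots> = - (xf 2 / \<delta> 2) *\<^sub>R (Lop ^^ (D - 2)) u" unfolding * by simp
    finally have tu: "(Lop ^^ (D - 2)) (t u) = - (xf 2 / \<delta> 2) *\<^sub>R (Lop ^^ (D - 2)) u" .
    have RLu: "Rop (Lop u) = xf D *\<^sub>R u + \<delta> D *\<^sub>R t u" using p_D[of u] by (simp add: p_def)
    have Lx: "(Lop ^^ (D - 2)) (Rop (Lop u)) = \<xi> *\<^sub>R (Lop ^^ (D - 2)) u"
      unfolding RLu relpow_add relpow_scaleR tu by (simp add: \<xi>_def algebra_simps)
    define y where "y = M (D - 2) u"
    have "Rop (Lop y) = M (D - 2) (Rop (Lop u))" using M_comm[OF lu, of "D - 2"] by (simp add: y_def)
    also have "\<dots> = \<xi> *\<^sub>R y" unfolding M_def Lx relpow_scaleR y_def ..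
    finally have "Lop y \<bullet> Lop y = \<xi> * (y \<bullet> y)" by (simp add: L_inner)
    then have "\<xi> * (y \<bullet> y) \<ge> 0" using inner_ge_zero[of "Lop y"] by simp
    then have "y \<bullet> y = 0" using \<xi> inner_ge_zero[of y] mult_neg_pos[of \<xi> "y \<bullet> y"] by linarith
    then have "y = 0" by simp
    then have "(Lop ^^ (D - 2)) u \<bullet> (Lop ^^ (D - 2)) u = 0"
      unfolding L_pow_inner using y_def M_def by simp
    then show ?thesis by (simp add: u_def)
  qed
  obtain y where y: "d x y = D" using sphere_nonempty by blast
  \<comment> \<open>Chosen such that \<open>Lop ^^ D\<close> kills \<open>z\<close>, which makes
    \<open>z\<close> the part of the vertex \<open>y\<close> orthogonal to the primary
    module.\<close>
  define \<rho> where "\<rho> = (\<Prod>i=1..D. c i) / (\<Prod>i<D. b (D - Suc i))"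
  have bp: "(\<Prod>i<j. b (D - Suc i)) > 0" if "j \<le> D" for j
    using that b_pos by (intro prod_pos) auto
  have cp: "(\<Prod>i=1..j. c i) > 0" if "j \<le> D" for j
    using that c_pos by (intro prod_pos) auto
  have \<rho>: "\<rho> > 0" using bp[of D] cp[of D] by (simp add: \<rho>_def)
  define z where "z = axis y 1 - \<rho> *\<^sub>R sph D"
  have lz: "lev D z = z"
  proof -
    have "lev D (axis y 1) = axis y (1::complex)" by (auto simp: cvec_eq_iff lev_nth axis_def y)
    then show ?thesis by (simp add: z_def)
  qed
  have Lz: "(Lop ^^ D) z = 0"
    unfolding z_def relpow_diff relpow_scaleR L_pow_ball_vec[OF y] L_pow_sph[OF order_refl] ball_vec_D[OF y]
  proof -
    have "\<rho> * (\<Prod>i<D. b (D - Suc i)) = (\<Prod>i=1..D. c i)"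
      unfolding \<rho>_def using bp[OF order_refl] by (simp del: prod_zero_iff)
    then show "(\<Prod>i=1..D. c i) *\<^sub>R sph 0 - \<rho> *\<^sub>R (\<Prod>i<D. b (D - Suc i)) *\<^sub>R sph (D - D) = 0"
      by simp
  qed
  have zz: "(Lop ^^ (D - 1)) z \<bullet> (Lop ^^ (D - 1)) z = xf 2 * ((Lop ^^ (D - 2)) z \<bullet> (Lop ^^ (D - 2)) z)"
  proof -
    have pw: "(Lop ^^ (D - 1)) z = (Lop ^^ Suc (D - 2)) z" using D1(4) by simp
    have "(Lop ^^ (D - 1)) z \<bullet> (Lop ^^ (D - 1)) z = (Lop ^^ (D - 2)) z \<bullet> Rop ((Lop ^^ Suc (D - 2)) z)"
      unfolding pw by (simp add: L_inner)
    also have "Rop ((Lop ^^ Suc (D - 2)) z) = (Lop ^^ (D - 2)) (p 2 z)"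
      using key[OF lz, of "D - 2"] D1 D_ge by simp
    also have "\<dots> = xf 2 *\<^sub>R (Lop ^^ (D - 2)) z"
      unfolding p_def relpow_add relpow_scaleR vanish[OF lz Lz] by simp
    finally show ?thesis by simp
  qed
  have orth: "(Lop ^^ j) z \<bullet> (Lop ^^ j) (sph D) = 0" if "j \<le> D" for j
  proof -
    have "(Lop ^^ j) z \<bullet> (Rop ^^ (D - j)) (sph 0) = 0"
    proof -
      have "(Lop ^^ (D - j)) ((Lop ^^ j) z) = (Lop ^^ (D - j + j)) z" unfolding funpow_add by simp
      then have "(Lop ^^ (D - j)) ((Lop ^^ j) z) = 0" using Lz that by simp
      then show ?thesis unfolding L_pow_inner[symmetric] by simp
    qed
    then have "(Lop ^^ j) z \<bullet> sph (D - j) = 0"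
      using cp[of "D - j"] by (simp add: R_pow_sph del: prod_zero_iff)
    then show ?thesis by (simp add: L_pow_sph[OF that])
  qed
  have split: "(Lop ^^ j) (axis y 1) \<bullet> (Lop ^^ j) (axis y 1)
      = (Lop ^^ j) z \<bullet> (Lop ^^ j) z + \<rho>^2 * ((Lop ^^ j) (sph D) \<bullet> (Lop ^^ j) (sph D))" if "j \<le> D" for j
  proof -
    have "(Lop ^^ j) (axis y 1) = (Lop ^^ j) z + \<rho> *\<^sub>R (Lop ^^ j) (sph D)"
      by (simp add: z_def relpow_diff relpow_scaleR)
    then show ?thesis using orth[OF that]
      by (simp add: inner_add_left inner_add_right inner_commute power2_eq_square)
  qed
  define S where "S = (Lop ^^ (D - 2)) (sph D)"
  have SS: "(Lop ^^ (D - 1)) (sph D) \<bullet> (Lop ^^ (D - 1)) (sph D) = x0 2 * (S \<bullet> S)" "S \<bullet> S > 0"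
  proof -
    have S: "S = (\<Prod>i<D-2. b (D - Suc i)) *\<^sub>R sph 2"
      unfolding S_def using L_pow_sph[of "D - 2"] D1 by simp
    have "Lop S \<bullet> Lop S = S \<bullet> Rop (Lop S)" by (rule L_inner)
    also have "Rop (Lop S) = x0 2 *\<^sub>R S" unfolding S by (simp add: sph_RL)
    finally show "(Lop ^^ (D - 1)) (sph D) \<bullet> (Lop ^^ (D - 1)) (sph D) = x0 2 * (S \<bullet> S)"
      unfolding S_def D1(4)[symmetric] by simp
    obtain u where "d x u = 2" using sphere_nonempty[of 2] D_ge by auto
    then have "sph 2 $ u = 1" by (simp add: sph_def)
    then have "sph 2 \<noteq> 0" by auto
    then show "S \<bullet> S > 0" using bp[of "D - 2"] by (simp add: S del: prod_zero_iff)
  qed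
  \<comment> \<open>From \<open>Lop ^^ (D - 2)\<close> to \<open>Lop ^^ (D - 1)\<close> squared
    norms grow by \<open>xf 2\<close> on \<open>z\<close> and by the larger \<open>x0 2\<close> on
    the primary part, so by more than \<open>xf 2\<close> on \<open>y\<close>. Counting on geodesics
    gives the factor \<open>c 2 * c (D - 1)\<close>, which is at most \<open>xf 2\<close>.\<close>
  define B where "B = (Lop ^^ (D - 2)) (axis y 1)"
  have "(Lop ^^ (D - 1)) (axis y 1) \<bullet> (Lop ^^ (D - 1)) (axis y 1) = xf 2 * (B \<bullet> B) + \<rho>^2 * ((x0 2 - xf 2) * (S \<bullet> S))"
    unfolding split[of "D - 1", OF diff_le_self] zz SS B_def split[of "D - 2", OF diff_le_self] S_def[symmetric]
    by (simp add: algebra_simps)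
  moreover have "\<rho>^2 * ((x0 2 - xf 2) * (S \<bullet> S)) > 0"
    using \<rho> sv(2) SS(2) by (intro mult_pos_pos) auto
  moreover have "(Lop ^^ (D - 1)) (axis y 1) \<bullet> (Lop ^^ (D - 1)) (axis y 1) = c 2 * c (D - 1) * (B \<bullet> B)"
  proof -
    have B: "B = (\<Prod>i=1..D-2. c i) *\<^sub>R ball_vec y (D - 2)" unfolding B_def by (rule L_pow_ball_vec[OF y])
    have LB: "Lop (ball_vec y (D - 2)) = c (D - 1) *\<^sub>R ball_vec y (D - 1)"
      using L_ball_vec[OF y, of "D - 2"] D1 by simp
    have "Lop (ball_vec y (D - 2)) \<bullet> Lop (ball_vec y (D - 2))
        = c (D - 1) * (ball_vec y (D - 1) \<bullet> Lop (ball_vec y (D - 2)))"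
      by (subst LB) simp
    also have "ball_vec y (D - 1) \<bullet> Lop (ball_vec y (D - 2)) = Rop (ball_vec y (D - 1)) \<bullet> ball_vec y (D - 1 - 1)"
      by (simp add: R_inner numeral_2_eq_2)
    also have "\<dots> = c 2 * (ball_vec y (D - 2) \<bullet> ball_vec y (D - 2))"
      using R_ball_vec_inner[OF y D1(3)] by (simp add: numeral_2_eq_2)
    finally have "Lop B \<bullet> Lop B = c 2 * c (D - 1) * (B \<bullet> B)" unfolding B by simp
    then show ?thesis unfolding B_def D1(4)[symmetric] by simp
  qed
  moreover have "c 2 * c (D - 1) * (B \<bullet> B) \<le> xf 2 * (B \<bullet> B)"
    using sv(1) by (intro mult_right_mono) auto
  ultimately show False by linarith
qed

end

section \<open>Semisimplicity of the standard module\<close>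

text \<open>The inner product of \<open>complex ^ 'n\<close> is the real one; its orthogonal complements of complex subspaces are complex
  subspaces again.\<close>

lemma inner_imaginary:
  fixes v w :: "complex ^ 'n::finite"
  shows "(\<i> *s v) \<bullet> w = - (v \<bullet> (\<i> *s w))"
  by (simp add: inner_vec_def inner_complex_def sum_negf[symmetric])

lemma smult_split: "s *s v = Re s *\<^sub>R v + Im s *\<^sub>R (\<i> *s v)"
  for v :: "complex ^ 'n::finite"
  by (simp add: cvec_eq_iff complex_eq_iff)

lemma orthogonal_comp_cspace:
  fixes W :: "(complex ^ 'n::finite) set"
  assumes "vec.subspace W"
  shows "vec.subspace {v. \<forall>w\<in>W. v \<bullet> w = 0}"
proof (rule vec.subspaceI)
  fix c and v :: "complex ^ 'n"
  assume v: "v \<in> {v. \<forall>w\<in>W. v \<bullet> w = 0}"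
  show "c *s v \<in> {v. \<forall>w\<in>W. v \<bullet> w = 0}"
  proof (intro CollectI ballI)
    fix w assume w: "w \<in> W"
    then have "\<i> *s w \<in> W" using assms by (rule vec.subspace_scale[rotated])
    then have "v \<bullet> w = 0" "v \<bullet> (\<i> *s w) = 0" using v w by auto
    then show "(c *s v) \<bullet> w = 0"
      by (subst smult_split) (simp add: inner_add_left inner_imaginary)
  qed
qed (auto simp: inner_add_left)

lemma real_subspace_of_cspace:
  fixes W :: "(complex ^ 'n::finite) set"
  assumes "vec.subspace W"
  shows "subspace W"
proof (rule subspaceI)
  show "0 \<in> W" using assms by (rule vec.subspace_0)
  show "u + v \<in> W" if "u \<in> W" "v \<in> W" for u v using assms that by (rule vec.subspace_add)
  show "r *\<^sub>R v \<in> W" if "v \<in> W" for r v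
    using vec.subspace_scale[OF assms that, of "of_real r"] by (simp add: smult_complex_of_real)
qed

lemma orthogonal_comp_trivial:
  fixes W :: "(complex ^ 'n::finite) set"
  assumes "vec.subspace W" "{v. \<forall>w\<in>W. v \<bullet> w = 0} = {0}"
  shows "W = UNIV"
proof -
  have s: "span W = W" using real_subspace_of_cspace[OF assms(1)] by (simp add: span_eq_iff)
  have "v \<in> W" for v
  proof -
    obtain y z where "y \<in> span W" "\<And>w. w \<in> span W \<Longrightarrow> Linear_Algebra.orthogonal z w" "v = y + z"
      using orthogonal_subspace_decomp_exists by metis
    note yz = this
    then have "z \<in> {v. \<forall>w\<in>W. v \<bullet> w = 0}" using s by (auto simp: Linear_Algebra.orthogonal_def)
    then have "z = 0" unfolding assms(2) by simp
    then show ?thesis using yz s by simp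
  qed
  then show ?thesis by auto
qed

context classical_graph
begin

text \<open>The generators are real symmetric and preserve \<open>W\<close>, hence its complement;
  this invariance passes to sums, multiples and products.\<close>

lemma T_mult_self_adjoint:
  assumes "M \<in> terwilliger_algebra E x" "T_module E x W"
  shows "\<forall>v\<in>{v. \<forall>w\<in>W. v \<bullet> w = 0}. M *v v \<in> {v. \<forall>w\<in>W. v \<bullet> w = 0}"
  using assms(1)
proof induction
  case adjacency
  have "Aop w \<in> W" if "w \<in> W" for w
    using assms(2) that terwilliger_algebra.adjacency[of E x]
    unfolding T_module_def adjacency_mult[symmetric] by blast
  then show ?case by (auto simp: adjacency_mult A_inner)
next
  case (dual i)
  then have "dual_idempotent E x i \<in> terwilliger_algebra E x" by (rule terwilliger_algebra.dual)
  then have "lev i w \<in> W" if "w \<in> W" for w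
    using assms(2) that unfolding T_module_def dual_idempotent_mult[symmetric] by blast
  then show ?case by (auto simp: dual_idempotent_mult lev_inner)
next
  case one
  then show ?case by simp
next
  case (add M N)
  then show ?case by (auto simp: matrix_vector_mult_add_rdistrib inner_add_left)
next
  case (scale M c)
  have "matrix_scale c M *v v = c *s (M *v v)" for v
    by (simp add: cvec_eq_iff matrix_vector_mult_def matrix_scale_def sum_distrib_left mult.assoc)
  moreover have "vec.subspace W" using assms(2) by (simp add: T_module_def)
  ultimately show ?case
    using scale.IH vec.subspace_scale[OF orthogonal_comp_cspace[of W]] by simp
next
  case (mult M N)
  then show ?case by (auto simp: matrix_vector_mul_assoc[symmetric])
qed

lemma T_module_orthogonal:
  assumes "T_module E x W"
  shows "T_module E x {v. \<forall>w\<in>W. v \<bullet> w = 0}"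
  using assms T_mult_self_adjoint[OF _ assms] orthogonal_comp_cspace unfolding T_module_def by blast

lemma exists_irreducible:
  assumes "T_module E x W" "W \<noteq> {0}"
  shows "\<exists>U\<subseteq>W. irreducible_T_module E x U"
  using assms
proof (induction "vec.dim W" arbitrary: W rule: less_induct)
  case less
  show ?case
  proof (cases "irreducible_T_module E x W")
    case False
    then obtain W' where W': "T_module E x W'" "W' \<subseteq> W" "W' \<noteq> {0}" "W' \<noteq> W"
      using less.prems unfolding irreducible_T_module_def by blast
    have "vec.subspace W'" "vec.subspace W" using W'(1) less.prems(1) by (auto simp: T_module_def)
    then have "vec.dim W' < vec.dim W"
      using W' vec.subspace_dim_equal[of W' W] by (meson not_le)
    from less.hyps[OF this W'(1,3)] show ?thesis using W'(2) by blast
  qed auto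
qed

definition irrspan :: "(complex ^ 'a) set" where
  "irrspan = vec.span (\<Union>{U. irreducible_T_module E x U})"

text \<open>An irreducible module in the orthogonal complement of \<open>irrspan\<close> would also
  lie in \<open>irrspan\<close>, hence be 0.\<close>

lemma irrspan_UNIV: "irrspan = UNIV"
proof (rule orthogonal_comp_trivial)
  show sub: "vec.subspace irrspan" by (simp add: irrspan_def vec.subspace_span)
  have "T_module E x irrspan"
    unfolding T_module_def
  proof (intro conjI ballI sub)
    fix M v assume M: "M \<in> terwilliger_algebra E x" and v: "v \<in> irrspan"
    from v show "M *v v \<in> irrspan"
      unfolding irrspan_def
    proof (induction rule: vec.span_induct_alt)
      case base
      then show ?case by (simp add: vec.span_zero)
    next
      case (step c u v)
      then have "M *v u \<in> \<Union>{U. irreducible_T_module E x U}"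
        using M unfolding irreducible_T_module_def T_module_def by blast
      note Mu = this
      show ?case
        unfolding matrix_vector_right_distrib vector_scalar_commute
        by (rule vec.span_add[OF vec.span_scale[OF vec.span_base[OF Mu]] step(2)])
    qed
  qed
  then have T: "T_module E x {v. \<forall>w\<in>irrspan. v \<bullet> w = 0}" by (rule T_module_orthogonal)
  show "{v. \<forall>w\<in>irrspan. v \<bullet> w = 0} = {0}"
  proof (rule ccontr)
    assume "{v. \<forall>w\<in>irrspan. v \<bullet> w = 0} \<noteq> {0}"
    then obtain U where U: "U \<subseteq> {v. \<forall>w\<in>irrspan. v \<bullet> w = 0}" "irreducible_T_module E x U"
      using exists_irreducible[OF T] by blast
    have "u = 0" if "u \<in> U" for u
    proof -
      have "u \<in> irrspan" unfolding irrspan_def using U(2) that by (intro vec.span_base) blast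
      then have "u \<bullet> u = 0" using U(1) that by blast
      then show ?thesis by simp
    qed
    moreover have "0 \<in> U" using U(2) unfolding irreducible_T_module_def T_module_def by (auto intro: vec.subspace_0)
    ultimately have "U = {0}" by auto
    then show False using U(2) by (simp add: irreducible_T_module_def)
  qed
qed

lemma module_closed:
  assumes "T_module E x W" "w \<in> W"
  shows "Aop w \<in> W" "i \<le> D \<Longrightarrow> lev i w \<in> W" "Lop w \<in> W" "Fop w \<in> W" "Rop w \<in> W"
proof -
  have A: "Aop w \<in> W" if "w \<in> W" for w
    using assms(1) that terwilliger_algebra.adjacency[of E x]
    unfolding T_module_def adjacency_mult[symmetric] by blast
  have l: "lev i w \<in> W" if "w \<in> W" for i w
  proof (cases "i \<le> D")
    case True
    then show ?thesis
      using assms(1) that terwilliger_algebra.dual[of i E x] diameter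
      unfolding T_module_def dual_idempotent_mult[symmetric] by blast
  next
    case False
    then show ?thesis using assms(1) by (auto simp: lev_gt T_module_def intro: vec.subspace_0)
  qed
  have sub: "vec.subspace W" using assms(1) by (simp add: T_module_def)
  show "Aop w \<in> W" "i \<le> D \<Longrightarrow> lev i w \<in> W" using A l assms(2) by auto
  have F: "Fop v = (\<Sum>i\<le>D. lev i (Aop (lev i v)))" for v
  proof -
    have "lev i (Aop (lev i v)) = Fop (lev i v)" for i
      by (cases i) (simp_all add: A_split lev_F lev_L lev_R lev_R_0)
    then show ?thesis by (simp only: relop_sum[symmetric] lev_sum)
  qed
  have R: "Rop v = (\<Sum>i\<le>D. lev (Suc i) (Aop (lev i v)))" for v
  proof -
    have "lev (Suc i) (Aop (lev i v)) = Rop (lev i v)" for i by (simp add: lev_Suc_A)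
    then show ?thesis by (simp only: relop_sum[symmetric] lev_sum)
  qed
  show "Fop w \<in> W" unfolding F using assms(2) A l by (intro vec.subspace_sum[OF sub]) auto
  show "Rop w \<in> W" unfolding R using assms(2) A l by (intro vec.subspace_sum[OF sub]) auto
  then have "Aop w - Fop w - Rop w \<in> W"
    using \<open>Aop w \<in> W\<close> \<open>Fop w \<in> W\<close> sub by (intro vec.subspace_diff) auto
  then show "Lop w \<in> W" by (simp add: A_split)
qed

text \<open>A vector of a one-dimensional level space is an eigenvector of the self-adjoint map \<open>Fop\<close>.\<close>

lemma thin_level_eigen:
  assumes "T_module E x W" "vec.dim (lev i ` W) \<le> 1" "v \<in> W" "lev i v = v" "i \<le> D"
  shows "\<exists>r::real. Fop v = r *\<^sub>R v"
proof (cases "v = 0")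
  case False
  have v: "v \<in> lev i ` W" using assms(3,4) by (intro image_eqI[of _ _ v]) auto
  have Fv: "Fop v \<in> lev i ` W"
    using module_closed(4)[OF assms(1,3)] assms(4) lev_F[of i v] by (intro image_eqI[of _ _ "Fop v"]) auto
  have "vec.dim {v} = 1" using False vec.dim_insert[of v "{}"] by simp
  have "lev i ` W \<subseteq> vec.span {v}"
    using vec.card_ge_dim_independent[of "{v}" "lev i ` W"] v assms(2) False by (simp add: vec.independent_insert)
  then obtain s where s: "Fop v = s *s v" using Fv by (auto simp: vec.span_singleton)
  \<comment> \<open>In the real inner product \<open>v\<close> and \<open>\<i> *s v\<close> are
    orthogonal of equal length, so pairing with \<open>\<i> *s v\<close> reads off
    \<open>Im s\<close>.\<close>
  have e: "(\<i> *s v) \<bullet> (\<i> *s v) = v \<bullet> v" by (simp add: inner_vec_def inner_complex_def add.commute)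
  have orth: "v \<bullet> (\<i> *s v) = 0" by (simp add: inner_vec_def inner_complex_def)
  have "Fop v \<bullet> (\<i> *s v) = v \<bullet> Fop (\<i> *s v)" by (rule F_inner)
  also have "\<dots> = v \<bullet> (\<i> *s Fop v)" by simp
  also have "\<dots> = - ((\<i> *s v) \<bullet> Fop v)" by (simp add: inner_imaginary)
  finally have "Fop v \<bullet> (\<i> *s v) = 0" by (simp add: inner_commute)
  moreover have "Fop v \<bullet> (\<i> *s v) = Im s * (v \<bullet> v)"
    unfolding s by (subst smult_split) (simp add: inner_add_left e orth)
  ultimately have "Im s = 0" using False by simp
  then have "Fop v = Re s *\<^sub>R v" unfolding s by (subst smult_split) simp
  then show ?thesis ..
qed auto

lemma sph_0_generated:
  assumes "T_module E x W" "sph 0 \<in> W" "i \<le> D"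
  shows "sph i \<in> W"
  using assms(3)
proof (induction i)
  case (Suc i)
  have sub: "vec.subspace W" using assms(1) by (simp add: T_module_def)
  have "c (Suc i) *\<^sub>R sph (Suc i) \<in> W"
    using module_closed(5)[OF assms(1), of "sph i"] Suc by (simp add: sph_R)
  then have "(1 / c (Suc i)) *\<^sub>R (c (Suc i) *\<^sub>R sph (Suc i)) \<in> W"
    by (rule subspace_scale[OF real_subspace_of_cspace[OF sub]])
  then show ?case using c_pos[of "Suc i"] Suc.prems by simp
qed (use assms in simp)

lemma sph_F: "Fop (sph i) = a i *\<^sub>R sph i"
proof -
  have "Fop (sph i) $ y = (a i *\<^sub>R sph i) $ y" for y
  proof -
    have "(if E y z \<and> d x y = d x z then sph i $ z else 0) = (if d x y = i \<and> E y z \<and> d z x = d y x then 1 else 0)" for z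
      by (auto simp: sph_def d_commute)
    then have "Fop (sph i) $ y = (if d x y = i then of_nat (card {w. E y w \<and> d w x = d y x}) else 0)"
      unfolding relop_nth by (simp add: sum.If_cases)
    also have "(of_nat (card {w. E y w \<and> d w x = d y x}) :: complex) = of_real (a (d x y))"
      unfolding d_commute[of x y] card_a[symmetric] by simp
    finally show ?thesis by (simp add: sph_def of_real_def)
  qed
  then show ?thesis unfolding cvec_eq_iff by blast
qed

definition primary :: "(complex ^ 'a) set" where
  "primary = vec.span (sph ` {..D})"

lemma sph_gt: "i > D \<Longrightarrow> sph i = 0"
  using lev_gt[of i "sph i"] by simp

lemma T_module_primary: "T_module E x primary"
proof -
  have sph_in: "sph i \<in> primary" for i
    by (cases "i \<le> D") (auto simp: primary_def sph_gt vec.span_zero intro: vec.span_base)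
  have sub: "vec.subspace primary" by (simp add: primary_def vec.subspace_span)
  have sc: "r *\<^sub>R v \<in> primary" if "v \<in> primary" for r v
    using that by (rule subspace_scale[OF real_subspace_of_cspace[OF sub]])
  have "M *v v \<in> primary" if M: "M \<in> terwilliger_algebra E x" and v: "v \<in> primary" for M v
    using M v
  proof (induction arbitrary: v)
    case adjacency
    have "Aop (sph i) \<in> primary" for i
      unfolding A_split sph_F sph_R using sph_in sub
      by (cases i) (auto intro!: vec.subspace_add sc simp: sph_L, auto simp: L_lev_0[of "sph 0", simplified] intro!: vec.subspace_0)
    show ?case using adjacency unfolding primary_def adjacency_mult
    proof (induction rule: vec.span_induct_alt)
      case base
      then show ?case by (simp add: vec.span_zero)
    next
      case (step c u v)
      then show ?case using \<open>\<And>i. Aop (sph i) \<in> primary\<close>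
        by (auto simp: primary_def intro!: vec.span_add vec.span_scale)
    qed
  next
    case (dual i)
    show ?case using dual(2) unfolding primary_def dual_idempotent_mult
    proof (induction rule: vec.span_induct_alt)
      case base
      then show ?case by (simp add: vec.span_zero)
    next
      case (step c u v)
      then obtain j where "u = sph j" "j \<le> D" by auto
      then have "lev i u \<in> vec.span (sph ` {..D})"
        by (cases "j = i") (simp_all add: vec.span_zero vec.span_base)
      then show ?case using step by (auto intro!: vec.span_add vec.span_scale)
    qed
  next
    case one
    then show ?case by simp
  next
    case (add M N)
    then show ?case using sub by (auto simp: matrix_vector_mult_add_rdistrib intro: vec.subspace_add)
  next
    case (scale M c)
    have "matrix_scale c M *v v = c *s (M *v v)" for v
      by (simp add: cvec_eq_iff matrix_vector_mult_def matrix_scale_def sum_distrib_left mult.assoc)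
    then show ?case using scale sub by (auto intro: vec.subspace_scale)
  next
    case (mult M N)
    then show ?case by (simp add: matrix_vector_mul_assoc[symmetric])
  qed
  then show ?thesis using sub by (simp add: T_module_def)
qed

lemma lev_primary: "v \<in> primary \<Longrightarrow> i \<le> D \<Longrightarrow> \<exists>s. lev i v = s *s sph i"
  unfolding primary_def
proof (induction rule: vec.span_induct_alt)
  case base
  show ?case by (rule exI[of _ 0]) simp
next
  case (step c u v)
  then obtain s where "lev i v = s *s sph i" by auto
  moreover obtain s' where "lev i u = s' *s sph i"
  proof -
    obtain j where "u = sph j" using step by auto
    then show ?thesis using that[of "if i = j then 1 else 0"] by (cases "i = j") auto
  qed
  ultimately show ?case
    by (intro exI[of _ "c * s' + s"]) (simp add: vec.scale_left_distrib)
qed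

text \<open>Semisimplicity reduces this to irreducible modules. One that meets level 0 contains the
  primary module, hence equals it, and contributes \<open>sph 1\<close>; any other one that meets
  level 1 has endpoint 1 and is thin by assumption.\<close>

lemma span_local:
  assumes thin: "\<And>W. irreducible_T_module E x W \<Longrightarrow> module_endpoint E x W = 1 \<Longrightarrow> thin_module E x W"
    and v: "lev 1 v = v"
  shows "v \<in> vec.span (insert (sph 1) {w. thin_vec w})"
proof -
  have irr: "lev 1 u \<in> vec.span (insert (sph 1) {w. thin_vec w})" if U: "irreducible_T_module E x U" "u \<in> U" for U u
  proof (cases "lev 1 u = 0")
    case True
    then show ?thesis by (simp add: vec.span_zero)
  next
    case False
    have T: "T_module E x U" using U(1) by (simp add: irreducible_T_module_def)
    have sub: "vec.subspace U" using T by (simp add: T_module_def)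
    show ?thesis
    proof (cases "\<exists>w\<in>U. lev 0 w \<noteq> 0")
      case True
      then obtain w where w: "w \<in> U" "lev 0 w \<noteq> 0" by blast
      have l0: "lev 0 w = (w $ x) *s sph 0"
        unfolding cvec_eq_iff lev_nth by (auto simp: sph_def d_eq_0)
      have "lev 0 w \<in> U" using module_closed(2)[OF T w(1), of 0] by simp
      then have "(1 / w $ x) *s lev 0 w \<in> U" by (rule vec.subspace_scale[OF sub])
      moreover have "w $ x \<noteq> 0" using w(2) unfolding l0 by auto
      ultimately have "sph 0 \<in> U" unfolding l0 by (simp add: vec.scale_scale)
      then have "primary \<subseteq> U"
        unfolding primary_def using sph_0_generated[OF T] sub by (intro vec.span_minimal) auto
      moreover have "sph 0 \<in> primary" by (auto simp: primary_def intro: vec.span_base)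
      then have "primary \<noteq> {0}" using \<open>lev 0 w \<noteq> 0\<close> l0 by auto
      ultimately have "U = primary"
        using U(1) T_module_primary unfolding irreducible_T_module_def by blast
      then obtain s where "lev 1 u = s *s sph 1" using lev_primary[of u 1] U(2) D_pos by auto
      then show ?thesis by (auto intro: vec.span_scale vec.span_base)
    next
      case no0: False
      have "lev i ` U \<noteq> {0} \<longleftrightarrow> (\<exists>w\<in>U. lev i w \<noteq> 0)" for i
      proof -
        have "0 \<in> lev i ` U" using vec.subspace_0[OF sub] by (intro image_eqI[of _ _ 0]) auto
        then show ?thesis by blast
      qed
      then have "1 \<in> {i. i \<le> D \<and> lev i ` U \<noteq> {0}}" "0 \<notin> {i. i \<le> D \<and> lev i ` U \<noteq> {0}}"
        using False U(2) no0 D_pos by auto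
      then have "module_endpoint E x U = 1"
        unfolding module_endpoint_def dual_idempotent_mult diameter
        by (intro Min_eqI) (auto simp: Suc_le_eq intro!: Suc_leI gr0I)
      then have th: "thin_module E x U" using thin U(1) by blast
      then have dim: "vec.dim (lev i ` U) \<le> 1" if "i \<le> D" for i
        using that by (simp add: thin_module_def dual_idempotent_mult diameter)
      define w where "w = lev 1 u"
      have w: "w \<in> U" "lev 1 w = w" "w \<noteq> 0"
        using module_closed(2)[OF T U(2), of 1] D_pos False by (auto simp: w_def)
      \<comment> \<open>The entry of \<open>Aop w\<close> at \<open>x\<close> is the sum of the
        entries of \<open>w\<close>, so the absence of level 0 makes \<open>w\<close> a local
        vector.\<close>
      have "lev 0 (Aop w) = 0" using no0 module_closed(1)[OF T w(1)] by blast
      then have "Aop w $ x = 0" using lev_nth[of 0 "Aop w" x] by simp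
      moreover have "Aop w $ x = (\<Sum>y\<in>UNIV. w $ y)"
      proof -
        have "w $ y = 0" if "\<not> E x y" for y
          using that lev_nth[of 1 w y] unfolding w(2) by (simp add: d_eq_1)
        then show ?thesis unfolding relop_nth by (intro sum.cong) auto
      qed
      ultimately have lw: "local_vec w" using w by (simp add: local_vec_def)
      have wpU: "wp (Suc m) w \<in> U" if "Suc m \<le> D" for m
        using that
      proof (induction m)
        case 0
        then show ?case using wp_1[OF lw] w by simp
      next
        case (Suc m)
        have "c (Suc m) *\<^sub>R wp (Suc (Suc m)) w \<in> U"
          using module_closed(5)[OF T, of "wp (Suc m) w"] Suc by (simp add: R_wp[OF lw])
        then have "(1 / c (Suc m)) *\<^sub>R (c (Suc m) *\<^sub>R wp (Suc (Suc m)) w) \<in> U"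
          by (rule subspace_scale[OF real_subspace_of_cspace[OF sub]])
        then show ?case using c_pos[of "Suc m"] Suc.prems by simp
      qed
      have "\<exists>r::real. Fop (wp i w) = r *\<^sub>R wp i w" if i: "i \<in> {1..D}" for i
        using thin_level_eigen[OF T dim, of i "wp i w"] wpU[of "i - 1"] i by simp
      then have "thin_vec w" using lw w by (simp add: thin_vec_def)
      then show ?thesis by (auto simp: w_def intro: vec.span_base)
    qed
  qed
  have "v \<in> irrspan" using irrspan_UNIV by simp
  then have "lev 1 v \<in> vec.span (insert (sph 1) {w. thin_vec w})"
    unfolding irrspan_def
  proof (induction rule: vec.span_induct_alt)
    case base
    then show ?case by (simp add: vec.span_zero)
  next
    case (step c u v)
    then show ?case using irr by (auto intro!: vec.span_add vec.span_scale)
  qed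
  then show ?thesis using v by simp
qed

section \<open>The local graph\<close>

lemma F_axis: "Fop (axis y 1) $ z = (if E z y \<and> d x z = d x y then 1 else 0)"
proof -
  have "(if E z u \<and> d x z = d x u then axis y 1 $ u else 0) = (if u = y then if E z y \<and> d x z = d x y then 1 else 0 else (0::complex))" for u
    by (auto simp: axis_def)
  then show ?thesis unfolding relop_nth by simp
qed

lemma FF_axis: "Fop (Fop (axis y 1)) $ z
    = of_nat (card {u. E z u \<and> d x z = d x u \<and> E u y \<and> d x u = d x y})"
proof -
  have "(if E z u \<and> d x z = d x u then Fop (axis y 1) $ u else 0)
      = (if E z u \<and> d x z = d x u \<and> E u y \<and> d x u = d x y then 1 else 0)" for u
    unfolding F_axis by auto
  then show ?thesis unfolding relop_nth[of _ "Fop (axis y 1)"] by (simp add: sum.If_cases)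
qed

lemma sum_sph_1: "(\<Sum>y\<in>UNIV. sph 1 $ y) = of_real (b 0)"
proof -
  have "(\<Sum>y\<in>UNIV. sph 1 $ y) = of_nat (card {y. E x y})"
    by (simp add: sph_def d_eq_1 sum.If_cases)
  then show ?thesis unfolding card_E[of x, symmetric] by simp
qed

lemma chain_F: "chain w g \<Longrightarrow> Fop w = (- 1 - g 1) *\<^sub>R w"
  using D_pos wp_1[of w] by (auto simp: chain_def phi_def dest!: bspec[of _ _ 1])

text \<open>\<open>(Fop + 1 + G) \<circ> (Fop + 1 + G')\<close> vanishes on all thin vectors, so on the first sphere it is a multiple of the all-ones
  matrix. The two claims compare a diagonal entry and an entry at two nonadjacent vertices.\<close>

lemma local_identity:
  assumes span: "\<And>v. lev 1 v = v \<Longrightarrow> v \<in> vec.span (insert (sph 1) {w. thin_vec w})"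
    and ev: "\<And>w g. chain w g \<Longrightarrow> g 1 = G \<or> g 1 = G'"
  defines "\<kappa> \<equiv> (a 1 + (1 + G)) * (a 1 + (1 + G'))"
  shows "(a 1 + (1 + G) * (1 + G')) * b 0 = \<kappa>" "\<exists>n::nat. real n = a 1 + (1 + G) * (1 + G')"
proof -
  define K where "K v = Fop (Fop v) + (2 + G + G') *\<^sub>R Fop v + ((1 + G) * (1 + G')) *\<^sub>R v" for v
  have b0: "b 0 > 0" using b_pos D_pos by simp
  \<comment> \<open>The scalar is read off from \<open>sph 1\<close>, whose entries sum to
    \<open>b 0\<close>.\<close>
  have KK: "K v = ((\<Sum>y\<in>UNIV. v $ y) * of_real (\<kappa> / b 0)) *s sph 1" if "lev 1 v = v" for v
    using span[OF that]
  proof (induction rule: vec.span_induct_alt)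
    case base
    then show ?case by (simp add: K_def)
  next
    case (step r u v)
    have "K u = ((\<Sum>y\<in>UNIV. u $ y) * of_real (\<kappa> / b 0)) *s sph 1"
    proof (cases "u = sph 1")
      case True
      have "K u = \<kappa> *\<^sub>R sph 1"
        unfolding True K_def sph_F relop_scaleR \<kappa>_def by (simp add: algebra_simps)
      then show ?thesis
        unfolding True sum_sph_1 using b0 by (simp add: smult_complex_of_real[symmetric])
    next
      case False
      then have "thin_vec u" using step by simp
      then obtain g where g: "chain u g" using thin_chain by blast
      have "K u = ((- 1 - g 1) * (- 1 - g 1) + (2 + G + G') * (- 1 - g 1) + (1 + G) * (1 + G')) *\<^sub>R u"
        unfolding K_def chain_F[OF g] relop_scaleR by (simp only: scaleR_scaleR scaleR_add_left)
      also have "(- 1 - g 1) * (- 1 - g 1) + (2 + G + G') * (- 1 - g 1) + (1 + G) * (1 + G') = (g 1 - G) * (g 1 - G')"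
        by (simp add: algebra_simps)
      also have "\<dots> = 0" using ev[OF g] by auto
      finally show ?thesis using g by (simp add: chain_def local_vec_def)
    qed
    moreover have "K (r *s u + v) = r *s K u + K v"
    proof -
      have sw: "t *\<^sub>R (r *s w) = r *s (t *\<^sub>R w)" for t and w :: "complex ^ 'a"
        by (simp add: smult_complex_of_real[symmetric] mult.commute)
      show ?thesis
        unfolding K_def relop_add relop_smult scaleR_right_distrib sw vec.scale_right_distrib by (simp only: add_ac)
    qed
    ultimately show ?case
      using step by (simp add: sum.distrib sum_distrib_left[symmetric] vec.scale_left_distrib mult.assoc distrib_right add_divide_distrib)
  qed
  obtain y where y: "E x y" using sphere_nonempty[of 1] D_pos by (auto simp: d_eq_1)
  have dy: "d x y = 1" using y d_eq_1 by simp
  have "lev 1 (axis y 1) = axis y (1::complex)" unfolding cvec_eq_iff lev_nth using dy by (auto simp: axis_def)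
  moreover have "(\<Sum>z\<in>UNIV. axis y (1::complex) $ z) = 1" by (simp add: axis_def)
  ultimately have Ky: "K (axis y 1) = of_real (\<kappa> / b 0) *s sph 1" using KK[of "axis y 1"] by simp
  have entry: "complex_of_real (real (card {u. E z u \<and> d x z = d x u \<and> E u y \<and> d x u = d x y})
      + (2 + G + G') * (if E z y \<and> d x z = d x y then 1 else 0) + (1 + G) * (1 + G') * (if z = y then 1 else 0))
      = of_real (\<kappa> / b 0)" if z: "E x z" for z
  proof -
    have "K (axis y 1) $ z = of_real (\<kappa> / b 0)" unfolding Ky using z by (simp add: sph_def d_eq_1)
    then show ?thesis
      unfolding K_def vector_add_component vector_scaleR_component F_axis FF_axis
      by (auto simp: axis_def scaleR_conv_of_real split: if_splits)
  qed
  have "{u. E y u \<and> d x y = d x u \<and> E u y \<and> d x u = d x y} = {u. E y u \<and> d u x = d y x}"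
    using E_sym by (auto simp: d_commute)
  then have "real (card {u. E y u \<and> d x y = d x u \<and> E u y \<and> d x u = d x y}) = a 1"
    using card_a[of y x] dy d_commute[of y x] by simp
  then have diag: "a 1 + (1 + G) * (1 + G') = \<kappa> / b 0"
    using entry[OF y] by (simp only: of_real_eq_iff) simp
  then show "(a 1 + (1 + G) * (1 + G')) * b 0 = \<kappa>" using b0 by (simp add: field_simps)
  have "real (card {w. E x w \<and> d w y = Suc (d x y)}) > 0" unfolding card_b using dy b_pos[of 1] D_ge by simp
  then obtain z where z: "E x z" "d z y = 2" using dy by (auto simp: card_gt_0_iff)
  then have "\<not> E z y" "z \<noteq> y" using d_eq_1[of z y] by auto
  then show "\<exists>n::nat. real n = a 1 + (1 + G) * (1 + G')"
    unfolding diag using entry[OF z(1)] by (simp only: of_real_eq_iff) auto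
qed

end

section \<open>Case analysis on the local eigenvalues\<close>

context uniform_graph
begin

lemma alpha_eq_0:
  assumes span: "\<And>v. lev 1 v = v \<Longrightarrow> v \<in> vec.span (insert (sph 1) {w. thin_vec w})"
  shows "\<alpha> = 0"
proof (rule ccontr)
  assume \<alpha>: "\<alpha> \<noteq> 0"
  have id: "(a 1 + (1 + G) * (1 + G')) * b 0 = (a 1 + (1 + G)) * (a 1 + (1 + G'))"
    "\<exists>n::nat. real n = a 1 + (1 + G) * (1 + G')"
    if "\<And>w g. chain w g \<Longrightarrow> g 1 = G \<or> g 1 = G'" for G G'
    using local_identity[of G G'] span that by blast+
  define N where "N = br D"
  have a1: "a 1 = \<beta> + \<alpha> * (N - 1) - 1" and b0: "b 0 = N * \<beta>"
    using parameter_forms(1,6) by (simp_all add: N_def)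
  have N1: "N - 1 > 0" using br_diff_pos[of 1] D_ge by (simp add: N_def)
  have beta: "\<beta> > 0" using b_pos[OF D_pos] N1 unfolding b0 by (simp add: zero_less_mult_iff)
  have ba: "\<beta> - \<alpha> > 0" using beta_alpha_pos[of 1] D_ge by simp
  have kne: "b 0 \<noteq> a 1 + 1" using b_pos[of 1] D_ge by (simp add: a_def)
  have ev: "g 1 = 0 \<or> g 1 = q \<or> g 1 = \<alpha> - \<beta> \<or> g 1 = - \<alpha> * (N - 1)" if "chain w g" for w g
    using chain_eigenvalue[OF that] by (simp add: N_def)
  show False
  \<comment> \<open>For \<beta> = \<alpha> N the fourth value coincides with \<alpha> - \<beta>, so
    it counts as a separate value only otherwise.\<close>
  proof (cases "\<exists>w g. chain w g \<and> g 1 = - \<alpha> * (N - 1) \<and> \<beta> \<noteq> \<alpha> * N")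
    case True
    then obtain w0 g0 where full: "chain w0 g0" "g0 1 = - \<alpha> * (br D - 1)" "\<beta> \<noteq> \<alpha> * br D"
      unfolding N_def by blast
    have no0: "g 1 \<noteq> 0" if "chain w g" for w g
      using full_chains_exclusive[OF that _ full] \<alpha> by blast
    show False
    proof (cases "\<exists>w g. chain w g \<and> g 1 = q")
      case True
      then have "g 1 \<noteq> \<alpha> - \<beta>" if "chain w g" for w g
        using tight_chains_exclusive[OF _ _ that] \<alpha> by blast
      then have ev': "g 1 = - \<alpha> * (N - 1) \<or> g 1 = q" if "chain w g" for w g
        using ev[OF that] no0[OF that] that by blast
      have "(a 1 + (1 + - \<alpha> * (N - 1)) * (1 + q)) * b 0 = (a 1 + (1 + - \<alpha> * (N - 1))) * (a 1 + (1 + q))"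
        by (rule id(1)) (rule ev')
      then have "\<beta> * ((N - 1) * (\<beta> + q - \<alpha> * (1 + q * N))) = 0"
        unfolding a1 b0 by Groebner_Basis.algebra
      then have bq: "\<beta> = \<alpha> * (1 + q * br D) - q" using beta N1 by (simp add: N_def)
      obtain n :: nat where "real n = a 1 + (1 + - \<alpha> * (N - 1)) * (1 + q)"
        using id(2)[of "- \<alpha> * (N - 1)" q] ev' by blast
      then have "real n = \<beta> + q - q * (\<alpha> * (N - 1))" unfolding a1 by (simp add: algebra_simps)
      then have n: "real n = \<alpha> * (1 + q)" using bq by (simp add: N_def algebra_simps)
      have "\<alpha> * (1 + q * N) > 0" using bq beta q_pos by (simp add: N_def)
      moreover have "1 + q * N > 0" using N1 q_pos by (simp add: add_pos_pos)
      ultimately have "\<alpha> > 0" by (simp add: zero_less_mult_iff)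
      then have "real n > 0" unfolding n using q_pos by simp
      then have "\<alpha> * (1 + q) \<ge> 1" unfolding n[symmetric] by simp
      then show False using full_chain_contradiction[OF full bq] by blast
    next
      case False
      then have ev': "g 1 = - \<alpha> * (N - 1) \<or> g 1 = \<alpha> - \<beta>" if "chain w g" for w g
        using ev[OF that] no0[OF that] that by blast
      have "(a 1 + (1 + - \<alpha> * (N - 1)) * (1 + (\<alpha> - \<beta>))) * b 0
          = (a 1 + (1 + - \<alpha> * (N - 1))) * (a 1 + (1 + (\<alpha> - \<beta>)))"
        by (rule id(1)) (rule ev')
      then have "N * \<beta> * (\<alpha> * (N - 1) * (\<beta> - \<alpha>)) = 0"
        unfolding a1 b0 by Groebner_Basis.algebra
      then show False using \<alpha> beta ba N1 by simp
    qed
  next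
    case no_full: False
    have ev3: "g 1 = 0 \<or> g 1 = q \<or> g 1 = \<alpha> - \<beta>" if "chain w g" for w g
    proof (cases "\<beta> = \<alpha> * N")
      case True
      then have "- \<alpha> * (N - 1) = \<alpha> - \<beta>" by (simp add: algebra_simps)
      then show ?thesis using ev[OF that] by metis
    next
      case False
      then show ?thesis using ev[OF that] no_full that by blast
    qed
    show False
    proof (cases "\<exists>w g. chain w g \<and> g 1 = q")
      case True
      then have "g 1 \<noteq> \<alpha> - \<beta>" if "chain w g" for w g
        using tight_chains_exclusive[OF _ _ that] \<alpha> by blast
      then have ev': "g 1 = 0 \<or> g 1 = q" if "chain w g" for w g
        using ev3[OF that] that by blast
      have "(a 1 + (1 + 0) * (1 + q)) * b 0 = (a 1 + (1 + 0)) * (a 1 + (1 + q))"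
        by (rule id(1)) (rule ev')
      then have "(a 1 + 1 + q) * (b 0 - (a 1 + 1)) = 0" by (simp add: algebra_simps)
      moreover have "a 1 + 1 + q > 0" using a_1_nonneg q_pos by simp
      ultimately show False using kne by simp
    next
      case False
      then have ev': "g 1 = 0 \<or> g 1 = \<alpha> - \<beta>" if "chain w g" for w g
        using ev3[OF that] that by blast
      have "(a 1 + (1 + 0) * (1 + (\<alpha> - \<beta>))) * b 0 = (a 1 + (1 + 0)) * (a 1 + (1 + (\<alpha> - \<beta>)))"
        by (rule id(1)) (rule ev')
      then have "(a 1 + (1 + (\<alpha> - \<beta>))) * (b 0 - (a 1 + 1)) = 0" by (simp add: algebra_simps)
      moreover have "a 1 + (1 + (\<alpha> - \<beta>)) = \<alpha> * N" unfolding a1 by (simp add: algebra_simps)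
      ultimately show False using kne \<alpha> N1 by simp
    qed
  qed
qed

end

theorem theorem8p3:
  fixes E :: "'a::finite \<Rightarrow> 'a \<Rightarrow> bool"
    and x :: 'a
    and D :: nat
    and q \<alpha> \<beta> :: real
  assumes "connected_simple_graph E"
    and "\<not> bipartite E"
    and "distance_regular E"
    and "has_classical_parameters E D q \<alpha> \<beta>"
    and "D \<ge> 4"
    and "q \<ge> 2"
    and "\<And>W. irreducible_T_module E x W \<Longrightarrow> module_endpoint E x W = 1 \<Longrightarrow> thin_module E x W"
    and "supports_uniform_structure E x"
  shows "\<alpha> = 0 \<or>
    (D mod 6 = 0 \<and> has_classical_parameters E D q q (q ^ 2 * (q ^ D - 1) / (q - 1)))"
proof -
  interpret classical_graph E x D q \<alpha> \<beta>
    by unfold_locales (use assms in auto)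
  obtain e f where pm: "parameter_matrix D e" and row: "\<And>i v. i \<in> {1..D} \<Longrightarrow> v \<in> range (lev i) \<Longrightarrow>
      e_minus e i *s Rop (Lop (Lop v)) + Lop (Rop (Lop v)) + e_plus D e i *s Lop (Lop (Rop v)) = f i *s Lop v"
    using assms(8) unfolding supports_uniform_structure_def Let_def diameter matrix_vector_mul_assoc[symmetric]
      lowering_mult raising_mult dual_idempotent_mult by blast
  interpret uniform_graph E x D q \<alpha> \<beta> e f
  proof unfold_locales
    fix i v assume "1 \<le> i" "i \<le> D" "lev i v = v"
    moreover from this have "v \<in> range (lev i)" by (intro range_eqI[of _ _ v]) simp
    ultimately show "e_minus e i *s Rop (Lop (Lop v)) + Lop (Rop (Lop v)) + e_plus D e i *s Lop (Lop (Rop v)) = f i *s Lop v"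
      using row by simp
  qed (rule pm)
  show ?thesis using alpha_eq_0[OF span_local[OF assms(7)]] by blast
qed

end
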